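(* Let $n\ge 2$. There exists $\delta=\delta(n)>0$ such that for every origin-symmetric convex body $K\subset\mathbb{R}^n$ with $d_{BM}(K,B_\infty^n)\le 1+\delta$ one has $$\mathcal{P}(K)\ \ge\ \mathcal{P}(B_\infty^n),$$ and, moreover, for such $K$ the equality $\mathcal{P}(K)=\mathcal{P}(B_\infty^n)$ holds only if $d_{BM}(K,B_\infty^n)=1$, i.e., only if $K$ is a parallelepiped.
   Context: A convex body in $\mathbb{R}^n$ is a compact convex set with nonempty interior; it is origin-symmetric if $K=-K$. For a convex body $K$ with the origin in its interior, the polar body is $K^*=\{\xi\in\mathbb{R}^n: x\cdot\xi\le 1\ \ \forall x\in K\}$, and the volume product is $\mathcal{P}(K)=\mathrm{vol}_n(K)\,\mathrm{vol}_n(K^* )$. The cube is $B_\infty^n=\{x\in\mathbb{R}^n: |x_i|\le 1,\ 1\le i\le n\}$. The (multiplicative) Banach–Mazur distance between origin-symmetric convex bodies $K,L\subset\mathbb{R}^n$ is $$d_{BM}(K,L)=\inf\{b/a:\ a,b>0,\ \exists\, T\in GL(n)\text{ such that } aK\subseteq TL\subseteq bK\}.$$ A parallelepiped (centered at the origin) is a set of the form $TB_\infty^n$ with $T\in GL(n)$. *)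

theory Defs
  imports "HOL-Analysis.Analysis"
begin

definition convex_body :: "'a::euclidean_space set \<Rightarrow> bool" where
  "convex_body K \<longleftrightarrow> compact K \<and> convex K \<and> interior K \<noteq> {}"

definition origin_symmetric :: "'a::euclidean_space set \<Rightarrow> bool" where
  "origin_symmetric K \<longleftrightarrow> K = uminus ` K"

definition polar :: "'a::euclidean_space set \<Rightarrow> 'a set" where
  "polar K = {\<xi>. \<forall>x\<in>K. x \<bullet> \<xi> \<le> 1}"

(* For K with the origin in its interior, the polar is bounded, so both volumes are finite. *)
definition volume_product :: "'a::euclidean_space set \<Rightarrow> real" where
  "volume_product K = measure lebesgue K * measure lebesgue (polar K)"

definition unit_cube :: "(real ^ 'n::finite) set" where
  "unit_cube = {x. \<forall>i. \<bar>x $ i\<bar> \<le> 1}"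

(* The set is nonempty for origin-symmetric convex bodies, so the real infimum is the intended one. *)
definition banach_mazur_dist :: "(real ^ 'n::finite) set \<Rightarrow> (real ^ 'n) set \<Rightarrow> real" where
  "banach_mazur_dist K L =
    Inf {b / a | a b. a > 0 \<and> b > 0 \<and>
      (\<exists>T :: real ^ 'n ^ 'n. invertible T \<and>
        (\<lambda>x. a *\<^sub>R x) ` K \<subseteq> (\<lambda>x. T *v x) ` L \<and>
        (\<lambda>x. T *v x) ` L \<subseteq> (\<lambda>x. b *\<^sub>R x) ` K)}"

definition parallelepiped :: "(real ^ 'n::finite) set \<Rightarrow> bool" where
  "parallelepiped P \<longleftrightarrow>
    (\<exists>T :: real ^ 'n ^ 'n. invertible T \<and> P = (\<lambda>x. T *v x) ` unit_cube)"

end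

theory Submission
  imports Defs
begin

text \<open>
  Write \<open>B\<close> for the cube and \<open>B*\<close> for its polar, the cross-polytope. After a linear map, a body \<open>K\<close> close to
  a cube lies in \<open>B\<close> and contains the facet centres \<open>axis i 1\<close>: take for the rows of the map the points of the
  polar of \<open>K\<close> with the largest determinant (\<open>auerbach_position\<close>, \<open>near_cube\<close>). The volume product is a linear
  invariant, so it suffices to treat this contact position (\<open>normal_position\<close>).

  The faces of the cube are named by the nonzero vectors \<open>c\<close> with entries \<open>-1, 0, 1\<close>; \<open>c\<close> is the centre of its
  face and \<open>c / l1 c\<close> the centre of the dual face of \<open>B*\<close>. For each \<open>c\<close> choose \<open>x\<close> in \<open>K\<close>, supported on the
  support of \<open>c\<close>, where the functional \<open>c\<close> is largest, with value \<open>r * l1 c\<close>, and a point \<open>\<xi>\<close> of the polar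
  that equals \<open>c / (r * l1 c)\<close> on that support (\<open>contact_pair\<close>, by separation). The piecewise linear maps that
  send each \<open>c\<close> to \<open>x\<close>, respectively to \<open>l1 c * \<xi>\<close>, carry \<open>B\<close> into \<open>K\<close> and \<open>B*\<close> into the polar of \<open>K\<close>.
  They are small Lipschitz perturbations of the identity, hence injective, and the volume of the image is the
  integral of a determinant, which is one plus the divergence up to a quadratic error. By the symmetries of the
  cube the mean gradient of the barycentric coordinate of \<open>c\<close> is a multiple of \<open>c\<close>, and relative to
  the volume the multiple is the same for \<open>B\<close> and \<open>B*\<close> (\<open>integral_grad_inner\<close>). So the shift of \<open>x\<close> enters only through \<open>r - 1\<close>, the
  shift of \<open>\<xi>\<close> only through \<open>1 / r - 1\<close>, with equal coefficients; as \<open>r + 1 / r \<ge> 2\<close>, the volume product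
  drops at most by a quadratic term in the distance \<open>\<delta>\<close> to the cube (\<open>piecewise_linear_volume\<close>).

  A gain that is linear in \<open>\<delta>\<close> compensates for this. Some vertex \<open>v\<close> has its contact point at distance
  exactly \<open>\<delta>\<close> from a facet containing it. Halfway between \<open>v\<close> and the centre of this facet, either \<open>K\<close> reaches
  beyond the image of \<open>B\<close> by a multiple of \<open>\<delta>\<close>, or a functional separates, and then the polar has a point beyond
  the facet of \<open>B*\<close> belonging to \<open>v\<close>. In both cases the corresponding map can be pushed outwards by a bump
  centred on a facet, and only the normal component of the push changes the volume to first order
  (\<open>half_ball_integral\<close>). Thus the volume product is strictly larger unless \<open>\<delta> = 0\<close>, that is \<open>K = B\<close>.
\<close>

section \<open>Barycentric coordinates for the faces of the cube\<close>

text \<open>The coordinates of a point that exceed the height \<open>t\<close> in absolute value, with their signs, form a face vector.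
  The length of the set of heights that produce \<open>c\<close> is the barycentric coordinate of \<open>c\<close> in the fan over the
  barycentric subdivision of the cube. This layer-cake form avoids sorting the coordinates.\<close>
definition level :: "real \<Rightarrow> real \<Rightarrow> real" where
  "level t a = (if t < \<bar>a\<bar> then sgn a else 0)"

definition layer :: "real^'n \<Rightarrow> real^'n \<Rightarrow> real set" where
  "layer c x = {t. 0 \<le> t \<and> (\<forall>i. level t (x $ i) = c $ i)}"

definition weight :: "real^'n \<Rightarrow> real^'n \<Rightarrow> real" where
  "weight c x = measure lborel (layer c x)"

definition faces :: "(real^'n) set" where
  "faces = {c. c \<noteq> 0 \<and> (\<forall>i. c $ i \<in> {-1, 0, 1})}"

definition l1 :: "real^'n \<Rightarrow> real" where
  "l1 x = (\<Sum>i\<in>UNIV. \<bar>x $ i\<bar>)"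

lemma finite_faces: "finite (faces :: (real^'n::finite) set)"
proof -
  have "finite {f :: 'n \<Rightarrow> real. \<forall>i. f i \<in> {-1,0,1}}"
    using finite_PiE[of "UNIV :: 'n set" "\<lambda>_. {-1,0,1::real}"]
    by (simp add: PiE_def Pi_def)
  then have "finite (vec_lambda ` {f :: 'n \<Rightarrow> real. \<forall>i. f i \<in> {-1,0,1}})"
    by (rule finite_imageI)
  moreover have "faces \<subseteq> vec_lambda ` {f :: 'n \<Rightarrow> real. \<forall>i. f i \<in> {-1,0,1}}"
  proof
    fix c :: "real^'n" assume "c \<in> faces"
    then have "(\<lambda>i. c $ i) \<in> {f. \<forall>i. f i \<in> {-1,0,1}}" by (auto simp: faces_def)
    moreover have "c = vec_lambda (\<lambda>i. c $ i)" by simp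
    ultimately show "c \<in> vec_lambda ` {f :: 'n \<Rightarrow> real. \<forall>i. f i \<in> {-1,0,1}}" by blast
  qed
  ultimately show ?thesis by (rule finite_subset[rotated])
qed

lemma faces_nonzero: "c \<in> faces \<Longrightarrow> \<exists>i. c $ i \<noteq> 0"
  by (auto simp: faces_def vec_eq_iff)

lemma faces_cases: "c \<in> faces \<Longrightarrow> c $ i = -1 \<or> c $ i = 0 \<or> c $ i = 1"
  by (auto simp: faces_def)

lemma layer_measurable [measurable]: "layer c (x :: real^'n::finite) \<in> sets borel"
  unfolding layer_def level_def by measurable

lemma layer_subset:
  assumes "c $ i \<noteq> 0"
  shows "layer c x \<subseteq> {0..<\<bar>x $ i\<bar>}"
proof
  fix t assume "t \<in> layer c x"
  then have "0 \<le> t" "level t (x $ i) = c $ i" by (auto simp: layer_def)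
  then show "t \<in> {0..<\<bar>x $ i\<bar>}" using assms by (auto simp: level_def split: if_splits)
qed

lemma layer_emeasure_finite:
  assumes "c \<in> faces" shows "emeasure lborel (layer c (x :: real^'n::finite)) \<noteq> \<infinity>"
proof -
  obtain i where i: "c $ i \<noteq> 0" using faces_nonzero[OF assms] by blast
  have "emeasure lborel (layer c x) \<le> emeasure lborel {0..<\<bar>x $ i\<bar>}"
    using layer_subset[OF i] by (rule emeasure_mono) simp
  also have "\<dots> < \<infinity>" by simp
  finally show ?thesis by simp
qed

lemma layer_disjoint: "disjoint_family_on (\<lambda>c. layer c x) A"
  by (auto simp: disjoint_family_on_def layer_def vec_eq_iff)

lemma weight_nonneg: "0 \<le> weight c x"
  by (simp add: weight_def)

lemma sum_weight_Union:
  assumes "A \<subseteq> faces"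
  shows "(\<Sum>c\<in>A. weight c (x :: real^'n::finite)) = measure lborel (\<Union>c\<in>A. layer c x)"
  unfolding weight_def
proof (rule measure_finite_Union[symmetric])
  show "finite A" using assms finite_faces finite_subset by blast
  show "(\<lambda>c. layer c x) ` A \<subseteq> sets lborel" by (auto intro: layer_measurable[simplified])
  show "disjoint_family_on (\<lambda>c. layer c x) A" by (rule layer_disjoint)
  show "emeasure lborel (layer c x) \<noteq> \<infinity>" if "c \<in> A" for c
    using that assms layer_emeasure_finite by blast
qed

lemma level_mem: "level t a \<in> {-1,0,1}"
  by (auto simp: level_def sgn_real_def)

text \<open>The layers of the faces that involve coordinate \<open>i\<close> partition the heights below \<open>\<bar>x $ i\<bar>\<close>.\<close>
lemma sum_weight_coord:
  fixes x :: "real^'n::finite"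
  shows "(\<Sum>c | c \<in> faces \<and> c $ i \<noteq> 0. weight c x) = \<bar>x $ i\<bar>"
proof -
  have "(\<Union>c\<in>{c \<in> faces. c $ i \<noteq> 0}. layer c x) = {0..<\<bar>x $ i\<bar>}"
  proof
    show "(\<Union>c\<in>{c \<in> faces. c $ i \<noteq> 0}. layer c x) \<subseteq> {0..<\<bar>x $ i\<bar>}"
      using layer_subset by blast
    show "{0..<\<bar>x $ i\<bar>} \<subseteq> (\<Union>c\<in>{c \<in> faces. c $ i \<noteq> 0}. layer c x)"
    proof
      fix t assume t: "t \<in> {0..<\<bar>x $ i\<bar>}"
      define c :: "real^'n" where "c = (\<chi> k. level t (x $ k))"
      have ci: "c $ i \<noteq> 0" using t by (auto simp: c_def level_def sgn_real_def)
      have "c \<in> faces" using ci level_mem by (auto simp: faces_def c_def vec_eq_iff)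
      moreover have "t \<in> layer c x" using t by (simp add: layer_def c_def)
      ultimately show "t \<in> (\<Union>c\<in>{c \<in> faces. c $ i \<noteq> 0}. layer c x)" using ci by blast
    qed
  qed
  then show ?thesis
    using sum_weight_Union[of "{c \<in> faces. c $ i \<noteq> 0}" x] by auto
qed

lemma weight_sgn:
  assumes "c $ i \<noteq> 0" "weight c x \<noteq> 0" shows "c $ i = sgn (x $ i)"
proof -
  have "layer c x \<noteq> {}" using assms(2) by (auto simp: weight_def)
  then obtain t where "level t (x $ i) = c $ i" by (auto simp: layer_def)
  then show ?thesis using assms(1) by (auto simp: level_def split: if_splits)
qed

lemma sum_weight_abs:
  fixes x :: "real^'n::finite"
  shows "(\<Sum>c\<in>faces. weight c x * \<bar>c $ i\<bar>) = \<bar>x $ i\<bar>"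
proof -
  have "(\<Sum>c\<in>faces. weight c x * \<bar>c $ i\<bar>) = (\<Sum>c | c \<in> faces \<and> c $ i \<noteq> 0. weight c x)"
    by (rule sum.mono_neutral_cong_right) (auto simp: finite_faces dest: faces_cases[of _ i])
  then show ?thesis by (simp add: sum_weight_coord)
qed

lemma sum_weight_scaleR:
  fixes x :: "real^'n::finite"
  shows "(\<Sum>c\<in>faces. weight c x *\<^sub>R c) = x"
proof -
  have "(\<Sum>c\<in>faces. weight c x * c $ i) = x $ i" for i
  proof -
    have "weight c x * c $ i = sgn (x $ i) * (weight c x * \<bar>c $ i\<bar>)" if "c \<in> faces" for c
      using weight_sgn[of c i x] faces_cases[OF that, of i] by (cases "weight c x = 0") auto
    then have "(\<Sum>c\<in>faces. weight c x * c $ i) = sgn (x $ i) * (\<Sum>c\<in>faces. weight c x * \<bar>c $ i\<bar>)"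
      unfolding sum_distrib_left by (intro sum.cong) auto
    then show ?thesis by (simp add: sum_weight_abs sgn_mult_abs)
  qed
  then show ?thesis by (simp add: vec_eq_iff sum_component)
qed

lemma sum_weight_l1:
  fixes x :: "real^'n::finite"
  shows "(\<Sum>c\<in>faces. weight c x * l1 c) = l1 x"
proof -
  have "(\<Sum>c\<in>faces. weight c x * l1 c) = (\<Sum>i\<in>UNIV. \<Sum>c\<in>faces. weight c x * \<bar>c $ i\<bar>)"
    unfolding l1_def sum_distrib_left by (rule sum.swap)
  then show ?thesis by (simp add: sum_weight_abs l1_def)
qed

lemma sum_weight_le:
  fixes x :: "real^'n::finite"
  assumes "\<And>i. \<bar>x $ i\<bar> \<le> 1"
  shows "(\<Sum>c\<in>faces. weight c x) \<le> 1"
proof -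
  have "(\<Union>c\<in>faces. layer c x) \<subseteq> {0..<1}"
  proof
    fix t assume "t \<in> (\<Union>c\<in>faces. layer c x)"
    then obtain c where c: "c \<in> faces" "t \<in> layer c x" by blast
    obtain i where "c $ i \<noteq> 0" using faces_nonzero c by blast
    then show "t \<in> {0..<1}" using layer_subset[of c i x] c assms[of i] by force
  qed
  then have "measure lborel (\<Union>c\<in>faces. layer c x) \<le> measure lborel {0..<1::real}"
    by (rule measure_mono_fmeasurable) (auto simp: fmeasurable_def finite_faces intro!: sets.finite_UN layer_measurable[simplified])
  then show ?thesis using sum_weight_Union[of faces x] by simp
qed

text \<open>Heights at which two coordinates differ lie between their absolute values, or below the larger one if the
  signs differ; summed over the coordinates this makes the weights Lipschitz.\<close>
lemma level_diff:
  "\<exists>l u. l \<le> u \<and> u - l \<le> \<bar>a - b\<bar> \<and> {t. 0 \<le> t \<and> level t a \<noteq> level t b} \<subseteq> {l..<u}"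
proof (cases "sgn a = sgn b")
  case True
  have "{t. 0 \<le> t \<and> level t a \<noteq> level t b} \<subseteq> {min \<bar>a\<bar> \<bar>b\<bar>..<max \<bar>a\<bar> \<bar>b\<bar>}"
    using True by (auto simp: level_def)
  moreover have "max \<bar>a\<bar> \<bar>b\<bar> - min \<bar>a\<bar> \<bar>b\<bar> \<le> \<bar>a - b\<bar>" by linarith
  moreover have "min \<bar>a\<bar> \<bar>b\<bar> \<le> max \<bar>a\<bar> \<bar>b\<bar>" by linarith
  ultimately show ?thesis by blast
next
  case False
  have "{t. 0 \<le> t \<and> level t a \<noteq> level t b} \<subseteq> {0..<max \<bar>a\<bar> \<bar>b\<bar>}"
    by (auto simp: level_def)
  moreover have "max \<bar>a\<bar> \<bar>b\<bar> - 0 \<le> \<bar>a - b\<bar>"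
    using False by (cases "a > 0"; cases "b > 0"; cases "a = 0"; cases "b = 0") auto
  moreover have "0 \<le> max \<bar>a\<bar> \<bar>b\<bar>" by linarith
  ultimately show ?thesis by blast
qed

lemma weight_lipschitz_aux:
  fixes x y :: "real^'n::finite"
  assumes c: "c \<in> faces"
  shows "weight c x \<le> weight c y + l1 (x - y)"
proof -
  have "\<forall>i. \<exists>J. J \<in> fmeasurable lborel \<and> measure lborel J \<le> \<bar>x $ i - y $ i\<bar> \<and>
      {t. 0 \<le> t \<and> level t (x $ i) \<noteq> level t (y $ i)} \<subseteq> J"
  proof
    fix i
    obtain l u where "l \<le> u" "u - l \<le> \<bar>x $ i - y $ i\<bar>"
      "{t. 0 \<le> t \<and> level t (x $ i) \<noteq> level t (y $ i)} \<subseteq> {l..<u}"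
      using level_diff by blast
    then show "\<exists>J. J \<in> fmeasurable lborel \<and> measure lborel J \<le> \<bar>x $ i - y $ i\<bar> \<and>
      {t. 0 \<le> t \<and> level t (x $ i) \<noteq> level t (y $ i)} \<subseteq> J"
      by (intro exI[of _ "{l..<u}"]) (simp add: fmeasurable_def)
  qed
  from choice[OF this] obtain I where I0: "\<forall>i. I i \<in> fmeasurable lborel \<and>
      measure lborel (I i) \<le> \<bar>x $ i - y $ i\<bar> \<and>
      {t. 0 \<le> t \<and> level t (x $ i) \<noteq> level t (y $ i)} \<subseteq> I i"
    by (rule exE)
  have I: "\<And>i. I i \<in> fmeasurable lborel"
      "\<And>i. measure lborel (I i) \<le> \<bar>x $ i - y $ i\<bar>"
      "\<And>i. {t. 0 \<le> t \<and> level t (x $ i) \<noteq> level t (y $ i)} \<subseteq> I i"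
    using I0 by blast+
  have sub: "layer c x \<subseteq> layer c y \<union> (\<Union>i. I i)"
  proof
    fix t assume t: "t \<in> layer c x"
    show "t \<in> layer c y \<union> (\<Union>i. I i)"
    proof (cases "\<forall>i. level t (x $ i) = level t (y $ i)")
      case True then show ?thesis using t by (simp add: layer_def)
    next
      case False
      then obtain i where "level t (x $ i) \<noteq> level t (y $ i)" by blast
      moreover have "0 \<le> t" using t by (simp add: layer_def)
      ultimately have "t \<in> I i" using I(3)[of i] by blast
      then show ?thesis by blast
    qed
  qed
  have fin: "layer c z \<in> fmeasurable lborel" for z
    using layer_emeasure_finite[OF c, of z] by (simp add: fmeasurable_def top.not_eq_extremum layer_measurable[simplified])
  have finI: "(\<Union>i. I i) \<in> fmeasurable lborel"
    by (rule fmeasurable.finite_UN) (auto simp: I)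
  have "weight c x \<le> measure lborel (layer c y \<union> (\<Union>i. I i))"
    unfolding weight_def
    by (rule measure_mono_fmeasurable) (use sub fin finI in \<open>auto intro: fmeasurableD\<close>)
  also have "\<dots> \<le> measure lborel (layer c y) + measure lborel (\<Union>i. I i)"
    using fin finI by (intro measure_Un_le) (auto intro: fmeasurableD)
  also have "measure lborel (\<Union>i. I i) \<le> (\<Sum>i\<in>UNIV. measure lborel (I i))"
    by (rule measure_UNION_le) (use fmeasurableD[OF I(1)] in auto)
  also have "\<dots> \<le> l1 (x - y)" unfolding l1_def by (intro sum_mono) (simp add: I(2))
  finally show ?thesis by (simp add: weight_def)
qed

lemma l1_minus_commute: "l1 (x - y) = l1 (y - x)"
  by (simp add: l1_def abs_minus_commute)

lemma weight_lipschitz: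
  fixes x y :: "real^'n::finite"
  assumes "c \<in> faces"
  shows "\<bar>weight c x - weight c y\<bar> \<le> l1 (x - y)"
  using weight_lipschitz_aux[OF assms, of x y] weight_lipschitz_aux[OF assms, of y x] l1_minus_commute[of x y]
  by linarith

lemma l1_le_norm: "l1 (x :: real^'n::finite) \<le> real CARD('n) * norm x"
proof -
  have "l1 x \<le> (\<Sum>i\<in>(UNIV::'n set). norm x)" unfolding l1_def
    by (intro sum_mono component_le_norm_cart)
  then show ?thesis by simp
qed

lemma norm_le_l1_vec: "norm (x :: real^'n::finite) \<le> l1 x"
  unfolding l1_def by (rule norm_le_l1_cart)

section \<open>Gradients of the coordinates at generic points\<close>

lemma level_nonzero_iff:
  assumes "e = 1 \<or> e = -1" "0 \<le> t" shows "level t a = e \<longleftrightarrow> t < e * a"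
  using assms by (auto simp: level_def sgn_real_def)

lemma level_zero_iff:
  assumes "0 \<le> t" shows "level t a = 0 \<longleftrightarrow> \<bar>a\<bar> \<le> t"
  using assms by (auto simp: level_def sgn_real_def)

lemma mem_layer:
  assumes "c \<in> faces"
  shows "t \<in> layer c x \<longleftrightarrow> 0 \<le> t \<and> (\<forall>k. if c $ k = 0 then \<bar>x $ k\<bar> \<le> t else t < c $ k * x $ k)"
proof -
  have "level t (x $ k) = c $ k \<longleftrightarrow> (if c $ k = 0 then \<bar>x $ k\<bar> \<le> t else t < c $ k * x $ k)" if "0 \<le> t" for k
    using level_nonzero_iff[OF _ that, of "c $ k" "x $ k"] level_zero_iff[OF that, of "x $ k"]
      faces_cases[OF assms, of k] by (auto split: if_splits)
  then show ?thesis by (auto simp: layer_def)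
qed

text \<open>Away from ties, \<open>c\<close> has positive weight exactly when its entries are the signs of the largest coordinates.
  The weight is then the smallest coordinate on the support of \<open>c\<close> minus the largest one off the support,
  and \<open>grad\<close> is the gradient of this difference.\<close>
definition visible :: "real^'n \<Rightarrow> real^'n \<Rightarrow> bool" where
  "visible c x \<longleftrightarrow> (\<forall>i. c $ i \<noteq> 0 \<longrightarrow> 0 < c $ i * x $ i \<and> (\<forall>j. c $ j = 0 \<longrightarrow> \<bar>x $ j\<bar> < c $ i * x $ i))"

definition generic :: "(real^'n) set" where
  "generic = {x. (\<forall>i. x $ i \<noteq> 0) \<and> (\<forall>i j. i \<noteq> j \<longrightarrow> \<bar>x $ i\<bar> \<noteq> \<bar>x $ j\<bar>)}"

definition grad :: "real^'n \<Rightarrow> real^'n \<Rightarrow> real^'n" where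
  "grad c x = (\<chi> i. if visible c x then
      (if c $ i \<noteq> 0 then (if \<forall>k. c $ k \<noteq> 0 \<longrightarrow> c $ i * x $ i \<le> c $ k * x $ k then c $ i else 0)
       else (if \<forall>k. c $ k = 0 \<longrightarrow> \<bar>x $ k\<bar> \<le> \<bar>x $ i\<bar> then - sgn (x $ i) else 0)) else 0)"

lemma negligible_not_generic: "negligible (- (generic :: (real^'n::finite) set))"
proof -
  let ?H = "(\<Union>i::'n. {x :: real^'n. axis i 1 \<bullet> x = 0}) \<union>
    (\<Union>p \<in> {p :: 'n \<times> 'n. fst p \<noteq> snd p}. {x :: real^'n. (axis (fst p) 1 - axis (snd p) 1) \<bullet> x = 0}
       \<union> {x :: real^'n. (axis (fst p) 1 + axis (snd p) 1) \<bullet> x = 0})"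
  have ne1: "axis i (1::real) \<noteq> (0 :: real^'n)" for i by (simp add: axis_eq_0_iff)
  have ne2: "axis i (1::real) - axis j 1 \<noteq> (0 :: real^'n)" if "i \<noteq> j" for i j
    using that by (simp add: axis_eq_axis)
  have ne3: "axis i (1::real) + axis j 1 \<noteq> (0 :: real^'n)" if "i \<noteq> j" for i j
  proof
    assume "axis i (1::real) + axis j 1 = (0 :: real^'n)"
    then have "(axis i (1::real) + axis j 1) $ i = (0 :: real^'n) $ i" by simp
    then show False using that by (simp add: axis_def)
  qed
  have "negligible ?H"
    by (intro negligible_Un negligible_Union finite_imageI ballI)
       (auto intro!: negligible_hyperplane negligible_Un simp: ne1 ne2 ne3 axis_eq_axis)
  moreover have "- generic \<subseteq> ?H"
  proof
    fix x :: "real^'n" assume "x \<in> - generic"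
    then consider i where "x $ i = 0" | i j where "i \<noteq> j" "\<bar>x $ i\<bar> = \<bar>x $ j\<bar>"
      by (auto simp: generic_def)
    then show "x \<in> ?H"
    proof cases
      case 1 then show ?thesis by (auto simp: inner_axis' intro: exI[of _ i])
    next
      case 2
      then have "x $ i - x $ j = 0 \<or> x $ i + x $ j = 0" by linarith
      then have "(axis i 1 - axis j 1) \<bullet> x = 0 \<or> (axis i 1 + axis j 1) \<bullet> x = 0"
        by (simp add: inner_axis' inner_diff_left inner_add_left)
      then show ?thesis using 2(1) by - (rule UnI2, rule UN_I[of "(i,j)"], auto)
    qed
  qed
  ultimately show ?thesis by (rule negligible_subset)
qed

lemma weight_not_visible:
  assumes "c \<in> faces" "\<not> visible c x" shows "weight c x = 0"
proof -
  have "layer c x = {}"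
  proof (rule ccontr)
    assume "layer c x \<noteq> {}"
    then obtain t where t: "0 \<le> t" "\<And>k. if c $ k = 0 then \<bar>x $ k\<bar> \<le> t else t < c $ k * x $ k"
      using mem_layer[OF assms(1)] by blast
    have "0 < c $ i * x $ i \<and> (\<forall>j. c $ j = 0 \<longrightarrow> \<bar>x $ j\<bar> < c $ i * x $ i)" if "c $ i \<noteq> 0" for i
    proof -
      have 1: "t < c $ i * x $ i" using t(2)[of i] that by simp
      have "\<bar>x $ j\<bar> < c $ i * x $ i" if "c $ j = 0" for j
        using t(2)[of j] that 1 by simp
      then show ?thesis using 1 t(1) by auto
    qed
    then show False using assms(2) by (auto simp: visible_def)
  qed
  then show ?thesis by (simp add: weight_def)
qed

lemma weight_eq:
  assumes c: "c \<in> faces" and i: "c $ i \<noteq> 0" "\<And>k. c $ k \<noteq> 0 \<Longrightarrow> c $ i * x $ i \<le> c $ k * x $ k"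
    and b: "0 \<le> b" "\<And>k. c $ k = 0 \<Longrightarrow> \<bar>x $ k\<bar> \<le> b" "b = 0 \<or> (\<exists>j. c $ j = 0 \<and> \<bar>x $ j\<bar> = b)"
    and "b \<le> c $ i * x $ i"
  shows "weight c (x :: real^'n::finite) = c $ i * x $ i - b"
proof -
  have "layer c x = {b..<c $ i * x $ i}"
  proof (intro set_eqI iffI)
    fix t assume "t \<in> layer c x"
    then have t: "0 \<le> t" "\<And>k. if c $ k = 0 then \<bar>x $ k\<bar> \<le> t else t < c $ k * x $ k"
      using mem_layer[OF c] by blast+
    have "b \<le> t" using b(3)
    proof
      assume "\<exists>j. c $ j = 0 \<and> \<bar>x $ j\<bar> = b"
      then obtain j where "c $ j = 0" "\<bar>x $ j\<bar> = b" by blast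
      then show ?thesis using t(2)[of j] by simp
    qed (use t in simp)
    moreover have "t < c $ i * x $ i" using t(2)[of i] i(1) by simp
    ultimately show "t \<in> {b..<c $ i * x $ i}" by simp
  next
    fix t assume "t \<in> {b..<c $ i * x $ i}"
    then have t: "b \<le> t" "t < c $ i * x $ i" by auto
    have "if c $ k = 0 then \<bar>x $ k\<bar> \<le> t else t < c $ k * x $ k" for k
      using b(2)[of k] i(2)[of k] t by auto
    then show "t \<in> layer c x" using mem_layer[OF c] t b(1) by auto
  qed
  then show ?thesis using assms(7) by (simp add: weight_def)
qed

lemma visible_argmin:
  fixes x :: "real^'n::finite"
  assumes "c \<in> faces"
  obtains i where "c $ i \<noteq> 0" "\<And>k. c $ k \<noteq> 0 \<Longrightarrow> c $ i * x $ i \<le> c $ k * x $ k"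
proof -
  have ne: "{k. c $ k \<noteq> 0} \<noteq> {}" using faces_nonzero[OF assms] by blast
  have fin: "finite ((\<lambda>k. c $ k * x $ k) ` {k. c $ k \<noteq> 0})" by simp
  have "Min ((\<lambda>k. c $ k * x $ k) ` {k. c $ k \<noteq> 0}) \<in> (\<lambda>k. c $ k * x $ k) ` {k. c $ k \<noteq> 0}"
    using ne fin by (intro Min_in) auto
  then obtain i where i: "c $ i \<noteq> 0" "Min ((\<lambda>k. c $ k * x $ k) ` {k. c $ k \<noteq> 0}) = c $ i * x $ i" by blast
  have "c $ i * x $ i \<le> c $ k * x $ k" if "c $ k \<noteq> 0" for k
    unfolding i(2)[symmetric] using fin that by (intro Min_le) auto
  then show ?thesis using that i(1) by blast
qed

lemma visible_argmax:
  fixes x :: "real^'n::finite"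
  assumes "c $ j0 = 0"
  shows "\<exists>j. c $ j = 0 \<and> (\<forall>k. c $ k = 0 \<longrightarrow> \<bar>x $ k\<bar> \<le> \<bar>x $ j\<bar>)"
proof -
  have fin: "finite ((\<lambda>k. \<bar>x $ k\<bar>) ` {k. c $ k = 0})" by simp
  have "Max ((\<lambda>k. \<bar>x $ k\<bar>) ` {k. c $ k = 0}) \<in> (\<lambda>k. \<bar>x $ k\<bar>) ` {k. c $ k = 0}"
    using assms fin by (intro Max_in) auto
  then obtain j where j: "c $ j = 0" "Max ((\<lambda>k. \<bar>x $ k\<bar>) ` {k. c $ k = 0}) = \<bar>x $ j\<bar>" by blast
  have "\<bar>x $ k\<bar> \<le> \<bar>x $ j\<bar>" if "c $ k = 0" for k
    unfolding j(2)[symmetric] using fin that by (intro Max_ge) auto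
  then show ?thesis using j(1) by blast
qed

lemma visible_abs:
  assumes "c \<in> faces" "visible c x" "c $ i \<noteq> 0" shows "c $ i * x $ i = \<bar>x $ i\<bar>"
proof -
  have "0 < c $ i * x $ i" using assms by (auto simp: visible_def)
  then have "c $ i * x $ i = \<bar>c $ i * x $ i\<bar>" by simp
  also have "\<dots> = \<bar>x $ i\<bar>" using faces_cases[OF assms(1), of i] assms(3) by (auto simp: abs_mult)
  finally show ?thesis .
qed

lemma grad_visible:
  fixes x :: "real^'n::finite"
  assumes c: "c \<in> faces" and x: "x \<in> generic" and v: "visible c x"
  shows "\<exists>i. c $ i \<noteq> 0 \<and> (\<forall>k. c $ k \<noteq> 0 \<longrightarrow> c $ i * x $ i \<le> c $ k * x $ k) \<and>
    (\<forall>k. c $ k \<noteq> 0 \<longrightarrow> grad c x $ k = (if k = i then c $ k else 0))"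
proof -
  obtain i where i: "c $ i \<noteq> 0" "\<And>k. c $ k \<noteq> 0 \<Longrightarrow> c $ i * x $ i \<le> c $ k * x $ k"
    using visible_argmin[OF c] by blast
  have "grad c x $ k = (if k = i then c $ k else 0)" if k: "c $ k \<noteq> 0" for k
  proof -
    have "(\<forall>l. c $ l \<noteq> 0 \<longrightarrow> c $ k * x $ k \<le> c $ l * x $ l) \<longleftrightarrow> k = i"
    proof
      assume "\<forall>l. c $ l \<noteq> 0 \<longrightarrow> c $ k * x $ k \<le> c $ l * x $ l"
      then have "c $ k * x $ k = c $ i * x $ i" using i k by (simp add: antisym)
      then have "\<bar>x $ k\<bar> = \<bar>x $ i\<bar>" using visible_abs[OF c v] i(1) k by simp
      then show "k = i" using x by (auto simp: generic_def)
    qed (use i in auto)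
    then show ?thesis using v k by (simp add: grad_def)
  qed
  then show ?thesis using i by blast
qed

lemma inner_vec_sum: "x \<bullet> y = (\<Sum>i\<in>UNIV. x $ i * y $ (i::'n::finite) :: real)"
  by (simp add: inner_vec_def)

text \<open>Moving along \<open>c\<close> raises the coordinates on the support at unit speed and leaves the others alone.\<close>
lemma grad_inner_face:
  fixes x :: "real^'n::finite"
  assumes c: "c \<in> faces" and x: "x \<in> generic"
  shows "grad c x \<bullet> c = (if visible c x then 1 else 0)"
proof (cases "visible c x")
  case True
  obtain i where i: "c $ i \<noteq> 0" "\<forall>k. c $ k \<noteq> 0 \<longrightarrow> grad c x $ k = (if k = i then c $ k else 0)"
    using grad_visible[OF c x True] by blast
  have "grad c x \<bullet> c = (\<Sum>k\<in>UNIV. if k = i then c $ i * c $ i else 0)"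
    unfolding inner_vec_sum using i by (intro sum.cong) auto
  also have "\<dots> = 1" using faces_cases[OF c, of i] i(1) by auto
  finally show ?thesis using True by simp
next
  case False
  then have "grad c x = 0" by (simp add: grad_def vec_eq_iff)
  then show ?thesis using False by simp
qed

lemma weight_grad:
  fixes x :: "real^'n::finite"
  assumes c: "c \<in> faces" and x: "x \<in> generic"
  shows "weight c x = grad c x \<bullet> x"
proof (cases "visible c x")
  case False
  then have "grad c x = 0" by (simp add: grad_def vec_eq_iff)
  then show ?thesis using weight_not_visible[OF c False] by simp
next
  case v: True
  obtain i where i0: "c $ i \<noteq> 0" "\<forall>k. c $ k \<noteq> 0 \<longrightarrow> c $ i * x $ i \<le> c $ k * x $ k"
    "\<forall>k. c $ k \<noteq> 0 \<longrightarrow> grad c x $ k = (if k = i then c $ k else 0)"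
    using grad_visible[OF c x v] by blast
  note i = i0(1) i0(2,3)[rule_format]
  show ?thesis
  proof (cases "\<exists>j0. c $ j0 = 0")
    case False
    have "weight c x = c $ i * x $ i - 0"
      using False v i by (intro weight_eq[OF c]) (auto simp: visible_def intro: less_imp_le)
    moreover have "grad c x \<bullet> x = (\<Sum>k\<in>UNIV. if k = i then c $ i * x $ i else 0)"
      unfolding inner_vec_sum using i False by (intro sum.cong) auto
    ultimately show ?thesis by simp
  next
    case True
    then obtain j where j0: "c $ j = 0" "\<forall>k. c $ k = 0 \<longrightarrow> \<bar>x $ k\<bar> \<le> \<bar>x $ j\<bar>"
      using visible_argmax[of c _ x] by blast
    note j = j0(1) j0(2)[rule_format]
    have gj: "grad c x $ k = (if k = j then - sgn (x $ k) else 0)" if k: "c $ k = 0" for k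
    proof -
      have "(\<forall>l. c $ l = 0 \<longrightarrow> \<bar>x $ l\<bar> \<le> \<bar>x $ k\<bar>) \<longleftrightarrow> k = j"
      proof
        assume "\<forall>l. c $ l = 0 \<longrightarrow> \<bar>x $ l\<bar> \<le> \<bar>x $ k\<bar>"
        then have "\<bar>x $ k\<bar> = \<bar>x $ j\<bar>" using j k by (simp add: antisym)
        then show "k = j" using x by (auto simp: generic_def)
      qed (use j in auto)
      then show ?thesis using v k by (simp add: grad_def)
    qed
    have "weight c x = c $ i * x $ i - \<bar>x $ j\<bar>"
    proof (rule weight_eq[OF c])
      show "\<bar>x $ j\<bar> \<le> c $ i * x $ i" using v i j unfolding visible_def by (simp add: less_imp_le)
    qed (use i j in auto)
    moreover have "grad c x \<bullet> x = (\<Sum>k\<in>UNIV. (if k = i then c $ i * x $ i else 0) + (if k = j then - \<bar>x $ j\<bar> else 0))"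
      unfolding inner_vec_sum
    proof (rule sum.cong)
      show "grad c x $ k * x $ k = (if k = i then c $ i * x $ i else 0) + (if k = j then - \<bar>x $ j\<bar> else 0)" for k
        using i gj[of k] j(1) by (cases "c $ k = 0") (auto simp: abs_sgn mult.commute)
    qed simp
    ultimately show ?thesis by (simp add: sum.distrib)
  qed
qed

text \<open>The weights are linear where the signs and the order of the absolute values do not change; around a generic
  point this is a neighbourhood.\<close>
definition same_pattern :: "real^'n \<Rightarrow> (real^'n) set" where
  "same_pattern x = {y. (\<forall>k. 0 < sgn (x $ k) * y $ k) \<and> (\<forall>k l. \<bar>x $ k\<bar> < \<bar>x $ l\<bar> \<longrightarrow> \<bar>y $ k\<bar> < \<bar>y $ l\<bar>)}"

lemma open_same_pattern: "open (same_pattern (x :: real^'n::finite))"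
proof -
  have "same_pattern x = (\<Inter>k. {y. 0 < sgn (x $ k) * y $ k}) \<inter>
     (\<Inter>p\<in>{p. \<bar>x $ fst p\<bar> < \<bar>x $ snd p\<bar>}. {y. \<bar>y $ fst p\<bar> < \<bar>y $ snd p\<bar>})"
    by (auto simp: same_pattern_def)
  moreover have "open {y::real^'n. 0 < sgn (x $ k) * y $ k}" for k
    by (intro open_Collect_less continuous_intros)
  moreover have "open {y::real^'n. \<bar>y $ k\<bar> < \<bar>y $ l\<bar>}" for k l
    by (intro open_Collect_less continuous_intros)
  ultimately show ?thesis by (auto intro!: open_Int open_INT)
qed

lemma same_pattern_self: "x \<in> generic \<Longrightarrow> x \<in> same_pattern x"
  by (auto simp: same_pattern_def generic_def sgn_real_def linorder_neq_iff)

lemma same_pattern_generic: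
  assumes "x \<in> generic" "y \<in> same_pattern x" shows "y \<in> generic"
proof -
  have "\<bar>y $ i\<bar> \<noteq> \<bar>y $ j\<bar>" if "i \<noteq> j" for i j
  proof -
    have "\<bar>x $ i\<bar> < \<bar>x $ j\<bar> \<or> \<bar>x $ j\<bar> < \<bar>x $ i\<bar>" using assms(1) that by (auto simp: generic_def neq_iff)
    then have "\<bar>y $ i\<bar> < \<bar>y $ j\<bar> \<or> \<bar>y $ j\<bar> < \<bar>y $ i\<bar>" using assms(2) unfolding same_pattern_def by blast
    then show ?thesis by auto
  qed
  moreover have "y $ i \<noteq> 0" for i
  proof -
    have "0 < sgn (x $ i) * y $ i" using assms(2) by (simp add: same_pattern_def)
    then show ?thesis by auto
  qed
  ultimately show ?thesis by (auto simp: generic_def)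
qed

lemma same_pattern_sgn:
  assumes "y \<in> same_pattern x" shows "sgn (y $ k) = sgn (x $ k)"
proof -
  have "0 < sgn (x $ k) * y $ k" using assms by (auto simp: same_pattern_def)
  then show ?thesis by (auto simp: sgn_real_def split: if_splits)
qed

lemma same_pattern_le:
  assumes "x \<in> generic" "y \<in> same_pattern x"
  shows "\<bar>y $ k\<bar> \<le> \<bar>y $ l\<bar> \<longleftrightarrow> \<bar>x $ k\<bar> \<le> \<bar>x $ l\<bar>"
proof (cases "k = l")
  case False
  then have "\<bar>x $ k\<bar> < \<bar>x $ l\<bar> \<or> \<bar>x $ l\<bar> < \<bar>x $ k\<bar>" using assms(1) by (auto simp: generic_def neq_iff)
  moreover have "\<bar>x $ k\<bar> < \<bar>x $ l\<bar> \<Longrightarrow> \<bar>y $ k\<bar> < \<bar>y $ l\<bar>" "\<bar>x $ l\<bar> < \<bar>x $ k\<bar> \<Longrightarrow> \<bar>y $ l\<bar> < \<bar>y $ k\<bar>"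
    using assms(2) unfolding same_pattern_def by blast+
  ultimately show ?thesis by linarith
qed simp

lemma visible_iff_sgn:
  assumes "c \<in> faces" "x \<in> generic"
  shows "visible c x \<longleftrightarrow> (\<forall>i. c $ i \<noteq> 0 \<longrightarrow> sgn (x $ i) = c $ i \<and> (\<forall>j. c $ j = 0 \<longrightarrow> \<not> \<bar>x $ i\<bar> \<le> \<bar>x $ j\<bar>))"
proof -
  have "(0 < c $ i * x $ i \<and> (\<forall>j. c $ j = 0 \<longrightarrow> \<bar>x $ j\<bar> < c $ i * x $ i)) \<longleftrightarrow>
      (sgn (x $ i) = c $ i \<and> (\<forall>j. c $ j = 0 \<longrightarrow> \<not> \<bar>x $ i\<bar> \<le> \<bar>x $ j\<bar>))" if "c $ i \<noteq> 0" for i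
  proof -
    have "c $ i = 1 \<or> c $ i = -1" using faces_cases[OF assms(1), of i] that by blast
    then have a: "0 < c $ i * x $ i \<longleftrightarrow> sgn (x $ i) = c $ i"
      by (elim disjE) (simp_all add: sgn_real_def)
    show ?thesis
    proof (cases "sgn (x $ i) = c $ i")
      case True
      have "c $ i * x $ i = \<bar>x $ i\<bar>" unfolding True[symmetric] by (simp add: abs_sgn mult.commute)
      then show ?thesis using a True by (simp only: not_le simp_thms)
    qed (use a in simp)
  qed
  then show ?thesis unfolding visible_def by blast
qed

lemma grad_same_pattern:
  assumes c: "c \<in> faces" and x: "x \<in> generic" and y: "y \<in> same_pattern x"
  shows "grad c y = grad c x"
proof -
  note le = same_pattern_le[OF x y] and sg = same_pattern_sgn[OF y]
  have vis: "visible c y \<longleftrightarrow> visible c x"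
    unfolding visible_iff_sgn[OF c x] visible_iff_sgn[OF c same_pattern_generic[OF x y]] le sg ..
  show ?thesis
  proof (cases "visible c x")
    case True
    then have vy: "visible c y" using vis by simp
    have "grad c y $ i = grad c x $ i" for i
    proof (cases "c $ i = 0")
      case False
      then have "(\<forall>k. c $ k \<noteq> 0 \<longrightarrow> c $ i * y $ i \<le> c $ k * y $ k) \<longleftrightarrow>
            (\<forall>k. c $ k \<noteq> 0 \<longrightarrow> c $ i * x $ i \<le> c $ k * x $ k)"
        using visible_abs[OF c True] visible_abs[OF c vy] le by simp
      then show ?thesis using False True vy by (simp add: grad_def)
    next
      case i0: True
      then have "(\<forall>k. c $ k = 0 \<longrightarrow> \<bar>y $ k\<bar> \<le> \<bar>y $ i\<bar>) \<longleftrightarrow> (\<forall>k. c $ k = 0 \<longrightarrow> \<bar>x $ k\<bar> \<le> \<bar>x $ i\<bar>)"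
        by (simp only: le)
      then show ?thesis using i0 True vy sg[of i] by (simp only: grad_def vec_lambda_beta simp_thms if_True if_False)
    qed
    then show ?thesis by (simp add: vec_eq_iff)
  next
    case False
    then show ?thesis using vis by (simp add: grad_def vec_eq_iff)
  qed
qed

lemma has_derivative_weight:
  fixes x :: "real^'n::finite"
  assumes c: "c \<in> faces" and x: "x \<in> generic"
  shows "(weight c has_derivative (\<lambda>h. grad c x \<bullet> h)) (at x within S)"
proof (rule has_derivative_at_withinI)
  have lin: "((\<lambda>y. grad c x \<bullet> y) has_derivative (\<lambda>h. grad c x \<bullet> h)) (at x)"
    by (rule bounded_linear_imp_has_derivative) (rule bounded_linear_inner_right)
  show "(weight c has_derivative (\<lambda>h. grad c x \<bullet> h)) (at x)"
  proof (rule has_derivative_transform_within_open[OF lin open_same_pattern same_pattern_self[OF x]])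
    fix y assume y: "y \<in> same_pattern x"
    show "grad c x \<bullet> y = weight c y"
      using weight_grad[OF c same_pattern_generic[OF x y]] grad_same_pattern[OF c x y] by simp
  qed
qed

lemma grad_bound: "c \<in> faces \<Longrightarrow> \<bar>grad c x $ i\<bar> \<le> 1"
  using faces_cases[of c i] by (auto simp: grad_def sgn_real_def)

lemma grad_measurable: "(\<lambda>x :: real^'n::finite. grad c x $ i) \<in> borel_measurable borel"
proof -
  have [measurable]: "(\<lambda>x :: real^'n. x $ k) \<in> borel_measurable borel" for k
    by (intro borel_measurable_continuous_onI continuous_intros)
  have [measurable]: "Measurable.pred borel (visible c)" unfolding visible_def by measurable
  show ?thesis unfolding grad_def vec_lambda_beta by measurable
qed

section \<open>Signed permutations and mean gradients\<close>

text \<open>Signed permutations of the coordinates: the symmetry group of the cube.\<close>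
definition sperm :: "('n \<Rightarrow> 'n) \<Rightarrow> ('n \<Rightarrow> real) \<Rightarrow> real^'n \<Rightarrow> real^'n" where
  "sperm p s x = (\<chi> i. s i * x $ p i)"

definition signs :: "('n \<Rightarrow> real) \<Rightarrow> bool" where
  "signs s \<longleftrightarrow> (\<forall>i. s i = 1 \<or> s i = -1)"

definition sym_set :: "(real^'n) set \<Rightarrow> bool" where
  "sym_set S \<longleftrightarrow> (\<forall>p s. bij p \<longrightarrow> signs s \<longrightarrow> sperm p s ` S \<subseteq> S)"

lemma sperm_nth [simp]: "sperm p s x $ i = s i * x $ p i"
  by (simp add: sperm_def)

lemma signs_sq: "signs s \<Longrightarrow> s i * s i = 1"
  unfolding signs_def by (metis mult_1 mult_minus_left mult_minus_right minus_minus)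

lemma signs_abs: "signs s \<Longrightarrow> \<bar>s i\<bar> = 1"
  unfolding signs_def by (metis abs_1 abs_minus_cancel)

lemma orthogonal_sperm:
  fixes p :: "'n::finite \<Rightarrow> 'n"
  assumes "bij p" "signs s" shows "orthogonal_transformation (sperm p s)"
  unfolding orthogonal_transformation_def
proof
  show "linear (sperm p s)"
    by (rule linearI) (simp_all add: vec_eq_iff algebra_simps)
  have "sperm p s v \<bullet> sperm p s w = v \<bullet> w" for v w
  proof -
    have "sperm p s v \<bullet> sperm p s w = (\<Sum>i\<in>UNIV. v $ p i * w $ p i)"
      unfolding inner_vec_sum
    proof (rule sum.cong)
      fix i
      have "sperm p s v $ i * sperm p s w $ i = (s i * s i) * (v $ p i * w $ p i)"
        by (simp add: algebra_simps)
      then show "sperm p s v $ i * sperm p s w $ i = v $ p i * w $ p i"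
        by (simp only: signs_sq[OF assms(2)] mult_1)
    qed simp
    also have "\<dots> = v \<bullet> w" unfolding inner_vec_sum
      by (rule sum.reindex_bij_betw[OF assms(1), of "\<lambda>i. v $ i * w $ i"])
    finally show ?thesis .
  qed
  then show "\<forall>v w. sperm p s v \<bullet> sperm p s w = v \<bullet> w" by blast
qed

lemma sym_set_image:
  fixes S :: "(real^'n::finite) set"
  assumes "sym_set S" "bij p" "signs s" shows "sperm p s ` S = S"
proof
  show "sperm p s ` S \<subseteq> S" using assms by (auto simp: sym_set_def)
  define q where "q = inv p"
  have q: "bij q" "\<And>i. p (q i) = i"
    using assms(2) by (auto simp: q_def bij_imp_bij_inv bij_is_surj surj_f_inv_f)
  have q2: "q (p i) = i" for i using assms(2) by (simp add: q_def bij_is_inj)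
  have s': "signs (\<lambda>i. s (q i))" using assms(3) by (auto simp: signs_def)
  show "S \<subseteq> sperm p s ` S"
  proof
    fix x assume "x \<in> S"
    then have "sperm q (\<lambda>i. s (q i)) x \<in> S" using assms(1) q(1) s' by (auto simp: sym_set_def)
    moreover have "x = sperm p s (sperm q (\<lambda>i. s (q i)) x)"
    proof (simp add: vec_eq_iff, intro allI)
      fix i
      have "s i * (s (q (p i)) * x $ q (p i)) = (s i * s i) * x $ i" by (simp add: q2)
      then show "x $ i = s i * (s (q (p i)) * x $ q (p i))" by (simp only: signs_sq[OF assms(3)] mult_1)
    qed
    ultimately show "x \<in> sperm p s ` S" by blast
  qed
qed

lemma all_bij: "bij p \<Longrightarrow> (\<forall>k. P (p k)) \<longleftrightarrow> (\<forall>k. P k)"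
  by (metis bij_pointE)

lemma sperm_faces:
  fixes p :: "'n::finite \<Rightarrow> 'n"
  assumes "bij p" "signs s" "c \<in> faces" shows "sperm p s c \<in> faces"
proof -
  have "s i * c $ p i \<in> {-1,0,1}" for i
    using faces_cases[OF assms(3), of "p i"] assms(2) unfolding signs_def by (metis insert_iff mult.commute mult_1 mult_minus_left mult_zero_left minus_minus)
  moreover obtain i where "c $ i \<noteq> 0" using faces_nonzero[OF assms(3)] by blast
  then have "sperm p s c $ inv p i \<noteq> 0"
    using signs_abs[OF assms(2), of "inv p i"] bij_inv_eq_iff[OF assms(1)] by (auto simp: bij_is_surj[OF assms(1)] surj_f_inv_f)
  then have "sperm p s c \<noteq> 0" by (metis zero_index)
  ultimately show ?thesis by (auto simp: faces_def)
qed

lemma sperm_prod: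
  assumes "signs s" shows "sperm p s c $ i * sperm p s x $ i = c $ p i * x $ p i"
proof -
  have "sperm p s c $ i * sperm p s x $ i = (s i * s i) * (c $ p i * x $ p i)" by simp
  then show ?thesis by (simp only: signs_sq[OF assms] mult_1)
qed

lemma sperm_zero_iff:
  assumes "signs s" shows "sperm p s c $ i = 0 \<longleftrightarrow> c $ p i = 0"
  using signs_abs[OF assms, of i] by auto

lemma sperm_abs:
  assumes "signs s" shows "\<bar>sperm p s x $ i\<bar> = \<bar>x $ p i\<bar>"
  using signs_abs[OF assms, of i] by (simp add: abs_mult)

lemma visible_sperm:
  assumes p: "bij p" and s: "signs s"
  shows "visible (sperm p s c) (sperm p s x) \<longleftrightarrow> visible c x"
proof -
  have inner: "(\<forall>j. c $ p j = 0 \<longrightarrow> \<bar>x $ p j\<bar> < a) \<longleftrightarrow> (\<forall>j. c $ j = 0 \<longrightarrow> \<bar>x $ j\<bar> < a)" for a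
    by (rule all_bij[OF p, of "\<lambda>j. c $ j = 0 \<longrightarrow> \<bar>x $ j\<bar> < a"])
  have "visible (sperm p s c) (sperm p s x) \<longleftrightarrow>
    (\<forall>i. c $ p i \<noteq> 0 \<longrightarrow> 0 < c $ p i * x $ p i \<and> (\<forall>j. c $ p j = 0 \<longrightarrow> \<bar>x $ p j\<bar> < c $ p i * x $ p i))"
    unfolding visible_def sperm_prod[OF s] sperm_zero_iff[OF s] sperm_abs[OF s] ..
  also have "\<dots> \<longleftrightarrow> (\<forall>i. c $ p i \<noteq> 0 \<longrightarrow> 0 < c $ p i * x $ p i \<and> (\<forall>j. c $ j = 0 \<longrightarrow> \<bar>x $ j\<bar> < c $ p i * x $ p i))"
    by (simp only: inner)
  also have "\<dots> \<longleftrightarrow> visible c x"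
    unfolding visible_def
    by (rule all_bij[OF p, of "\<lambda>i. c $ i \<noteq> 0 \<longrightarrow> 0 < c $ i * x $ i \<and> (\<forall>j. c $ j = 0 \<longrightarrow> \<bar>x $ j\<bar> < c $ i * x $ i)"])
  finally show ?thesis .
qed

lemma grad_sperm:
  assumes p: "bij p" and s: "signs s"
  shows "grad (sperm p s c) (sperm p s x) $ i = s i * grad c x $ p i"
proof -
  have 1: "(\<forall>k. c $ p k \<noteq> 0 \<longrightarrow> c $ p i * x $ p i \<le> c $ p k * x $ p k) \<longleftrightarrow>
      (\<forall>k. c $ k \<noteq> 0 \<longrightarrow> c $ p i * x $ p i \<le> c $ k * x $ k)"
    by (rule all_bij[OF p, of "\<lambda>k. c $ k \<noteq> 0 \<longrightarrow> c $ p i * x $ p i \<le> c $ k * x $ k"])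
  have 2: "(\<forall>k. c $ p k = 0 \<longrightarrow> \<bar>x $ p k\<bar> \<le> \<bar>x $ p i\<bar>) \<longleftrightarrow> (\<forall>k. c $ k = 0 \<longrightarrow> \<bar>x $ k\<bar> \<le> \<bar>x $ p i\<bar>)"
    by (rule all_bij[OF p, of "\<lambda>k. c $ k = 0 \<longrightarrow> \<bar>x $ k\<bar> \<le> \<bar>x $ p i\<bar>"])
  have 3: "sgn (sperm p s x $ i) = s i * sgn (x $ p i)"
    using s unfolding signs_def by (metis mult_minus1 mult_1 sgn_minus sperm_nth)
  show ?thesis
    unfolding grad_def vec_lambda_beta visible_sperm[OF p s] sperm_prod[OF s] sperm_zero_iff[OF s] sperm_abs[OF s] 1 2 3
    by (simp only: sperm_nth if_distrib[of "\<lambda>z. s i * z"] mult_zero_right mult_minus_right)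
qed

lemma integral_isometry:
  fixes f :: "real^'n::{finite,wellorder} \<Rightarrow> real^'n::_" and h :: "real^'n::_ \<Rightarrow> real"
  assumes f: "orthogonal_transformation f" and S: "S \<in> sets lebesgue"
    and img: "(\<lambda>x. a + f x) ` S = T" and h: "h absolutely_integrable_on T"
  shows "integral T h = integral S (\<lambda>x. h (a + f x))"
proof -
  have lin: "linear f" using f by (rule orthogonal_transformation_linear)
  have inj: "inj_on (\<lambda>x. a + f x) S"
    using orthogonal_transformation_inj[OF f] by (auto simp: inj_on_def)
  have der: "((\<lambda>x. a + f x) has_derivative f) (at x within S)" for x
    using lin by (auto intro!: derivative_eq_intros simp: linear_imp_has_derivative)
  have int: "integral U k = integral U (\<lambda>x. vec (k x) :: real^1) $ 1" for U and k :: "real^'n::_ \<Rightarrow> real"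
    by (simp add: integral_on_1_eq)
  have 1: "(\<lambda>x. vec (h x) :: real^1) absolutely_integrable_on T"
    using h by (simp add: absolutely_integrable_on_1_iff)
  have "integral T (\<lambda>x. vec (h x) :: real^1) = integral S (\<lambda>x. vec (h (a + f x)) :: real^1)"
    using integral_change_of_variables[OF S der inj, of "\<lambda>x. vec (h x) :: real^1"] 1 img
      orthogonal_transformation_det[OF f] by simp
  then show ?thesis unfolding int by simp
qed

definition gint :: "(real^'n::finite) set \<Rightarrow> real^'n \<Rightarrow> 'n \<Rightarrow> real" where
  "gint S c i = integral S (\<lambda>x. grad c x $ i)"

lemma bounded_measurable_absolutely_integrable:
  fixes f :: "real^'n::finite \<Rightarrow> real"
  assumes "S \<in> lmeasurable" "f \<in> borel_measurable borel" "\<And>x. x \<in> S \<Longrightarrow> \<bar>f x\<bar> \<le> b"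
  shows "f absolutely_integrable_on S"
proof (rule measurable_bounded_by_integrable_imp_absolutely_integrable)
  show "f \<in> borel_measurable (lebesgue_on S)"
    using assms(2) by (intro measurable_restrict_space1) (auto simp: measurable_completion)
  show "(\<lambda>x. b) integrable_on S" using assms(1) by (simp add: integrable_on_const)
qed (use assms in \<open>auto simp: fmeasurableD\<close>)

lemma grad_absolutely_integrable:
  assumes "S \<in> lmeasurable" "c \<in> faces"
  shows "(\<lambda>x :: real^'n::finite. grad c x $ i) absolutely_integrable_on S"
  using assms grad_bound by (intro bounded_measurable_absolutely_integrable[of _ _ 1] grad_measurable) auto

lemma gint_sperm:
  fixes S :: "(real^'n::{finite,wellorder}) set"
  assumes S: "S \<in> lmeasurable" "sym_set S" and p: "bij p" and s: "signs s" and c: "c \<in> faces"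
  shows "gint S (sperm p s c) i = s i * gint S c (p i)"
proof -
  have "gint S (sperm p s c) i = integral S (\<lambda>x. grad (sperm p s c) (sperm p s x) $ i)"
    using integral_isometry[OF orthogonal_sperm[OF p s] fmeasurableD[OF S(1)], of 0 S "\<lambda>x. grad (sperm p s c) x $ i"]
      sym_set_image[OF S(2) p s] grad_absolutely_integrable[OF S(1) sperm_faces[OF p s c]]
    by (simp add: gint_def)
  then show ?thesis by (simp add: grad_sperm[OF p s] gint_def)
qed

text \<open>Reflecting a coordinate outside the support fixes \<open>c\<close> and changes the sign of the integral.\<close>
lemma gint_off_support:
  fixes S :: "(real^'n::{finite,wellorder}) set"
  assumes S: "S \<in> lmeasurable" "sym_set S" and c: "c \<in> faces" and i: "c $ i = 0"
  shows "gint S c i = 0"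
proof -
  define s where "s = (\<lambda>k. if k = i then -1 else 1 :: real)"
  have s: "signs s" by (simp add: signs_def s_def)
  have "sperm id s c = c" using i by (simp add: vec_eq_iff s_def)
  then have "gint S c i = s i * gint S c (id i)"
    using gint_sperm[OF S bij_id s c, of i] by simp
  then show ?thesis by (simp add: s_def)
qed

text \<open>Exchanging two coordinates of the support, with the signs that fix \<open>c\<close>.\<close>
lemma gint_on_support:
  fixes S :: "(real^'n::{finite,wellorder}) set"
  assumes S: "S \<in> lmeasurable" "sym_set S" and c: "c \<in> faces" and ik: "c $ i \<noteq> 0" "c $ k \<noteq> 0"
  shows "c $ i * gint S c i = c $ k * gint S c k"
proof -
  define s where "s = (\<lambda>j. if j = i \<or> j = k then c $ i * c $ k else 1 :: real)"
  have s: "signs s" using faces_cases[OF c, of i] faces_cases[OF c, of k] ik by (auto simp: signs_def s_def)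
  have sq: "c $ i * c $ i = 1" "c $ k * c $ k = 1"
    using faces_cases[OF c, of i] faces_cases[OF c, of k] ik by auto
  define p where "p = (\<lambda>j. if j = i then k else if j = k then i else j)"
  have p: "bij p" by (rule involuntory_imp_bij) (auto simp: p_def)
  have "c $ i * c $ k * c $ k = c $ i" using sq(2) by (simp add: mult.assoc)
  moreover have "c $ i * c $ k * c $ i = c $ k"
  proof -
    have "c $ i * c $ k * c $ i = (c $ i * c $ i) * c $ k" by (simp only: mult_ac)
    then show ?thesis by (simp only: sq mult_1)
  qed
  ultimately have "sperm p s c $ j = c $ j" for j
    by (auto simp: s_def p_def)
  then have "sperm p s c = c" by (simp add: vec_eq_iff)
  then have "gint S c i = s i * gint S c (p i)"
    using gint_sperm[OF S p s c, of i] by simp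
  then have "c $ i * gint S c i = (c $ i * c $ i) * (c $ k * gint S c k)" by (simp add: s_def p_def)
  then show ?thesis by (simp only: sq mult_1)
qed

text \<open>By \<open>grad_inner_face\<close> this is the volume of the part of \<open>S\<close> where \<open>c\<close> is visible.\<close>
definition vint :: "(real^'n::finite) set \<Rightarrow> real^'n \<Rightarrow> real" where
  "vint S c = (\<Sum>i\<in>UNIV. c $ i * gint S c i)"

lemma l1_face: "c \<in> faces \<Longrightarrow> l1 c = real (card {i. c $ i \<noteq> 0})"
proof -
  assume c: "c \<in> faces"
  have "l1 c = (\<Sum>i\<in>UNIV. if c $ i \<noteq> 0 then 1 else 0)"
    unfolding l1_def using faces_cases[OF c] by (intro sum.cong) (auto, metis abs_1 abs_minus_cancel)
  then show ?thesis by (simp add: sum.If_cases)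
qed

lemma l1_face_pos: "c \<in> faces \<Longrightarrow> 0 < l1 (c :: real^'n::finite)"
  using faces_nonzero[of c] by (auto simp: l1_face card_gt_0_iff)

lemma gint_vint:
  fixes S :: "(real^'n::{finite,wellorder}) set"
  assumes S: "S \<in> lmeasurable" "sym_set S" and c: "c \<in> faces"
  shows "gint S c i = c $ i * (vint S c / l1 c)"
proof (cases "c $ i = 0")
  case True then show ?thesis using gint_off_support[OF S c] by simp
next
  case i: False
  have "vint S c = (\<Sum>k\<in>UNIV. if c $ k \<noteq> 0 then c $ i * gint S c i else 0)"
    unfolding vint_def using gint_on_support[OF S c i] by (intro sum.cong) auto
  also have "\<dots> = l1 c * (c $ i * gint S c i)" by (simp add: sum.If_cases l1_face[OF c])
  finally have "vint S c / l1 c = c $ i * gint S c i" using l1_face_pos[OF c] by (simp add: field_simps)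
  then have "c $ i * (vint S c / l1 c) = (c $ i * c $ i) * gint S c i" by (simp only: mult.assoc)
  moreover have "c $ i * c $ i = 1" using faces_cases[OF c, of i] i by auto
  ultimately show ?thesis by simp
qed

lemma vint_sperm:
  fixes S :: "(real^'n::{finite,wellorder}) set"
  assumes S: "S \<in> lmeasurable" "sym_set S" and p: "bij p" and s: "signs s" and c: "c \<in> faces"
  shows "vint S (sperm p s c) = vint S c"
proof -
  have "sperm p s c $ i * gint S (sperm p s c) i = c $ p i * gint S c (p i)" for i
  proof -
    have "sperm p s c $ i * gint S (sperm p s c) i = (s i * s i) * (c $ p i * gint S c (p i))"
      by (simp add: gint_sperm[OF S p s c])
    then show ?thesis by (simp only: signs_sq[OF s] mult_1)
  qed
  then have "vint S (sperm p s c) = (\<Sum>i\<in>UNIV. c $ p i * gint S c (p i))" by (simp only: vint_def)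
  also have "\<dots> = vint S c" unfolding vint_def
    by (rule sum.reindex_bij_betw[OF p, of "\<lambda>i. c $ i * gint S c i"])
  finally show ?thesis .
qed

lemma sperm_transitive:
  fixes c d :: "real^'n::finite"
  assumes c: "c \<in> faces" and d: "d \<in> faces" and l1: "l1 c = l1 d"
  shows "\<exists>p s. bij p \<and> signs s \<and> sperm p s c = d"
proof -
  let ?C = "{i. c $ i \<noteq> 0}" and ?D = "{i. d $ i \<noteq> 0}"
  have card: "card ?D = card ?C" using l1 by (simp add: l1_face c d)
  then obtain f where f: "bij_betw f ?D ?C"
    using finite_same_card_bij[OF finite finite card] by blast
  have card': "card (- ?D) = card (- ?C)" using card by (simp only: Compl_eq_Diff_UNIV card_Diff_subset finite subset_UNIV)
  then obtain g where g: "bij_betw g (- ?D) (- ?C)"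
    using finite_same_card_bij[OF finite finite card'] by blast
  define p where "p = (\<lambda>i. if i \<in> ?D then f i else g i)"
  have "bij_betw p (?D \<union> - ?D) (?C \<union> - ?C)"
    unfolding p_def using f g by (rule bij_betw_disjoint_Un) auto
  then have p: "bij p" by simp
  define s where "s = (\<lambda>i. if d $ i \<noteq> 0 then d $ i * c $ p i else 1)"
  have fC: "c $ f i \<noteq> 0" if "d $ i \<noteq> 0" for i using bij_betwE[OF f] that by auto
  have gC: "c $ g i = 0" if "d $ i = 0" for i using bij_betwE[OF g] that by auto
  have s: "signs s"
    unfolding signs_def
  proof
    fix i
    show "s i = 1 \<or> s i = -1"
      using fC[of i] faces_cases[OF c, of "p i"] faces_cases[OF d, of i] by (auto simp: s_def p_def)
  qed
  have "s i * c $ p i = d $ i" for i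
    using fC[of i] gC[of i] faces_cases[OF c, of "p i"] faces_cases[OF d, of i] by (auto simp: s_def p_def)
  then have "sperm p s c = d" by (simp add: vec_eq_iff)
  then show ?thesis using p s by blast
qed

text \<open>The support of the visible face of size \<open>k\<close> consists of the \<open>k\<close> largest coordinates. Ranks give a bijection
  onto \<open>{1..n}\<close>, so this set has exactly \<open>k\<close> elements.\<close>
lemma ex1_visible:
  fixes x :: "real^'n::finite"
  assumes x: "x \<in> generic" and k: "1 \<le> k" "k \<le> CARD('n)"
  shows "\<exists>!c. c \<in> faces \<and> l1 c = real k \<and> visible c x"
proof -
  define rank where "rank = (\<lambda>i. card {j. \<bar>x $ i\<bar> \<le> \<bar>x $ j\<bar>})"
  have mono: "rank j < rank i" if "\<bar>x $ i\<bar> < \<bar>x $ j\<bar>" for i j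
  proof -
    have "{k. \<bar>x $ j\<bar> \<le> \<bar>x $ k\<bar>} \<subset> {k. \<bar>x $ i\<bar> \<le> \<bar>x $ k\<bar>}"
    proof
      show "{k. \<bar>x $ j\<bar> \<le> \<bar>x $ k\<bar>} \<subseteq> {k. \<bar>x $ i\<bar> \<le> \<bar>x $ k\<bar>}" using that by auto
      have "i \<in> {k. \<bar>x $ i\<bar> \<le> \<bar>x $ k\<bar>}" "i \<notin> {k. \<bar>x $ j\<bar> \<le> \<bar>x $ k\<bar>}" using that by auto
      then show "{k. \<bar>x $ j\<bar> \<le> \<bar>x $ k\<bar>} \<noteq> {k. \<bar>x $ i\<bar> \<le> \<bar>x $ k\<bar>}" by blast
    qed
    then show ?thesis unfolding rank_def by (intro psubset_card_mono) auto
  qed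
  have gen: "\<bar>x $ i\<bar> < \<bar>x $ j\<bar> \<or> \<bar>x $ j\<bar> < \<bar>x $ i\<bar>" if "i \<noteq> j" for i j
    using x that by (auto simp: generic_def neq_iff)
  have inj: "inj rank"
  proof (rule injI, rule ccontr)
    fix i j assume "rank i = rank j" "i \<noteq> j"
    then show False using gen[of i j] mono[of i j] mono[of j i] by auto
  qed
  have "1 \<le> rank i" for i
    unfolding rank_def by (simp add: Suc_le_eq card_gt_0_iff) blast
  moreover have "rank i \<le> CARD('n)" for i unfolding rank_def by (intro card_mono) auto
  ultimately have "range rank \<subseteq> {1..CARD('n)}" by auto
  moreover have "card (range rank) = CARD('n)" using inj by (simp add: card_image)
  ultimately have range: "range rank = {1..CARD('n)}" by (intro card_subset_eq) auto
  define T where "T = {i. rank i \<le> k}"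
  have "rank ` T = {1..k}"
  proof
    show "rank ` T \<subseteq> {1..k}" using range by (auto simp: T_def)
    show "{1..k} \<subseteq> rank ` T"
    proof
      fix r assume r: "r \<in> {1..k}"
      then have "r \<in> range rank" using range k by auto
      then show "r \<in> rank ` T" using r by (auto simp: T_def)
    qed
  qed
  then have cT: "card T = k" using card_image[of rank T] inj by (metis card_atLeastAtMost diff_Suc_1 inj_on_subset subset_UNIV)
  have nz: "x $ i \<noteq> 0" for i using x by (simp add: generic_def)
  define c :: "real^'n" where "c = (\<chi> i. if i \<in> T then sgn (x $ i) else 0)"
  have supp: "c $ i \<noteq> 0 \<longleftrightarrow> i \<in> T" for i using nz[of i] by (simp add: c_def sgn_zero_iff)
  have "T \<noteq> {}" using cT k by auto
  then have c: "c \<in> faces" using supp by (auto simp: faces_def c_def vec_eq_iff sgn_real_def)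
  have lc: "l1 c = real k" using l1_face[OF c] supp cT by simp
  have vis: "visible c x"
    unfolding visible_iff_sgn[OF c x]
  proof (intro allI impI conjI)
    fix i assume "c $ i \<noteq> 0"
    then have i: "i \<in> T" using supp by simp
    then show "sgn (x $ i) = c $ i" by (simp add: c_def)
    fix j assume "c $ j = 0"
    then have j: "j \<notin> T" using supp by blast
    show "\<not> \<bar>x $ i\<bar> \<le> \<bar>x $ j\<bar>"
    proof
      assume "\<bar>x $ i\<bar> \<le> \<bar>x $ j\<bar>"
      then have "rank j \<le> rank i" unfolding rank_def by (intro card_mono) auto
      then show False using i j by (simp add: T_def)
    qed
  qed
  have uniq: "d = c" if d: "d \<in> faces" "l1 d = real k" "visible d x" for d
  proof -
    have ds: "\<And>i. d $ i \<noteq> 0 \<Longrightarrow> sgn (x $ i) = d $ i"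
      "\<And>i j. d $ i \<noteq> 0 \<Longrightarrow> d $ j = 0 \<Longrightarrow> \<bar>x $ j\<bar> < \<bar>x $ i\<bar>"
      using d(3) unfolding visible_iff_sgn[OF d(1) x] by (auto simp: not_le)
    let ?D = "{i. d $ i \<noteq> 0}"
    have cD: "card ?D = card T" using d l1_face[OF d(1)] cT by simp
    have "?D \<subseteq> T \<or> T \<subseteq> ?D"
    proof (rule ccontr)
      assume "\<not> (?D \<subseteq> T \<or> T \<subseteq> ?D)"
      then obtain i j where i: "d $ i \<noteq> 0" "i \<notin> T" and j: "j \<in> T" "d $ j = 0" by blast
      have "rank i < rank j" using ds(2)[OF i(1) j(2)] mono by blast
      then show False using i j by (simp add: T_def)
    qed
    then have "?D = T" using cD by (metis card_subset_eq finite)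
    then have "d $ i = c $ i" for i using ds(1)[of i] supp[of i] by (cases "i \<in> T") (auto simp: c_def)
    then show ?thesis by (simp add: vec_eq_iff)
  qed
  show ?thesis using c lc vis uniq by blast
qed

lemma vint_integral:
  fixes S :: "(real^'n::finite) set"
  assumes S: "S \<in> lmeasurable" and c: "c \<in> faces"
  shows "vint S c = integral S (\<lambda>x. grad c x \<bullet> c)"
proof -
  have "integral S (\<lambda>x. \<Sum>i\<in>UNIV. c $ i * grad c x $ i) = (\<Sum>i\<in>UNIV. integral S (\<lambda>x. c $ i * grad c x $ i))"
    by (rule integral_sum) (use grad_absolutely_integrable[OF S c] in \<open>auto simp: absolutely_integrable_on_def intro!: integrable_on_mult_right\<close>)
  then show ?thesis by (simp add: vint_def gint_def inner_vec_sum mult.commute)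
qed

lemma sum_vint:
  fixes S :: "(real^'n::finite) set"
  assumes S: "S \<in> lmeasurable" and k: "1 \<le> k" "k \<le> CARD('n)"
  shows "(\<Sum>c | c \<in> faces \<and> l1 c = real k. vint S c) = measure lebesgue S"
proof -
  have fin: "finite {c \<in> faces. l1 (c :: real^'n) = real k}"
    by (rule finite_subset[OF _ finite_faces]) auto
  have int: "(\<lambda>x. grad c x \<bullet> c) integrable_on S" if "c \<in> faces" for c
    unfolding inner_vec_sum using grad_absolutely_integrable[OF S that]
    by (auto simp: absolutely_integrable_on_def intro!: integrable_sum integrable_on_mult_left)
  have "(\<Sum>c | c \<in> faces \<and> l1 c = real k. vint S c)
      = (\<Sum>c | c \<in> faces \<and> l1 c = real k. integral S (\<lambda>x. grad c x \<bullet> c))"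
    using vint_integral[OF S] by (intro sum.cong) auto
  also have "\<dots> = integral S (\<lambda>x. \<Sum>c | c \<in> faces \<and> l1 c = real k. grad c x \<bullet> c)"
    by (rule integral_sum[symmetric]) (use fin int in auto)
  also have "\<dots> = integral S (\<lambda>x. 1)"
  proof (rule integral_spike[OF negligible_not_generic])
    fix x assume "x \<in> S - - generic"
    then have x: "x \<in> generic" by simp
    from ex1_visible[OF x k] obtain d where d0: "d \<in> faces \<and> l1 d = real k \<and> visible d x"
      and u0: "\<forall>c. c \<in> faces \<and> l1 c = real k \<and> visible c x \<longrightarrow> c = d"
      by (rule ex1E)
    have d: "d \<in> faces" "l1 d = real k" "visible d x" using d0 by blast+
    have u: "c = d" if "c \<in> faces" "l1 c = real k" "visible c x" for c using u0 that by blast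
    have "(\<Sum>c | c \<in> faces \<and> l1 c = real k. grad c x \<bullet> c) = (\<Sum>c | c \<in> faces \<and> l1 c = real k. if c = d then 1 else 0)"
    proof (rule sum.cong[OF refl])
      fix c :: "real^'n" assume "c \<in> {c \<in> faces. l1 c = real k}"
      then have c: "c \<in> faces" "l1 c = real k" by simp_all
      show "grad c x \<bullet> c = (if c = d then 1 else 0)"
        unfolding grad_inner_face[OF c(1) x] using u[OF c] d(3) by (cases "c = d") auto
    qed
    also have "\<dots> = 1" using d fin by simp
    finally show "1 = (\<Sum>c | c \<in> faces \<and> l1 c = real k. grad c x \<bullet> c)" by simp
  qed
  also have "\<dots> = measure lebesgue S" using S by (simp add: lmeasure_integral)
  finally show ?thesis .
qed

definition class_size :: "real^'n::finite \<Rightarrow> real" where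
  "class_size c = real (card {d \<in> faces. l1 (d :: real^'n) = l1 c})"

lemma class_size_pos: "c \<in> faces \<Longrightarrow> 0 < class_size c"
  unfolding class_size_def using finite_faces by (auto simp: card_gt_0_iff)

text \<open>The faces of a given size are permuted transitively and their visibility regions partition \<open>S\<close>, so all regions
  have the same share of the volume. The share does not depend on \<open>S\<close>, which links the cube and its polar.\<close>
lemma vint_eq:
  fixes S :: "(real^'n::{finite,wellorder}) set"
  assumes S: "S \<in> lmeasurable" "sym_set S" and c: "c \<in> faces"
  shows "vint S c = measure lebesgue S / class_size c"
proof -
  define k where "k = card {i. c $ i \<noteq> 0}"
  have l: "l1 c = real k" using l1_face[OF c] by (simp add: k_def)
  have "1 \<le> k" using l1_face_pos[OF c] l by simp
  moreover have "k \<le> CARD('n)" unfolding k_def by (intro card_mono) auto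
  ultimately have "measure lebesgue S = (\<Sum>d | d \<in> faces \<and> l1 d = real k. vint S d)"
    using sum_vint[OF S(1)] by simp
  also have "\<dots> = (\<Sum>d | d \<in> faces \<and> l1 (d :: real^'n::_) = real k. vint S c)"
  proof (rule sum.cong)
    fix d :: "real^'n::_" assume "d \<in> {d \<in> faces. l1 d = real k}"
    then have "\<exists>p s. bij p \<and> signs s \<and> sperm p s c = d" using c l by (intro sperm_transitive) auto
    then show "vint S d = vint S c" using vint_sperm[OF S _ _ c] by blast
  qed simp
  finally show ?thesis using class_size_pos[OF c] l by (simp add: class_size_def field_simps)
qed

text \<open>Symmetry leaves only the direction of \<open>c\<close>: displacements orthogonal to \<open>c\<close> do not change the volume to first
  order.\<close>
lemma integral_grad_inner:
  fixes S :: "(real^'n::{finite,wellorder}) set"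
  assumes S: "S \<in> lmeasurable" "sym_set S" and c: "c \<in> faces"
  shows "integral S (\<lambda>x. grad c x \<bullet> w) = (c \<bullet> w) / (l1 c * class_size c) * measure lebesgue S"
proof -
  have "integral S (\<lambda>x. \<Sum>i\<in>UNIV. grad c x $ i * w $ i) = (\<Sum>i\<in>UNIV. integral S (\<lambda>x. grad c x $ i * w $ i))"
    by (rule integral_sum) (use grad_absolutely_integrable[OF S(1) c] in \<open>auto simp: absolutely_integrable_on_def intro!: integrable_on_mult_left\<close>)
  also have "\<dots> = (\<Sum>i\<in>UNIV. gint S c i * w $ i)" by (simp add: gint_def)
  also have "\<dots> = (\<Sum>i\<in>UNIV. (vint S c / l1 c) * (c $ i * w $ i))"
    using gint_vint[OF S c] by (intro sum.cong) (simp_all add: algebra_simps)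
  also have "\<dots> = (vint S c / l1 c) * (c \<bullet> w)" by (simp only: sum_distrib_left inner_vec_sum)
  finally show ?thesis by (simp add: inner_vec_sum vint_eq[OF S c] mult.commute)
qed

section \<open>Volume of a perturbed set\<close>

lemma prod_one_plus_approx:
  fixes a :: "'a \<Rightarrow> real"
  assumes "finite I" "\<And>i. i \<in> I \<Longrightarrow> \<bar>a i\<bar> \<le> e" "e \<le> 1"
  shows "\<bar>(\<Prod>i\<in>I. 1 + a i) - (1 + (\<Sum>i\<in>I. a i))\<bar> \<le> 4 ^ card I * e\<^sup>2"
  using assms(1,2)
proof (induction I)
  case empty then show ?case by simp
next
  case (insert i I)
  let ?P = "\<Prod>i\<in>I. 1 + a i" and ?S = "\<Sum>i\<in>I. a i"
  have IH: "\<bar>?P - (1 + ?S)\<bar> \<le> 4 ^ card I * e\<^sup>2" using insert by simp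
  have ai: "\<bar>a i\<bar> \<le> e" using insert.prems by simp
  then have e0: "0 \<le> e" by linarith
  have "\<bar>?S\<bar> \<le> (\<Sum>i\<in>I. e)" using insert.prems by (intro order_trans[OF sum_abs] sum_mono) auto
  then have S: "\<bar>?S\<bar> \<le> real (card I) * e" by simp
  have "real (card I) \<le> 4 ^ card I" using of_nat_less_two_power[of "card I", where 'a=real] power_mono[of "2::real" 4 "card I"] by linarith
  have "(\<Prod>i\<in>insert i I. 1 + a i) - (1 + (\<Sum>i\<in>insert i I. a i)) = (1 + a i) * (?P - (1 + ?S)) + a i * ?S"
    using insert.hyps by (simp add: algebra_simps)
  also have "\<bar>\<dots>\<bar> \<le> \<bar>1 + a i\<bar> * \<bar>?P - (1 + ?S)\<bar> + \<bar>a i\<bar> * \<bar>?S\<bar>"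
    by (metis abs_mult abs_triangle_ineq)
  also have "\<dots> \<le> 2 * (4 ^ card I * e\<^sup>2) + e * (real (card I) * e)"
    using IH S ai assms(3) e0 by (intro add_mono mult_mono) auto
  also have "\<dots> = (2 * 4 ^ card I + real (card I)) * e\<^sup>2" by (simp add: power2_eq_square algebra_simps)
  also have "\<dots> \<le> (4 * 4 ^ card I) * e\<^sup>2"
  proof (rule mult_right_mono)
    show "2 * 4 ^ card I + real (card I) \<le> 4 * 4 ^ card I"
      using \<open>real (card I) \<le> 4 ^ card I\<close> zero_le_power[of "4::real" "card I"] by linarith
  qed simp
  finally show ?case using insert.hyps by simp
qed

text \<open>A permutation other than the identity moves at least two indices and contributes at most \<open>e\<^sup>2\<close> times a constant.\<close>
lemma det_near_id:
  "\<exists>C\<ge>0. \<forall>(M :: real^'n^'n::finite) e. (\<forall>i j. \<bar>M $ i $ j\<bar> \<le> e) \<longrightarrow> e \<le> 1 \<longrightarrow>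
     1 + trace M - C * e\<^sup>2 \<le> det (mat 1 + M)"
proof (intro exI conjI allI impI)
  let ?n = "CARD('n)"
  let ?C = "4 ^ ?n + real (card {p. p permutes (UNIV :: 'n set)}) * 2 ^ ?n"
  show "0 \<le> ?C" by simp
  fix M :: "real^'n^'n" and e :: real
  assume M: "\<forall>i j. \<bar>M $ i $ j\<bar> \<le> e" and e1: "e \<le> 1"
  have e0: "0 \<le> e" using M abs_ge_zero order_trans by metis
  let ?A = "mat 1 + M"
  let ?P = "{p. p permutes (UNIV :: 'n set)}"
  let ?t = "\<lambda>p. of_int (sign p) * (\<Prod>i\<in>UNIV. ?A $ i $ p i)"
  have finP: "finite ?P" by (simp add: finite_permutations)
  have idP: "id \<in> ?P" by (simp add: permutes_id)
  have "det ?A = ?t id + (\<Sum>p\<in>?P - {id}. ?t p)"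
    unfolding det_def by (rule sum.remove[OF finP idP])
  moreover have "1 + trace M - 4 ^ ?n * e\<^sup>2 \<le> ?t id"
  proof -
    have "\<bar>(\<Prod>i\<in>UNIV. 1 + M $ i $ i) - (1 + (\<Sum>i\<in>UNIV. M $ i $ i))\<bar> \<le> 4 ^ ?n * e\<^sup>2"
      using M e1 by (intro prod_one_plus_approx) auto
    moreover have "?t id = (\<Prod>i\<in>UNIV. 1 + M $ i $ i)" by (simp add: mat_def)
    ultimately show ?thesis by (simp add: trace_def)
  qed
  moreover have "- (2 ^ ?n * e\<^sup>2) \<le> ?t p" if p: "p \<in> ?P - {id}" for p
  proof -
    obtain i where i: "p i \<noteq> i" using p by (auto simp: fun_eq_iff)
    have inj: "inj p" using p permutes_inj by auto
    have j: "p (p i) \<noteq> p i" using i inj by (auto dest: injD)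
    let ?D = "{i, p i}"
    have "\<bar>\<Prod>k\<in>UNIV. ?A $ k $ p k\<bar> = (\<Prod>k\<in>UNIV. \<bar>?A $ k $ p k\<bar>)" by (rule abs_prod)
    also have "\<dots> \<le> (\<Prod>k\<in>UNIV. if k \<in> ?D then e else 2)"
    proof (rule prod_mono)
      fix k
      have "\<bar>?A $ k $ p k\<bar> \<le> e" if "k \<in> ?D"
      proof -
        have "p k \<noteq> k" using that i j by auto
        then show ?thesis using M by (simp add: mat_def)
      qed
      moreover have "\<bar>?A $ k $ p k\<bar> \<le> 2"
      proof -
        have "\<bar>?A $ k $ p k\<bar> \<le> \<bar>mat 1 $ k $ p k\<bar> + \<bar>M $ k $ p k\<bar>" by simp
        also have "\<dots> \<le> 1 + 1"
        proof (rule add_mono)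
          show "\<bar>M $ k $ p k\<bar> \<le> 1" using M e1 order_trans by blast
        qed (simp add: mat_def)
        finally show ?thesis by simp
      qed
      ultimately show "0 \<le> \<bar>?A $ k $ p k\<bar> \<and> \<bar>?A $ k $ p k\<bar> \<le> (if k \<in> ?D then e else 2)" by auto
    qed
    also have "\<dots> = e ^ card ?D * 2 ^ card (- ?D)" by (simp only: prod.If_cases finite Int_UNIV_left Collect_mem_eq prod_constant)
    also have "\<dots> \<le> e\<^sup>2 * 2 ^ ?n"
    proof -
      have "card ?D = 2" using i by simp
      moreover have "(2::real) ^ card (- ?D) \<le> 2 ^ ?n" by (intro power_increasing card_mono) auto
      ultimately show ?thesis by (simp add: mult_left_mono)
    qed
    finally have "\<bar>\<Prod>k\<in>UNIV. ?A $ k $ p k\<bar> \<le> 2 ^ ?n * e\<^sup>2" by (simp add: mult.commute)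
    moreover have "\<bar>?t p\<bar> = \<bar>\<Prod>k\<in>UNIV. ?A $ k $ p k\<bar>" by (simp add: abs_mult sign_def)
    ultimately show ?thesis by linarith
  qed
  then have "(\<Sum>p\<in>?P - {id}. - (2 ^ ?n * e\<^sup>2)) \<le> (\<Sum>p\<in>?P - {id}. ?t p)" by (rule sum_mono)
  moreover have "- (real (card ?P) * 2 ^ ?n * e\<^sup>2) \<le> (\<Sum>p\<in>?P - {id}. - (2 ^ ?n * e\<^sup>2))"
  proof -
    have "real (card (?P - {id})) \<le> real (card ?P)" using finP by (simp add: card_mono)
    then have "real (card (?P - {id})) * (2 ^ ?n * e\<^sup>2) \<le> real (card ?P) * (2 ^ ?n * e\<^sup>2)" by (intro mult_right_mono) auto
    then show ?thesis by (simp add: sum_negf)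
  qed
  ultimately show "1 + trace M - ?C * e\<^sup>2 \<le> det ?A" by (simp add: algebra_simps)
qed

text \<open>Change of variables together with \<open>det_near_id\<close>: to first order the volume grows by the integral of the divergence.\<close>
lemma volume_perturbation:
  fixes S T :: "(real^'n::{finite,wellorder}) set" and E :: "real^'n::_ \<Rightarrow> real^'n::_"
    and M :: "real^'n::_ \<Rightarrow> real^'n::_^'n::_"
  assumes S: "S \<in> lmeasurable" and T: "T \<in> lmeasurable" and N: "negligible N"
    and der: "\<And>x. x \<in> S - N \<Longrightarrow> (E has_derivative (\<lambda>h. M x *v h)) (at x within (S - N))"
    and inj: "inj_on (\<lambda>x. x + E x) S" and sub: "(\<lambda>x. x + E x) ` S \<subseteq> T"
    and M: "\<And>x i j. \<bar>M x $ i $ j\<bar> \<le> e" "e \<le> 1" and meas: "\<And>i j. (\<lambda>x. M x $ i $ j) \<in> borel_measurable borel"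
    and C: "\<And>x. 1 + trace (M x) - C * e\<^sup>2 \<le> det (mat 1 + M x)"
  shows "(1 - C * e\<^sup>2) * measure lebesgue S + integral S (\<lambda>x. trace (M x)) \<le> measure lebesgue T"
proof -
  let ?S = "S - N"
  let ?f' = "\<lambda>x h. h + M x *v h"
  let ?d = "\<lambda>x. \<bar>det (mat 1 + M x)\<bar>"
  have S': "?S \<in> lmeasurable"
    using S N by (simp add: negligible_iff_null_sets fmeasurable_Diff null_setsD2)
  have mS': "measure lebesgue ?S = measure lebesgue S"
    using S N by (simp add: measure_Diff_null_set negligible_iff_null_sets fmeasurableD)
  have mat: "matrix (?f' x) = mat 1 + M x" for x
  proof -
    have "?f' x = (*v) (mat 1 + M x)" by (simp add: fun_eq_iff matrix_vector_mult_add_rdistrib)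
    then show ?thesis by simp
  qed
  have trb: "\<bar>trace (M x)\<bar> \<le> real CARD('n) * e" for x
  proof -
    have "\<bar>trace (M x)\<bar> \<le> (\<Sum>i\<in>(UNIV::'n set). e)" unfolding trace_def
      using M(1) by (intro order_trans[OF sum_abs] sum_mono) auto
    then show ?thesis by simp
  qed
  have tr_meas: "(\<lambda>x. trace (M x)) \<in> borel_measurable borel"
    unfolding trace_def using meas by measurable
  have tr_int: "(\<lambda>x. trace (M x)) integrable_on ?S"
    using bounded_measurable_absolutely_integrable[OF S' tr_meas] trb by (auto simp: absolutely_integrable_on_def)
  have d_meas: "?d \<in> borel_measurable borel"
    unfolding det_def vector_add_component using meas by measurable
  have db: "?d x \<le> real (card {p. p permutes (UNIV :: 'n set)}) * 2 ^ CARD('n)" for x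
  proof -
    have ent: "\<bar>(mat 1 + M x) $ i $ j\<bar> \<le> 2" for i j
    proof -
      have "\<bar>(mat 1 + M x) $ i $ j\<bar> \<le> \<bar>mat 1 $ i $ j\<bar> + \<bar>M x $ i $ j\<bar>" by simp
      also have "\<dots> \<le> 1 + 1" using order_trans[OF M(1) M(2)] by (intro add_mono) (auto simp: mat_def)
      finally show ?thesis by simp
    qed
    have "?d x \<le> (\<Sum>p | p permutes (UNIV :: 'n set). \<bar>of_int (sign p) * (\<Prod>i\<in>UNIV. (mat 1 + M x) $ i $ p i)\<bar>)"
      unfolding det_def by (rule sum_abs)
    also have "\<dots> \<le> (\<Sum>p | p permutes (UNIV :: 'n set). 2 ^ CARD('n))"
    proof (rule sum_mono)
      fix p
      have "\<bar>of_int (sign p) * (\<Prod>i\<in>UNIV. (mat 1 + M x) $ i $ p i)\<bar> = (\<Prod>i\<in>UNIV. \<bar>(mat 1 + M x) $ i $ p i\<bar>)"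
        by (simp add: abs_mult abs_prod sign_def)
      also have "\<dots> \<le> (\<Prod>i\<in>(UNIV :: 'n set). 2)" using ent by (intro prod_mono) auto
      finally show "\<bar>of_int (sign p) * (\<Prod>i\<in>UNIV. (mat 1 + M x) $ i $ p i)\<bar> \<le> 2 ^ CARD('n)" by simp
    qed
    finally show ?thesis by simp
  qed
  have d_int: "?d integrable_on ?S"
    using bounded_measurable_absolutely_integrable[OF S' d_meas] db by (auto simp: absolutely_integrable_on_def)
  have der': "((\<lambda>x. x + E x) has_derivative ?f' x) (at x within ?S)" if "x \<in> ?S" for x
    by (intro has_derivative_add has_derivative_ident der[OF that])
  have inj': "inj_on (\<lambda>x. x + E x) ?S" using inj by (rule inj_on_subset) auto
  have img: "(\<lambda>x. x + E x) ` ?S \<in> lmeasurable"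
    using measurable_differentiable_image_eq[OF fmeasurableD[OF S'] der' inj'] d_int by (simp add: mat)
  have "measure lebesgue ((\<lambda>x. x + E x) ` ?S) = integral ?S ?d"
    using measure_differentiable_image_eq[OF fmeasurableD[OF S'] der' inj'] d_int by (simp add: mat)
  moreover have "measure lebesgue ((\<lambda>x. x + E x) ` ?S) \<le> measure lebesgue T"
    using sub T img by (intro measure_mono_fmeasurable) (auto intro: fmeasurableD)
  moreover have "integral ?S (\<lambda>x. (1 - C * e\<^sup>2) + trace (M x)) \<le> integral ?S ?d"
  proof (rule integral_le)
    show "(\<lambda>x. (1 - C * e\<^sup>2) + trace (M x)) integrable_on ?S"
      using tr_int S' by (intro integrable_add integrable_on_const)
    fix x
    show "(1 - C * e\<^sup>2) + trace (M x) \<le> ?d x" using C[of x] by linarith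
  qed (rule d_int)
  moreover have "integral ?S (\<lambda>x. (1 - C * e\<^sup>2) + trace (M x)) =
      (1 - C * e\<^sup>2) * measure lebesgue ?S + integral ?S (\<lambda>x. trace (M x))"
    using tr_int S' integral_mult_right[where c="1 - C * e\<^sup>2" and S="?S" and f="\<lambda>x. 1"]
    by (subst integral_add) (simp_all add: integrable_on_const lmeasure_integral)
  moreover have "integral ?S (\<lambda>x. trace (M x)) = integral S (\<lambda>x. trace (M x))"
    using N by (intro integral_spike_set) (auto intro: negligible_subset)
  ultimately show ?thesis using mS' by simp
qed

section \<open>Bumps centred on a facet\<close>

definition bump :: "real^'n::finite \<Rightarrow> real \<Rightarrow> real^'n \<Rightarrow> real" where
  "bump p r x = max 0 (r\<^sup>2 - (x - p) \<bullet> (x - p))"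

definition bump_grad :: "real^'n::finite \<Rightarrow> real \<Rightarrow> real^'n \<Rightarrow> real^'n" where
  "bump_grad p r x = (if x \<in> ball p r then - 2 *\<^sub>R (x - p) else 0)"

lemma bump_bounds: "0 \<le> bump p r x" "bump p r x \<le> r\<^sup>2"
  by (auto simp: bump_def)

lemma bump_outside:
  assumes "x \<notin> ball p r" "0 \<le> r" shows "bump p r x = 0"
proof -
  have "r \<le> norm (x - p)" using assms(1) by (simp add: dist_norm norm_minus_commute)
  then have "r\<^sup>2 \<le> (norm (x - p))\<^sup>2" using assms(2) by (rule power_mono)
  then show ?thesis by (simp add: bump_def power2_norm_eq_inner)
qed

lemma bump_lipschitz:
  assumes "0 \<le> r" shows "\<bar>bump p r x - bump p r y\<bar> \<le> 2 * r * norm (x - y)"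
proof -
  have e: "bump p r z = r\<^sup>2 - (min (norm (z - p)) r)\<^sup>2" for z
    using assms power_mono[of r "norm (z - p)" 2] power_mono[of "norm (z - p)" r 2]
    by (auto simp: bump_def min_def max_def power2_norm_eq_inner[symmetric])
  let ?a = "min (norm (x - p)) r" and ?b = "min (norm (y - p)) r"
  have "bump p r x - bump p r y = (?b - ?a) * (?b + ?a)" unfolding e by (simp add: power2_eq_square algebra_simps)
  then have "\<bar>bump p r x - bump p r y\<bar> = \<bar>?b - ?a\<bar> * \<bar>?b + ?a\<bar>" by (simp add: abs_mult)
  also have "\<dots> \<le> norm (x - y) * (2 * r)"
  proof (rule mult_mono)
    have "\<bar>norm (x - p) - norm (y - p)\<bar> \<le> norm (x - y)"
      using norm_triangle_ineq3[of "x - p" "y - p"] by simp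
    then show "\<bar>?b - ?a\<bar> \<le> norm (x - y)" by linarith
    show "\<bar>?b + ?a\<bar> \<le> 2 * r" using assms norm_ge_zero[of "x - p"] norm_ge_zero[of "y - p"] by linarith
  qed auto
  finally show ?thesis by (simp add: mult_ac)
qed

lemma has_derivative_bump:
  assumes "0 < r" "x \<notin> sphere p r"
  shows "(bump p r has_derivative (\<lambda>h. bump_grad p r x \<bullet> h)) (at x within S)"
proof (rule has_derivative_at_withinI)
  show "(bump p r has_derivative (\<lambda>h. bump_grad p r x \<bullet> h)) (at x)"
  proof (cases "x \<in> ball p r")
    case True
    have "((\<lambda>y. r\<^sup>2 - (y - p) \<bullet> (y - p)) has_derivative (\<lambda>h. bump_grad p r x \<bullet> h)) (at x)"
      using True by (auto intro!: derivative_eq_intros simp: bump_grad_def inner_commute inner_diff_left inner_diff_right algebra_simps)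
    then show ?thesis
    proof (rule has_derivative_transform_within_open[OF _ open_ball True])
      fix y assume "y \<in> ball p r"
      then have "norm (y - p) < r" by (simp add: dist_norm norm_minus_commute)
      then have "(norm (y - p))\<^sup>2 \<le> r\<^sup>2" by (intro power_mono) auto
      then show "r\<^sup>2 - (y - p) \<bullet> (y - p) = bump p r y" by (simp add: bump_def power2_norm_eq_inner)
    qed
  next
    case False
    then have x: "x \<in> - cball p r" using assms(2) by auto
    have "((\<lambda>y. 0) has_derivative (\<lambda>h. bump_grad p r x \<bullet> h)) (at x)"
      using False by (simp add: bump_grad_def)
    then show ?thesis
      by (rule has_derivative_transform_within_open[of _ _ _ _ "- cball p r"]) (use x assms(1) bump_outside[of _ p r] in auto)
  qed
qed

lemma bump_grad_bound: "\<bar>bump_grad p r x $ i\<bar> \<le> 2 * r" if "0 \<le> r"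
  using component_le_norm_cart[of "x - p" i] that
  by (auto simp: bump_grad_def dist_norm norm_minus_commute abs_mult)

lemma bump_grad_measurable: "(\<lambda>x. bump_grad p r x $ i) \<in> borel_measurable borel"
proof -
  have [measurable]: "(\<lambda>x :: real^'n. x $ k) \<in> borel_measurable borel" for k
    by (intro borel_measurable_continuous_onI continuous_intros)
  have "(\<lambda>x. bump_grad p r x $ i) = (\<lambda>x. if x \<in> ball p r then - 2 * (x $ i - p $ i) else 0)"
    by (auto simp: bump_grad_def fun_eq_iff)
  then show ?thesis by simp
qed

text \<open>The mean gradient of a bump over the half ball below a hyperplane through its centre is normal to the
  hyperplane. The half turn about the normal preserves the half ball and reverses the tangential directions.\<close>
lemma half_ball_integral:
  fixes p u :: "real^'n::{finite,wellorder}"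
  assumes r: "0 < r" and u: "u \<noteq> 0"
  shows "\<exists>\<gamma>>0. \<forall>S w. S \<inter> ball p r = {x \<in> ball p r. (x - p) \<bullet> u \<le> 0} \<longrightarrow>
    integral S (\<lambda>x. bump_grad p r x \<bullet> w) = \<gamma> * (w \<bullet> u)"
proof -
  let ?H = "{x \<in> ball p r. (x - p) \<bullet> u \<le> 0}"
  let ?J = "\<lambda>w. integral ?H (\<lambda>x. - 2 * ((x - p) \<bullet> w))"
  have H: "?H \<in> lmeasurable"
  proof -
    have "?H = ball p r \<inter> {x. u \<bullet> x \<le> u \<bullet> p}" by (auto simp: inner_diff_left inner_commute[of u])
    moreover have "{x. u \<bullet> x \<le> u \<bullet> p} \<in> sets lebesgue"
      using closed_halfspace_le[of u "u \<bullet> p"] by (simp add: borel_closed)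
    ultimately show ?thesis by (metis fmeasurable_Int_fmeasurable lmeasurable_ball)
  qed
  have ai: "(\<lambda>x. - 2 * ((x - p) \<bullet> w)) absolutely_integrable_on ?H" for w
  proof (rule bounded_measurable_absolutely_integrable[OF H])
    show "(\<lambda>x. - 2 * ((x - p) \<bullet> w)) \<in> borel_measurable borel"
      by (intro borel_measurable_continuous_onI continuous_intros)
    fix x assume "x \<in> ?H"
    then have "norm (x - p) \<le> r" by (simp add: dist_norm norm_minus_commute)
    then have "norm (x - p) * norm w \<le> r * norm w" by (intro mult_right_mono) auto
    then have "\<bar>(x - p) \<bullet> w\<bar> \<le> r * norm w" using Cauchy_Schwarz_ineq2[of "x - p" w] by linarith
    then show "\<bar>- 2 * ((x - p) \<bullet> w)\<bar> \<le> 2 * (r * norm w)" by (simp add: abs_mult)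
  qed
  then have int: "(\<lambda>x. - 2 * ((x - p) \<bullet> w)) integrable_on ?H" for w by (simp add: absolutely_integrable_on_def)
  have red: "integral S (\<lambda>x. bump_grad p r x \<bullet> w) = ?J w" if "S \<inter> ball p r = ?H" for S w
  proof -
    have "integral S (\<lambda>x. bump_grad p r x \<bullet> w) = integral S (\<lambda>x. if x \<in> ball p r then - 2 * ((x - p) \<bullet> w) else 0)"
      by (intro arg_cong[where f="integral S"]) (auto simp: bump_grad_def)
    also have "\<dots> = integral (S \<inter> ball p r) (\<lambda>x. - 2 * ((x - p) \<bullet> w))"
      unfolding Int_commute[of S] by (rule Henstock_Kurzweil_Integration.integral_restrict_Int)
    finally show ?thesis by (simp only: that)
  qed
  have uu: "0 < u \<bullet> u" using u by simp
  \<comment> \<open>The half ball is invariant under the half turn about the axis u.\<close>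
  define R where "R = (\<lambda>y. (2 * (y \<bullet> u) / (u \<bullet> u)) *\<^sub>R u - y)"
  have R_inner: "R y \<bullet> z = 2 * (y \<bullet> u) / (u \<bullet> u) * (u \<bullet> z) - y \<bullet> z" for y z
    by (simp add: R_def inner_diff_left)
  have Ru: "R y \<bullet> u = y \<bullet> u" for y using uu by (simp add: R_inner)
  have RR: "R y \<bullet> R z = y \<bullet> z" for y z
  proof -
    have "R y \<bullet> R z = 2 * (z \<bullet> u) / (u \<bullet> u) * (R y \<bullet> u) - R y \<bullet> z"
      using R_inner[of z "R y"] by (simp add: inner_commute)
    also have "R y \<bullet> u = y \<bullet> u" by (rule Ru)
    also have "2 * (z \<bullet> u) / (u \<bullet> u) * (y \<bullet> u) - R y \<bullet> z = y \<bullet> z"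
      unfolding R_inner inner_commute[of u z] by simp
    finally show ?thesis .
  qed
  have orth: "orthogonal_transformation R"
    unfolding orthogonal_transformation_def
  proof
    show "linear R"
      by (rule linearI) (simp_all add: R_def inner_add_left scaleR_add_left add_divide_distrib algebra_simps)
  qed (use RR in blast)
  have inv: "R (R y) = y" for y
  proof -
    have app: "R z = (2 * (z \<bullet> u) / (u \<bullet> u)) *\<^sub>R u - z" for z by (simp add: R_def)
    have "R (R y) = (2 * (R y \<bullet> u) / (u \<bullet> u)) *\<^sub>R u - R y" by (rule app)
    also have "\<dots> = y" unfolding Ru by (simp add: app[of y])
    finally show ?thesis .
  qed
  have nR: "norm (R y) = norm y" for y by (simp add: norm_eq_sqrt_inner RR)
  have img: "(\<lambda>x. (p - R p) + R x) ` ?H = ?H"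
  proof -
    have g: "(p - R p) + R x = p + R (x - p)" for x
      using linear_diff[OF orthogonal_transformation_linear[OF orth]] by simp
    have in_H: "(p - R p) + R x \<in> ?H" if "x \<in> ?H" for x
      unfolding g using that nR[of "x - p"] by (simp add: dist_norm Ru norm_minus_commute)
    have "(p - R p) + R ((p - R p) + R x) = x" for x unfolding g by (simp add: inv)
    then show ?thesis using in_H by (metis (no_types, lifting) image_eqI subsetI image_subsetI subset_antisym)
  qed
  have odd: "?J w = 0" if "w \<bullet> u = 0" for w
  proof -
    have "?J w = integral ?H (\<lambda>x. - 2 * (((p - R p) + R x - p) \<bullet> w))"
      by (rule integral_isometry[OF orth fmeasurableD[OF H] img ai])
    also have "\<dots> = integral ?H (\<lambda>x. - (- 2 * ((x - p) \<bullet> w)))"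
    proof (rule arg_cong[where f="integral ?H"], rule ext)
      fix x
      have "(p - R p + R x - p) \<bullet> w = R x \<bullet> w - R p \<bullet> w" by (simp add: inner_diff_left inner_add_left)
      also have "\<dots> = - ((x - p) \<bullet> w)" using that by (simp add: R_inner inner_commute[of u w] inner_diff_left)
      finally show "- 2 * ((p - R p + R x - p) \<bullet> w) = - (- 2 * ((x - p) \<bullet> w))" by simp
    qed
    also have "\<dots> = - ?J w" by (rule integral_neg)
    finally show ?thesis by simp
  qed
  have lin: "?J w = (w \<bullet> u) / (u \<bullet> u) * ?J u" for w
  proof -
    define a where "a = (w \<bullet> u) / (u \<bullet> u)"
    have "(w - a *\<^sub>R u) \<bullet> u = 0" using uu by (simp add: inner_diff_left a_def)
    then have 0: "?J (w - a *\<^sub>R u) = 0" by (rule odd)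
    have "?J w = integral ?H (\<lambda>x. a * (- 2 * ((x - p) \<bullet> u)) + - 2 * ((x - p) \<bullet> (w - a *\<^sub>R u)))"
      by (intro arg_cong[where f="integral ?H"] ext) (simp add: inner_diff_right algebra_simps)
    also have "\<dots> = integral ?H (\<lambda>x. a * (- 2 * ((x - p) \<bullet> u))) + ?J (w - a *\<^sub>R u)"
      by (rule integral_add[OF integrable_on_mult_right[OF int] int])
    also have "integral ?H (\<lambda>x. a * (- 2 * ((x - p) \<bullet> u))) = a * ?J u" by (rule integral_mult_right)
    finally show ?thesis using 0 by (simp add: a_def)
  qed
  have pos: "0 < ?J u"
  proof -
    define z where "z = p - (r / (2 * norm u)) *\<^sub>R u"
    have nu: "0 < norm u" using u by simp
    let ?B = "ball z (r / 4)"
    have key: "(x - p) \<bullet> u \<le> - (r / 4 * norm u)" "norm (x - p) < r" if "x \<in> ?B" for x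
    proof -
      have zx: "norm (x - z) < r / 4" using that by (simp add: dist_norm norm_minus_commute)
      have e: "x - p = (x - z) - (r / (2 * norm u)) *\<^sub>R u" by (simp add: z_def)
      have "(x - z) \<bullet> u \<le> norm (x - z) * norm u" using Cauchy_Schwarz_ineq2[of "x - z" u] by linarith
      also have "\<dots> \<le> r / 4 * norm u" using zx by (intro mult_right_mono) auto
      finally have 1: "(x - z) \<bullet> u \<le> r / 4 * norm u" .
      have "(r / (2 * norm u)) *\<^sub>R u \<bullet> u = r / 2 * norm u"
        using nu by (simp add: power2_norm_eq_inner[symmetric] power2_eq_square)
      then show "(x - p) \<bullet> u \<le> - (r / 4 * norm u)" unfolding e inner_diff_left[of "x - z"] using 1 by linarith
      have "norm ((r / (2 * norm u)) *\<^sub>R u) = r / 2" using nu r by simp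
      then show "norm (x - p) < r" unfolding e using zx norm_triangle_ineq4[of "x - z" "(r / (2 * norm u)) *\<^sub>R u"] r by linarith
    qed
    have c0: "0 < r / 4 * norm u" using r nu by simp
    have BH: "?B \<subseteq> ?H"
    proof
      fix x assume x: "x \<in> ?B"
      show "x \<in> ?H" using key[OF x] c0 by (simp add: dist_norm norm_minus_commute)
    qed
    have intB: "(\<lambda>x. r / 2 * norm u) integrable_on ?B" by (intro integrable_on_const lmeasurable_ball)
    have "(\<lambda>x. - 2 * ((x - p) \<bullet> u)) absolutely_integrable_on ?B"
      using ai by (rule set_integrable_subset) (use BH in auto)
    then have intB2: "(\<lambda>x. - 2 * ((x - p) \<bullet> u)) integrable_on ?B" by (simp add: absolutely_integrable_on_def)
    have "integral ?B (\<lambda>x. r / 2 * norm u) \<le> integral ?B (\<lambda>x. - 2 * ((x - p) \<bullet> u))"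
      by (rule integral_le[OF intB intB2]) (use key in force)
    also have "\<dots> \<le> ?J u"
      by (rule integral_subset_le[OF BH intB2 int]) auto
    finally have "integral ?B (\<lambda>x. r / 2 * norm u) \<le> ?J u" .
    moreover have "integral ?B (\<lambda>x. r / 2 * norm u) = r / 2 * norm u * measure lebesgue ?B"
      using integral_mult_right[where c="r / 2 * norm u" and S="?B" and f="\<lambda>x. 1"]
      unfolding lmeasure_integral[OF lmeasurable_ball] by (simp only: mult_1_right)
    moreover have "0 < measure lebesgue ?B"
      using r content_ball_pos[of "r / 4" z] by (simp add: measure_completion)
    moreover have "0 < r / 2 * norm u" using r nu by simp
    ultimately show ?thesis using mult_pos_pos[of "r / 2 * norm u" "measure lebesgue ?B"] by linarith
  qed
  show ?thesis
  proof (intro exI[of _ "?J u / (u \<bullet> u)"] conjI allI impI)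
    show "0 < ?J u / (u \<bullet> u)" using pos uu by (rule divide_pos_pos)
    fix S w assume "S \<inter> ball p r = ?H"
    then have "integral S (\<lambda>x. bump_grad p r x \<bullet> w) = ?J w" by (rule red)
    also have "\<dots> = (w \<bullet> u) / (u \<bullet> u) * ?J u" by (rule lin)
    also have "\<dots> = ?J u / (u \<bullet> u) * (w \<bullet> u)" by (simp only: times_divide_eq_left times_divide_eq_right mult.commute)
    finally show "integral S (\<lambda>x. bump_grad p r x \<bullet> w) = ?J u / (u \<bullet> u) * (w \<bullet> u)" .
  qed
qed

section \<open>Volume bounds from piecewise linear maps\<close>

text \<open>The Lipschitz bounds on the weights and on the bump make the map injective for small \<open>e\<close>. By
  \<open>integral_grad_inner\<close> only the component of \<open>D c\<close> along \<open>c\<close> survives in the integral of the divergence.\<close>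
lemma piecewise_linear_volume:
  "\<exists>C \<epsilon>0. 0 \<le> C \<and> 0 < \<epsilon>0 \<and>
    (\<forall>(S :: (real^'n::{finite,wellorder}) set) T D w p r e.
      S \<in> lmeasurable \<longrightarrow> sym_set S \<longrightarrow> T \<in> lmeasurable \<longrightarrow> e \<le> \<epsilon>0 \<longrightarrow> 0 < r \<longrightarrow> r \<le> 1 \<longrightarrow>
      (\<forall>c\<in>faces. \<forall>i. \<bar>D c $ i\<bar> \<le> e) \<longrightarrow> (\<forall>i. \<bar>w $ i\<bar> \<le> e) \<longrightarrow>
      (\<forall>x\<in>S. x + ((\<Sum>c\<in>faces. weight c x *\<^sub>R D c) + bump p r x *\<^sub>R w) \<in> T) \<longrightarrow>
      (1 - C * e\<^sup>2 + (\<Sum>c\<in>faces. (c \<bullet> D c) / (l1 c * class_size c))) * measure lebesgue S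
        + integral S (\<lambda>x. bump_grad p r x \<bullet> w) \<le> measure lebesgue T)"
proof -
  let ?n = "real CARD('n)"
  define L where "L = real (card (faces :: (real^'n::_) set)) + 2"
  have L: "2 \<le> L" by (simp add: L_def)
  obtain C0 where C0: "0 \<le> C0" "\<And>(M :: real^'n::_^'n::_) e. (\<forall>i j. \<bar>M $ i $ j\<bar> \<le> e) \<Longrightarrow> e \<le> 1 \<Longrightarrow>
     1 + trace M - C0 * e\<^sup>2 \<le> det (mat 1 + M)"
    using det_near_id[where 'n='n] by blast
  define \<epsilon>0 where "\<epsilon>0 = 1 / (2 * L * ?n * ?n)"
  have n1: "1 \<le> ?n" by (simp add: Suc_le_eq)
  have e0: "0 < \<epsilon>0" using L n1 by (simp add: \<epsilon>0_def)
  have Ln: "L * ?n * ?n * \<epsilon>0 = 1 / 2" using L n1 by (simp add: \<epsilon>0_def)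
  have L1: "L * \<epsilon>0 \<le> 1 / 2"
  proof -
    have "L * 1 * 1 * \<epsilon>0 \<le> L * ?n * ?n * \<epsilon>0" using L n1 e0 by (intro mult_mono) auto
    then show ?thesis using Ln by simp
  qed
  show ?thesis
  proof (rule exI[of _ "C0 * L\<^sup>2"], rule exI[of _ \<epsilon>0], intro conjI allI impI)
    show "0 \<le> C0 * L\<^sup>2" using C0(1) by simp
    show "0 < \<epsilon>0" by (rule e0)
    fix S T :: "(real^'n::_) set" and D w p and r e :: real
    assume S: "S \<in> lmeasurable" "sym_set S" and T: "T \<in> lmeasurable" and e: "e \<le> \<epsilon>0" and r: "0 < r" "r \<le> 1"
      and D: "\<forall>c\<in>faces. \<forall>i. \<bar>D c $ i\<bar> \<le> e" and w: "\<forall>i. \<bar>w $ i\<bar> \<le> e"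
      and sub: "\<forall>x\<in>S. x + ((\<Sum>c\<in>faces. weight c x *\<^sub>R D c) + bump p r x *\<^sub>R w) \<in> T"
    have epos: "0 \<le> e" using w by (meson abs_ge_zero order_trans)
    define E where "E = (\<lambda>x. (\<Sum>c\<in>faces. weight c x *\<^sub>R D c) + bump p r x *\<^sub>R w)"
    define M where "M = (\<lambda>x. \<chi> i j. (\<Sum>c\<in>faces. D c $ i * grad c x $ j) + w $ i * bump_grad p r x $ j)"
    define N where "N = - (generic :: (real^'n::_) set) \<union> sphere p r"
    have N: "negligible N" unfolding N_def
      by (intro negligible_Un negligible_not_generic negligible_sphere)
    have Mv: "M x *v h = (\<Sum>c\<in>faces. (grad c x \<bullet> h) *\<^sub>R D c) + (bump_grad p r x \<bullet> h) *\<^sub>R w" for x h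
    proof -
      have "(M x *v h) $ i = (\<Sum>c\<in>faces. (grad c x \<bullet> h) * D c $ i) + (bump_grad p r x \<bullet> h) * w $ i" for i
      proof -
      have "(M x *v h) $ i = (\<Sum>j\<in>UNIV. (\<Sum>c\<in>faces. D c $ i * grad c x $ j * h $ j)) + (\<Sum>j\<in>UNIV. w $ i * bump_grad p r x $ j * h $ j)"
        by (simp add: matrix_vector_mult_def M_def ring_distribs sum_distrib_right sum.distrib)
      also have "\<dots> = (\<Sum>c\<in>faces. (grad c x \<bullet> h) * D c $ i) + (bump_grad p r x \<bullet> h) * w $ i"
        unfolding sum.swap[of _ faces] inner_vec_sum sum_distrib_right
        by (intro arg_cong2[where f="(+)"] sum.cong) (simp_all add: mult_ac)
      finally show ?thesis .
      qed
      then show ?thesis by (simp add: vec_eq_iff sum_component)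
    qed
    have der: "(E has_derivative (\<lambda>h. M x *v h)) (at x within (S - N))" if "x \<in> S - N" for x
      unfolding E_def Mv
      using that r by (intro has_derivative_add has_derivative_sum has_derivative_scaleR_left has_derivative_weight has_derivative_bump)
        (auto simp: N_def)
    have bM: "\<bar>M x $ i $ j\<bar> \<le> L * e" for x i j
    proof -
      have "\<bar>\<Sum>c\<in>faces. D c $ i * grad c x $ j\<bar> \<le> (\<Sum>c\<in>(faces :: (real^'n::_) set). e)"
      proof (rule order_trans[OF sum_abs sum_mono])
        fix c :: "real^'n::_" assume c: "c \<in> faces"
        have "\<bar>D c $ i\<bar> * \<bar>grad c x $ j\<bar> \<le> e * 1" using D c grad_bound[OF c] epos by (intro mult_mono) auto
        then show "\<bar>D c $ i * grad c x $ j\<bar> \<le> e" by (simp add: abs_mult)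
      qed
      moreover have "\<bar>w $ i * bump_grad p r x $ j\<bar> \<le> e * 2"
      proof -
        have "\<bar>bump_grad p r x $ j\<bar> \<le> 2" using bump_grad_bound[of r p x j] r by linarith
        then show ?thesis unfolding abs_mult using w epos by (intro mult_mono) auto
      qed
      ultimately show ?thesis by (simp add: M_def L_def algebra_simps)
    qed
    have Le: "L * e \<le> 1" using L e L1 mult_left_mono[of e \<epsilon>0 L] by linarith
    have measM: "(\<lambda>x. M x $ i $ j) \<in> borel_measurable borel" for i j
      unfolding M_def vec_lambda_beta
      by (intro borel_measurable_add borel_measurable_sum borel_measurable_times grad_measurable bump_grad_measurable) auto
    have Elip: "norm (E x - E y) \<le> (L * ?n * ?n * e) * norm (x - y)" for x y
    proof -
      have nD: "norm v \<le> ?n * e" if "\<forall>i. \<bar>v $ i\<bar> \<le> e" for v :: "real^'n::_"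
      proof -
        have "l1 v \<le> (\<Sum>i\<in>(UNIV::'n set). e)" unfolding l1_def using that by (intro sum_mono) auto
        then show ?thesis using norm_le_l1_vec[of v] by simp
      qed
      have "E x - E y = (\<Sum>c\<in>faces. (weight c x - weight c y) *\<^sub>R D c) + (bump p r x - bump p r y) *\<^sub>R w"
        by (simp add: E_def scaleR_diff_left sum_subtractf)
      also have "norm \<dots> \<le> (\<Sum>c\<in>faces. norm ((weight c x - weight c y) *\<^sub>R D c)) + norm ((bump p r x - bump p r y) *\<^sub>R w)"
        by (intro order_trans[OF norm_triangle_ineq] add_right_mono norm_sum)
      also have "\<dots> \<le> (\<Sum>c\<in>(faces :: (real^'n::_) set). (?n * norm (x - y)) * (?n * e)) + (2 * ?n * norm (x - y)) * (?n * e)"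
      proof (intro add_mono sum_mono)
        fix c :: "real^'n::_" assume c: "c \<in> faces"
        have "\<bar>weight c x - weight c y\<bar> \<le> ?n * norm (x - y)"
          using weight_lipschitz[OF c, of x y] l1_le_norm[of "x - y"] by linarith
        then show "norm ((weight c x - weight c y) *\<^sub>R D c) \<le> (?n * norm (x - y)) * (?n * e)"
          unfolding norm_scaleR using nD[of "D c"] D c by (intro mult_mono) auto
      next
        have "2 * r * norm (x - y) \<le> 2 * ?n * norm (x - y)" using r n1 by (intro mult_right_mono mult_left_mono norm_ge_zero) linarith+
        then have "\<bar>bump p r x - bump p r y\<bar> \<le> 2 * ?n * norm (x - y)"
          using bump_lipschitz[of r p x y] r by linarith
        then show "norm ((bump p r x - bump p r y) *\<^sub>R w) \<le> (2 * ?n * norm (x - y)) * (?n * e)"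
          unfolding norm_scaleR using nD[of w] w by (intro mult_mono) auto
      qed
      also have "\<dots> = (L * ?n * ?n * e) * norm (x - y)" by (simp add: L_def algebra_simps)
      finally show ?thesis .
    qed
    have inj: "inj_on (\<lambda>x. x + E x) S"
    proof (rule inj_onI, rule ccontr)
      fix x y assume eq: "x + E x = y + E y" and ne: "x \<noteq> y"
      have "E x - E y = y - x" using eq by (simp add: algebra_simps)
      then have "norm (x - y) \<le> (L * ?n * ?n * e) * norm (x - y)" using Elip[of x y] by (simp add: norm_minus_commute)
      also have "\<dots> \<le> (1 / 2) * norm (x - y)"
      proof (rule mult_right_mono)
        have "L * ?n * ?n * e \<le> L * ?n * ?n * \<epsilon>0" using e L n1 by (intro mult_left_mono) auto
        then show "L * ?n * ?n * e \<le> 1 / 2" using Ln by simp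
      qed simp
      finally show False using ne by simp
    qed
    have "(1 - C0 * (L * e)\<^sup>2) * measure lebesgue S + integral S (\<lambda>x. trace (M x)) \<le> measure lebesgue T"
      by (rule volume_perturbation[OF S(1) T N der inj _ bM Le measM])
         (use sub C0(2)[of "M _" "L * e"] bM Le in \<open>auto simp: E_def\<close>)
    moreover have "integral S (\<lambda>x. trace (M x)) =
       (\<Sum>c\<in>faces. (c \<bullet> D c) / (l1 c * class_size c)) * measure lebesgue S + integral S (\<lambda>x. bump_grad p r x \<bullet> w)"
    proof -
      have tr: "trace (M x) = (\<Sum>c\<in>faces. grad c x \<bullet> D c) + bump_grad p r x \<bullet> w" for x
        unfolding trace_def M_def vec_lambda_beta sum.distrib inner_vec_sum
        by (subst sum.swap) (simp add: mult.commute)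
      have i1: "(\<lambda>x. grad c x \<bullet> D c) integrable_on S" if "c \<in> faces" for c
        unfolding inner_vec_sum using grad_absolutely_integrable[OF S(1) that]
        by (auto simp: absolutely_integrable_on_def intro!: integrable_sum integrable_on_mult_left)
      have "(\<lambda>x. bump_grad p r x $ i) absolutely_integrable_on S" for i
        using r by (intro bounded_measurable_absolutely_integrable[OF S(1) bump_grad_measurable bump_grad_bound]) auto
      then have i2: "(\<lambda>x. bump_grad p r x \<bullet> w) integrable_on S"
        unfolding inner_vec_sum
        by (auto simp: absolutely_integrable_on_def intro!: integrable_sum integrable_on_mult_left)
      have "integral S (\<lambda>x. trace (M x)) = integral S (\<lambda>x. \<Sum>c\<in>faces. grad c x \<bullet> D c) + integral S (\<lambda>x. bump_grad p r x \<bullet> w)"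
        unfolding tr using i1 i2 finite_faces by (intro integral_add integrable_sum) auto
      also have "integral S (\<lambda>x. \<Sum>c\<in>faces. grad c x \<bullet> D c) = (\<Sum>c\<in>faces. integral S (\<lambda>x. grad c x \<bullet> D c))"
        using i1 finite_faces by (intro integral_sum) auto
      also have "\<dots> = (\<Sum>c\<in>faces. (c \<bullet> D c) / (l1 c * class_size c) * measure lebesgue S)"
        using integral_grad_inner[OF S] by (intro sum.cong) auto
      finally show ?thesis by (simp add: sum_distrib_right)
    qed
    ultimately show "(1 - C0 * L\<^sup>2 * e\<^sup>2 + (\<Sum>c\<in>faces. (c \<bullet> D c) / (l1 c * class_size c))) * measure lebesgue S
        + integral S (\<lambda>x. bump_grad p r x \<bullet> w) \<le> measure lebesgue T"
      by (simp add: algebra_simps power_mult_distrib)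
  qed
qed

section \<open>Polarity and contact points near the cube\<close>

lemma inverse_one_minus_le:
  fixes d :: real
  assumes "0 \<le> d" "d \<le> 1/2" shows "1 / (1 - d) \<le> 1 + 2 * d"
proof -
  have "0 \<le> d * (1 - 2 * d)" using assms by simp
  then have "1 \<le> (1 + 2 * d) * (1 - d)" by (simp add: algebra_simps)
  then show ?thesis using assms by (simp add: divide_le_eq)
qed

lemma mem_unit_cube: "x \<in> unit_cube \<longleftrightarrow> (\<forall>i. \<bar>x $ i\<bar> \<le> 1)"
  by (simp add: unit_cube_def)

lemma unit_cube_cbox: "(unit_cube :: (real^'n::finite) set) = cbox (\<chi> i. -1) (\<chi> i. 1)"
  by (auto simp: mem_unit_cube mem_box_cart abs_le_iff minus_le_iff)

lemma compact_unit_cube: "compact (unit_cube :: (real^'n::finite) set)"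
  by (simp add: unit_cube_cbox compact_cbox)

lemma inner_le_l1:
  fixes x y :: "real^'n::finite"
  assumes "x \<in> unit_cube" shows "\<bar>x \<bullet> y\<bar> \<le> l1 y"
proof -
  have "\<bar>x \<bullet> y\<bar> \<le> (\<Sum>i\<in>UNIV. \<bar>x $ i * y $ i\<bar>)" unfolding inner_vec_sum by (rule sum_abs)
  also have "\<dots> \<le> l1 y" unfolding l1_def
  proof (rule sum_mono)
    fix i
    have "\<bar>x $ i\<bar> * \<bar>y $ i\<bar> \<le> 1 * \<bar>y $ i\<bar>" using assms by (intro mult_right_mono) (auto simp: mem_unit_cube)
    then show "\<bar>x $ i * y $ i\<bar> \<le> \<bar>y $ i\<bar>" by (simp add: abs_mult)
  qed
  finally show ?thesis .
qed

lemma l1_attained: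
  fixes y :: "real^'n::finite"
  shows "(\<chi> i. sgn (y $ i)) \<in> unit_cube" "(\<chi> i. sgn (y $ i)) \<bullet> y = l1 y"
  by (auto simp: mem_unit_cube sgn_real_def inner_vec_sum l1_def intro!: sum.cong)

lemma polar_l1_le:
  fixes K :: "(real^'n::finite) set"
  assumes "0 < t" "\<And>x. x \<in> unit_cube \<Longrightarrow> t *\<^sub>R x \<in> K" "\<xi> \<in> polar K"
  shows "l1 \<xi> \<le> 1 / t"
proof -
  have "t *\<^sub>R (\<chi> i. sgn (\<xi> $ i)) \<in> K" by (rule assms(2)[OF l1_attained(1)])
  then have "(t *\<^sub>R (\<chi> i. sgn (\<xi> $ i))) \<bullet> \<xi> \<le> 1" using assms(3) unfolding polar_def by blast
  then have "t * l1 \<xi> \<le> 1" by (simp only: inner_scaleR_left l1_attained(2))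
  then show ?thesis using assms(1) by (simp add: field_simps)
qed

lemma polar_unit_cube: "polar (unit_cube :: (real^'n::finite) set) = {\<xi>. l1 \<xi> \<le> 1}"
proof (intro set_eqI iffI)
  fix \<xi> :: "real^'n" assume "\<xi> \<in> polar unit_cube"
  then show "\<xi> \<in> {\<xi>. l1 \<xi> \<le> 1}" using polar_l1_le[of 1 unit_cube \<xi>] by simp
next
  fix \<xi> :: "real^'n" assume "\<xi> \<in> {\<xi>. l1 \<xi> \<le> 1}"
  then have "x \<bullet> \<xi> \<le> 1" if "x \<in> unit_cube" for x using inner_le_l1[OF that, of \<xi>] by simp
  then show "\<xi> \<in> polar unit_cube" by (simp add: polar_def)
qed

lemma closed_polar: "closed (polar K)"
proof -
  have "polar K = (\<Inter>x\<in>K. {\<xi>. x \<bullet> \<xi> \<le> 1})" by (auto simp: polar_def)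
  then show ?thesis by (auto intro: closed_halfspace_le)
qed

lemma convex_polar: "convex (polar K)"
proof -
  have "polar K = (\<Inter>x\<in>K. {\<xi>. x \<bullet> \<xi> \<le> 1})" by (auto simp: polar_def)
  then show ?thesis by (auto intro!: convex_INT convex_halfspace_le)
qed

lemma zero_polar: "0 \<in> polar K"
  by (simp add: polar_def)

lemma compact_polar:
  fixes K :: "(real^'n::finite) set"
  assumes "0 < t" "\<And>x. x \<in> unit_cube \<Longrightarrow> t *\<^sub>R x \<in> K"
  shows "compact (polar K)"
  unfolding compact_eq_bounded_closed
proof
  have "norm \<xi> \<le> 1 / t" if "\<xi> \<in> polar K" for \<xi>
    using polar_l1_le[OF assms that] norm_le_l1_vec[of \<xi>] by linarith
  then show "bounded (polar K)" by (auto simp: bounded_iff)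
qed (rule closed_polar)

lemma compact_polar_cube: "compact (polar (unit_cube :: (real^'n::finite) set))"
  by (rule compact_polar[of 1]) auto

lemma bipolar:
  assumes "closed K" "convex K" "0 \<in> K" "\<And>\<xi>. \<xi> \<in> polar K \<Longrightarrow> x \<bullet> \<xi> \<le> 1"
  shows "x \<in> K"
proof (rule ccontr)
  assume "x \<notin> K"
  then obtain a b where ab: "a \<bullet> x < b" "\<forall>y\<in>K. b < a \<bullet> y"
    using separating_hyperplane_closed_point[OF assms(2,1)] by blast
  have b: "b < 0" using ab(2) assms(3) by force
  have "(1 / b) *\<^sub>R a \<in> polar K"
    unfolding polar_def
  proof (intro CollectI ballI)
    fix y assume "y \<in> K"
    then have "b < a \<bullet> y" using ab(2) by blast
    then show "y \<bullet> ((1 / b) *\<^sub>R a) \<le> 1" using b by (simp add: inner_commute divide_simps)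
  qed
  then have "x \<bullet> ((1 / b) *\<^sub>R a) \<le> 1" by (rule assms(4))
  then show False using b ab(1) by (simp add: inner_commute divide_simps split: if_splits)
qed

lemma face_inner_self:
  assumes "c \<in> faces" shows "c \<bullet> c = l1 (c :: real^'n::finite)"
  unfolding inner_vec_sum l1_def
proof (rule sum.cong)
  show "c $ i * c $ i = \<bar>c $ i\<bar>" for i using faces_cases[OF assms, of i] by auto
qed simp

lemma faces_unit_cube:
  assumes "c \<in> faces" shows "c \<in> unit_cube"
  unfolding mem_unit_cube
proof
  show "\<bar>c $ i\<bar> \<le> 1" for i using faces_cases[OF assms, of i] by auto
qed

text \<open>The contact points of the face \<open>c\<close>: \<open>x\<close> is a farthest point of the section of \<open>K\<close> by the coordinate subspace of the
  support of \<open>c\<close>, and \<open>\<xi>\<close> is a supporting functional of this section, extended to a point of the polar. At a facet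
  centre both are pinned to \<open>c\<close>, which is where the bump argument starts.\<close>
definition contact :: "(real^'n::finite) set \<Rightarrow> real^'n \<Rightarrow> real^'n \<Rightarrow> real^'n \<Rightarrow> real \<Rightarrow> bool" where
  "contact K c x \<xi> r \<longleftrightarrow> x \<in> K \<and> \<xi> \<in> polar K \<and> 0 < r \<and> x \<bullet> c = r * l1 c \<and> (\<forall>i. c $ i = 0 \<longrightarrow> x $ i = 0) \<and>
    (\<forall>y\<in>K. (\<forall>i. c $ i = 0 \<longrightarrow> y $ i = 0) \<longrightarrow> y \<bullet> c \<le> r * l1 c) \<and>
    (\<forall>i. c $ i \<noteq> 0 \<longrightarrow> \<xi> $ i = c $ i / (r * l1 c)) \<and> (l1 c = 1 \<longrightarrow> x = c \<and> \<xi> = c)"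

text \<open>Extending the supporting functional means that \<open>c / (r * l1 c)\<close> lies in the projection of the polar to the
  coordinate subspace; otherwise a separating vector of the subspace would, by the bipolar theorem, give a point of
  the section beyond \<open>x\<close>.\<close>
lemma contact_pair:
  fixes K :: "(real^'n::finite) set"
  assumes K: "compact K" "convex K" and t: "0 < t" "\<And>x. x \<in> unit_cube \<Longrightarrow> t *\<^sub>R x \<in> K"
    and Kc: "K \<subseteq> unit_cube" and ax: "\<And>i. axis i 1 \<in> K" "\<And>i. - axis i 1 \<in> K" and c: "c \<in> faces"
  shows "\<exists>x \<xi> r. contact K c x \<xi> r"
proof (cases "l1 c = 1")
  case True
  then have "card {i. c $ i \<noteq> 0} = 1" using l1_face[OF c] by simp
  then obtain i where i: "{i. c $ i \<noteq> 0} = {i}" by (auto simp: card_1_singleton_iff)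
  then have "c $ i = 1 \<or> c $ i = -1" using faces_cases[OF c, of i] by auto
  moreover have "c = c $ i *\<^sub>R axis i 1" using i by (auto simp: vec_eq_iff axis_def)
  ultimately have cK: "c \<in> K" using ax[of i] by (metis scaleR_minus1_left scaleR_one)
  have yc: "y \<bullet> c \<le> 1" if "y \<in> K" for y using inner_le_l1[of y c] that Kc True by auto
  then have "c \<in> polar K" by (simp add: polar_def)
  then show ?thesis using cK yc True face_inner_self[OF c] unfolding contact_def
    by (intro exI[of _ c] exI[of _ "1::real"] conjI) auto
next
  case False
  define V where "V = {x :: real^'n. \<forall>i. c $ i = 0 \<longrightarrow> x $ i = 0}"
  have "V = (\<Inter>i\<in>{i. c $ i = 0}. {x. axis i 1 \<bullet> x = 0})" by (auto simp: V_def inner_axis')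
  then have "closed V" by (auto intro!: closed_INT closed_hyperplane)
  then have cKV: "compact (K \<inter> V)" using K(1) by (simp add: compact_Int_closed)
  have tc: "t *\<^sub>R c \<in> K \<inter> V" using t(2)[OF faces_unit_cube[OF c]] by (simp add: V_def)
  have "continuous_on (K \<inter> V) (\<lambda>x. x \<bullet> c)" by (intro continuous_intros)
  then obtain x where x: "x \<in> K \<inter> V" "\<forall>y\<in>K \<inter> V. y \<bullet> c \<le> x \<bullet> c"
    using continuous_attains_sup[OF cKV] tc by blast
  define r where "r = x \<bullet> c / l1 c"
  have l: "0 < l1 c" by (rule l1_face_pos[OF c])
  have xr: "x \<bullet> c = r * l1 c" using l by (simp add: r_def)
  have "(t *\<^sub>R c) \<bullet> c \<le> x \<bullet> c" using x(2) tc by blast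
  then have "t * l1 c \<le> x \<bullet> c" by (simp add: face_inner_self[OF c])
  moreover have "0 < t * l1 c" using t(1) l by simp
  ultimately have r: "0 < r" "0 < r * l1 c" using l xr by (simp_all add: zero_less_mult_iff)
  define P where "P = (\<lambda>\<xi> :: real^'n. \<chi> i. if c $ i = 0 then 0 else \<xi> $ i)"
  have P: "linear P" unfolding P_def by (rule linearI) (simp_all add: vec_eq_iff)
  have Padj: "P a \<bullet> \<xi> = a \<bullet> P \<xi>" for a \<xi>
    unfolding inner_vec_sum by (intro sum.cong) (simp_all add: P_def)
  have comp: "compact (P ` polar K)"
    using compact_polar[OF t] P by (intro compact_continuous_image linear_continuous_on) (auto simp: linear_conv_bounded_linear)
  have conv: "convex (P ` polar K)" by (intro convex_linear_image P convex_polar)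
  define \<eta> where "\<eta> = (1 / (r * l1 c)) *\<^sub>R c"
  have "\<eta> \<in> P ` polar K"
  proof (rule ccontr)
    assume "\<eta> \<notin> P ` polar K"
    then obtain a b where ab: "a \<bullet> \<eta> < b" "\<forall>y\<in>P ` polar K. b < a \<bullet> y"
      using separating_hyperplane_closed_point[OF conv compact_imp_closed[OF comp]] by blast
    have P0: "P 0 = 0" using P by (rule linear_0)
    have b: "b < 0" using ab(2) zero_polar[of K] P0 by force
    have zK: "(1 / b) *\<^sub>R P a \<in> K"
    proof (rule bipolar[OF compact_imp_closed[OF K(1)] K(2)])
      show "0 \<in> K" using t(2)[of 0] by (simp add: mem_unit_cube)
      fix \<xi> assume "\<xi> \<in> polar K"
      then have "b < P a \<bullet> \<xi>" using ab(2) Padj by auto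
      then show "((1 / b) *\<^sub>R P a) \<bullet> \<xi> \<le> 1" using b by (simp add: divide_simps)
    qed
    have "(1 / b) *\<^sub>R P a \<in> V" by (simp add: V_def P_def)
    then have "((1 / b) *\<^sub>R P a) \<bullet> c \<le> x \<bullet> c" using x(2) zK by blast
    then have le: "((1 / b) *\<^sub>R P a) \<bullet> c \<le> r * l1 c" by (simp only: xr)
    have "P \<eta> = \<eta>" by (simp add: P_def \<eta>_def vec_eq_iff)
    then have "P a \<bullet> \<eta> < b" using ab(1) Padj by simp
    then have "P a \<bullet> c < b * (r * l1 c)" using r by (simp add: \<eta>_def divide_simps)
    then have "r * l1 c < ((1 / b) *\<^sub>R P a) \<bullet> c" using b by (simp add: divide_simps mult_ac)
    then show False using le by simp
  qed
  then obtain \<xi> where \<xi>: "\<xi> \<in> polar K" "\<eta> = P \<xi>" by blast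
  have "\<xi> $ i = c $ i / (r * l1 c)" if "c $ i \<noteq> 0" for i
  proof -
    have "P \<xi> $ i = \<xi> $ i" using that by (simp add: P_def)
    then have "\<xi> $ i = \<eta> $ i" using \<xi>(2) by simp
    then show ?thesis by (simp add: \<eta>_def)
  qed
  then show ?thesis using x xr r(1) \<xi>(1) False unfolding contact_def
    by (intro exI[of _ x] exI[of _ \<xi>] exI[of _ r]) (auto simp: V_def)
qed

text \<open>The coordinates of \<open>x\<close> on the support are at most one in modulus and their signed mean is \<open>r\<close>, so each is
  close to one. The part of \<open>\<xi>\<close> on the support already has \<open>l1\<close>-norm \<open>1 / r \<ge> 1\<close>, which leaves little outside.\<close>
lemma contact_pair_estimates:
  fixes K :: "(real^'n::finite) set"
  assumes d: "0 \<le> d" "d \<le> 1/2" "\<And>x. x \<in> unit_cube \<Longrightarrow> (1 - d) *\<^sub>R x \<in> K" and Kc: "K \<subseteq> unit_cube"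
    and c: "c \<in> faces" and ct: "contact K c x \<xi> r"
  shows "1 - d \<le> r" "r \<le> 1" "\<bar>x $ i - c $ i\<bar> \<le> real CARD('n) * d"
    "\<bar>l1 c * \<xi> $ i - c $ i\<bar> \<le> 2 * real CARD('n) * d"
proof -
  have x: "x \<in> K" "x \<bullet> c = r * l1 c" "\<forall>i. c $ i = 0 \<longrightarrow> x $ i = 0"
    and max: "\<forall>y\<in>K. (\<forall>i. c $ i = 0 \<longrightarrow> y $ i = 0) \<longrightarrow> y \<bullet> c \<le> r * l1 c"
    and \<xi>: "\<xi> \<in> polar K" "\<forall>i. c $ i \<noteq> 0 \<longrightarrow> \<xi> $ i = c $ i / (r * l1 c)"
    using ct unfolding contact_def by blast+
  let ?n = "real CARD('n)"
  have l: "0 < l1 c" by (rule l1_face_pos[OF c])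
  have ln: "l1 c \<le> ?n" unfolding l1_face[OF c] by (simp add: card_mono)
  have "(1 - d) *\<^sub>R c \<bullet> c \<le> r * l1 c"
    using max d(3)[OF faces_unit_cube[OF c]] by auto
  then show r1: "1 - d \<le> r" using l by (simp add: face_inner_self[OF c])
  have "x \<in> unit_cube" using x(1) Kc by blast
  then have "x \<bullet> c \<le> l1 c" using inner_le_l1[of x c] by simp
  then show r2: "r \<le> 1" using l x(2) by simp
  have r0: "0 < r" using r1 d(2) by linarith
  have "1 / r \<le> 1 / (1 - d)" using r1 d(2) by (intro divide_left_mono) auto
  also have d2: "1 / (1 - d) \<le> 1 + 2 * d" by (rule inverse_one_minus_le[OF d(1,2)])
  finally have r3: "1 / r \<le> 1 + 2 * d" .
  have r4: "1 \<le> 1 / r" using r2 r0 by simp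
  have xle: "c $ k * x $ k \<le> \<bar>c $ k\<bar>" for k
  proof -
    have "\<bar>x $ k\<bar> \<le> 1" using \<open>x \<in> unit_cube\<close> by (simp add: mem_unit_cube)
    then have "\<bar>c $ k\<bar> * \<bar>x $ k\<bar> \<le> \<bar>c $ k\<bar> * 1" by (intro mult_left_mono) auto
    then show ?thesis using abs_ge_self[of "c $ k * x $ k"] by (simp add: abs_mult)
  qed
  show "\<bar>x $ i - c $ i\<bar> \<le> ?n * d"
  proof (cases "c $ i = 0")
    case True then show ?thesis using x(3) d(1) by simp
  next
    case False
    have "x \<bullet> c = (\<Sum>k\<in>UNIV. c $ k * x $ k)" by (simp add: inner_vec_sum mult.commute)
    also have "\<dots> = c $ i * x $ i + (\<Sum>k\<in>UNIV - {i}. c $ k * x $ k)" by (rule sum.remove) auto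
    finally have "r * l1 c = c $ i * x $ i + (\<Sum>k\<in>UNIV - {i}. c $ k * x $ k)" using x(2) by simp
    also have "(\<Sum>k\<in>UNIV - {i}. c $ k * x $ k) \<le> (\<Sum>k\<in>UNIV - {i}. \<bar>c $ k\<bar>)" by (intro sum_mono xle)
    also have "\<dots> = l1 c - \<bar>c $ i\<bar>" unfolding l1_def by (simp add: sum.remove[of UNIV i])
    finally have "r * l1 c \<le> c $ i * x $ i + (l1 c - \<bar>c $ i\<bar>)" by simp
    moreover have "(1 - d) * l1 c \<le> r * l1 c" using r1 l by simp
    moreover have "d * l1 c \<le> ?n * d" using ln d(1) by (simp add: mult.commute mult_left_mono)
    moreover have "\<bar>c $ i\<bar> = 1" using faces_cases[OF c, of i] False by auto
    ultimately have "1 - ?n * d \<le> c $ i * x $ i" by (simp add: algebra_simps)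
    moreover have "c $ i * x $ i \<le> 1" using xle[of i] \<open>\<bar>c $ i\<bar> = 1\<close> by simp
    moreover have "\<bar>x $ i - c $ i\<bar> = \<bar>c $ i * x $ i - 1\<bar>"
    proof -
      consider "c $ i = 1" | "c $ i = -1" using faces_cases[OF c, of i] False by blast
      then show ?thesis by (cases; simp; linarith)
    qed
    ultimately show ?thesis by simp
  qed
  show "\<bar>l1 c * \<xi> $ i - c $ i\<bar> \<le> 2 * ?n * d"
  proof (cases "c $ i = 0")
    case False
    have n1: "1 \<le> ?n" by (simp add: Suc_le_eq)
    have "l1 c * \<xi> $ i - c $ i = c $ i * (1 / r - 1)" using \<xi>(2) False l r0 by (simp add: field_simps)
    moreover have "\<bar>c $ i\<bar> = 1" using faces_cases[OF c, of i] False by auto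
    ultimately have "\<bar>l1 c * \<xi> $ i - c $ i\<bar> = 1 / r - 1" using r4 by (simp add: abs_mult)
    also have "\<dots> \<le> 2 * d" using r3 by simp
    also have "\<dots> \<le> 2 * ?n * d" using n1 d(1) by (simp add: mult_le_cancel_right1)
    finally show ?thesis .
  next
    case True
    have "l1 \<xi> \<le> 1 / (1 - d)" by (rule polar_l1_le[OF _ d(3) \<xi>(1)]) (use d in auto)
    moreover have "l1 \<xi> = \<bar>\<xi> $ i\<bar> + (\<Sum>k\<in>UNIV - {i}. \<bar>\<xi> $ k\<bar>)" unfolding l1_def by (rule sum.remove) auto
    moreover have "(\<Sum>k\<in>UNIV - {i}. \<bar>c $ k\<bar> / (r * l1 c)) \<le> (\<Sum>k\<in>UNIV - {i}. \<bar>\<xi> $ k\<bar>)"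
    proof (rule sum_mono)
      fix k show "\<bar>c $ k\<bar> / (r * l1 c) \<le> \<bar>\<xi> $ k\<bar>" using \<xi>(2) r0 l by (cases "c $ k = 0") (auto simp: abs_mult)
    qed
    moreover have "(\<Sum>k\<in>UNIV - {i}. \<bar>c $ k\<bar> / (r * l1 c)) = l1 c / (r * l1 c)"
      unfolding sum_divide_distrib[symmetric] using True by (simp add: l1_def sum.remove[of UNIV i])
    moreover have "l1 c / (r * l1 c) = 1 / r" using l by simp
    ultimately have "\<bar>\<xi> $ i\<bar> \<le> 2 * d" using d2 r4 by linarith
    then have "l1 c * \<bar>\<xi> $ i\<bar> \<le> ?n * (2 * d)" using ln l by (intro mult_mono) auto
    then show ?thesis using True l by (simp add: abs_mult)
  qed
qed

lemma sym_set_unit_cube: "sym_set (unit_cube :: (real^'n::finite) set)"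
  unfolding sym_set_def by (auto simp: mem_unit_cube signs_abs abs_mult)

lemma l1_sperm:
  assumes "bij p" "signs s" shows "l1 (sperm p s x) = l1 x"
  unfolding l1_def sperm_abs[OF assms(2)] by (rule sum.reindex_bij_betw[OF assms(1), of "\<lambda>i. \<bar>x $ i\<bar>"])

lemma sym_set_polar_cube: "sym_set (polar (unit_cube :: (real^'n::finite) set))"
  unfolding sym_set_def polar_unit_cube by (auto simp: l1_sperm)

text \<open>Since \<open>K\<close> contains the origin, coefficients with sum at most one are enough for a convex combination.\<close>
lemma weighted_sum_mem:
  fixes K :: "(real^'n::finite) set"
  assumes K: "convex K" "0 \<in> K" and fin: "finite I" and q: "q \<in> K" and X: "\<And>i. i \<in> I \<Longrightarrow> X i \<in> K"
    and a: "\<And>i. i \<in> I \<Longrightarrow> 0 \<le> a i" and b: "0 \<le> b" and le: "(\<Sum>i\<in>I. a i) + b \<le> 1"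
  shows "(\<Sum>i\<in>I. a i *\<^sub>R X i) + b *\<^sub>R q \<in> K"
proof -
  define s where "s = (\<Sum>i\<in>I. a i) + b"
  have s0: "0 \<le> s" unfolding s_def using a b by (simp add: sum_nonneg)
  show ?thesis
  proof (cases "s = 0")
    case True
    then have "b = 0" "\<And>i. i \<in> I \<Longrightarrow> a i = 0"
      using a b sum_nonneg[of I a] fin unfolding s_def by (auto simp: sum_nonneg_eq_0_iff add_nonneg_eq_0_iff)
    then show ?thesis using K(2) by simp
  next
    case False
    define Y where "Y = (\<lambda>j. case j of None \<Rightarrow> q | Some i \<Rightarrow> X i)"
    define u where "u = (\<lambda>j. (case j of None \<Rightarrow> b | Some i \<Rightarrow> a i) / s)"
    have sp: "0 < s" using s0 False by simp
    have "(\<Sum>j\<in>insert None (Some ` I). u j *\<^sub>R Y j) \<in> K"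
    proof (rule convex_sum)
      show "(\<Sum>j\<in>insert None (Some ` I). u j) = 1"
        using fin sp by (simp add: u_def sum.reindex sum_divide_distrib[symmetric] add_divide_distrib[symmetric] s_def add.commute)
    qed (use fin K q X a b sp in \<open>auto simp: u_def Y_def\<close>)
    then have "(1 / s) *\<^sub>R ((\<Sum>i\<in>I. a i *\<^sub>R X i) + b *\<^sub>R q) \<in> K"
      using fin by (simp add: u_def Y_def sum.reindex scaleR_sum_right scaleR_add_right add.commute)
    then have "s *\<^sub>R ((1 / s) *\<^sub>R ((\<Sum>i\<in>I. a i *\<^sub>R X i) + b *\<^sub>R q)) + (1 - s) *\<^sub>R 0 \<in> K"
      using K s0 le by (intro convexD) (auto simp: s_def)
    then show ?thesis using sp by simp
  qed
qed

section \<open>Bodies touching the unit cube at the centres of its facets\<close>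

text \<open>Moving mass from the points \<open>Y c\<close> to \<open>q\<close> in the proportions \<open>\<kappa>\<close> keeps the total mass at most one, and
  \<open>b * \<kappa> c \<le> a c\<close> keeps all coefficients nonnegative.\<close>
lemma bump_mem:
  fixes K :: "(real^'n::finite) set"
  assumes K: "convex K" "0 \<in> K" and q: "q \<in> K" and Y: "\<And>c. c \<in> faces \<Longrightarrow> Y c \<in> K"
    and b: "0 \<le> b" and \<kappa>: "\<And>c. c \<in> faces \<Longrightarrow> b * \<kappa> c \<le> a c" "(\<Sum>c\<in>faces. \<kappa> c) = 1"
    and a: "(\<Sum>c\<in>faces. a c) \<le> 1"
  shows "(\<Sum>c\<in>faces. a c *\<^sub>R Y c) + b *\<^sub>R (q - (\<Sum>c\<in>faces. \<kappa> c *\<^sub>R Y c)) \<in> K"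
proof -
  have "(\<Sum>c\<in>faces. (a c - b * \<kappa> c) *\<^sub>R Y c) + b *\<^sub>R q \<in> K"
  proof (rule weighted_sum_mem[OF K finite_faces q Y _ b])
    show "(\<Sum>c\<in>faces. a c - b * \<kappa> c) + b \<le> 1"
      using a \<kappa>(2) by (simp add: sum_subtractf sum_distrib_left[symmetric])
  qed (use \<kappa>(1) in auto)
  then show ?thesis
    by (simp add: scaleR_diff_left scaleR_diff_right sum_subtractf scaleR_sum_right algebra_simps)
qed

lemma measure_pos_of_cube:
  fixes K :: "(real^'n::finite) set"
  assumes "0 < t" "\<And>x. x \<in> unit_cube \<Longrightarrow> t *\<^sub>R x \<in> K" "K \<in> lmeasurable"
  shows "0 < measure lebesgue K"
proof -
  have "ball 0 t \<subseteq> K"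
  proof
    fix x :: "real^'n" assume "x \<in> ball 0 t"
    then have x: "norm x < t" by simp
    have "\<bar>((1 / t) *\<^sub>R x) $ i\<bar> \<le> 1" for i
      using component_le_norm_cart[of x i] x assms(1) by (simp add: abs_mult divide_le_eq)
    then have "t *\<^sub>R ((1 / t) *\<^sub>R x) \<in> K" by (intro assms(2)) (simp add: mem_unit_cube)
    then show "x \<in> K" using assms(1) by simp
  qed
  then have "measure lebesgue (ball (0 :: real^'n) t) \<le> measure lebesgue K"
    using assms(3) by (intro measure_mono_fmeasurable) (auto intro: fmeasurableD)
  moreover have "0 < measure lebesgue (ball (0 :: real^'n) t)"
    using assms(1) content_ball_pos[of t "0 :: real^'n"] by (simp add: measure_completion)
  ultimately show ?thesis by linarith
qed

lemma finite_uniform_pos: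
  assumes "finite A" "\<And>a. a \<in> A \<Longrightarrow> \<exists>g>0::real. Q a g"
  shows "\<exists>\<gamma>>0. \<forall>a\<in>A. \<exists>g\<ge>\<gamma>. Q a g"
  using assms
proof (induction A)
  case empty then show ?case by (intro exI[of _ 1]) auto
next
  case (insert x A)
  then obtain \<gamma> where \<gamma>: "0 < \<gamma>" "\<forall>a\<in>A. \<exists>g\<ge>\<gamma>. Q a g" by auto
  obtain g where g: "0 < g" "Q x g" using insert.prems by auto
  show ?case
  proof (rule exI[of _ "min \<gamma> g"], intro conjI ballI)
    show "0 < min \<gamma> g" using \<gamma>(1) g(1) by simp
    fix a assume "a \<in> insert x A"
    then show "\<exists>h\<ge>min \<gamma> g. Q a h"
    proof
      assume "a = x" then show ?thesis using g by (intro exI[of _ g]) auto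
    next
      assume "a \<in> A"
      then obtain h where "h \<ge> \<gamma>" "Q a h" using \<gamma>(2) by blast
      then show ?thesis by (intro exI[of _ h]) auto
    qed
  qed
qed

text \<open>The first order terms \<open>a\<close>, \<open>b\<close> nearly cancel, so a linear gain \<open>\<tau> * d\<close> beats the quadratic errors for small \<open>d\<close>.\<close>
lemma product_gain:
  fixes a b A B VA VB :: real
  assumes V: "0 < VA" "0 < VB" and A: "(1 + a) * VA \<le> A" and B: "(1 + b) * VB \<le> B"
    and ab: "\<bar>a\<bar> \<le> M * d" "\<bar>b\<bar> \<le> M * d" "\<tau> * d - Q * d\<^sup>2 \<le> a + b"
    and d: "0 < d" "M * d \<le> 1" "(M\<^sup>2 + Q) * d < \<tau>"
  shows "VA * VB < A * B"
proof -
  have a0: "0 \<le> 1 + a" and b0: "0 \<le> 1 + b" using ab d(2) by linarith+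
  have "\<bar>a * b\<bar> \<le> (M * d) * (M * d)" unfolding abs_mult using ab by (intro mult_mono) auto
  then have "- (M\<^sup>2 * d\<^sup>2) \<le> a * b" by (simp add: power2_eq_square mult_ac)
  then have "1 + (\<tau> * d - (M\<^sup>2 + Q) * d\<^sup>2) \<le> (1 + a) * (1 + b)"
    using ab(3) by (simp add: algebra_simps)
  moreover have "0 < \<tau> * d - (M\<^sup>2 + Q) * d\<^sup>2"
  proof -
    have "0 < (\<tau> - (M\<^sup>2 + Q) * d) * d" using d by (intro mult_pos_pos) auto
    then show ?thesis by (simp add: power2_eq_square algebra_simps)
  qed
  ultimately have "1 < (1 + a) * (1 + b)" by linarith
  then have "VA * VB < (1 + a) * (1 + b) * (VA * VB)" using V by simp
  also have "\<dots> = ((1 + a) * VA) * ((1 + b) * VB)" by (simp add: mult_ac)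
  also have "\<dots> \<le> A * B" using A B a0 b0 V by (intro mult_mono order_trans[OF _ A]) auto
  finally show ?thesis .
qed

definition vertices :: "(real^'n::finite) set" where
  "vertices = {v. \<forall>i. v $ i = 1 \<or> v $ i = -1}"

lemma vertices_faces: "v \<in> vertices \<Longrightarrow> v \<in> faces"
  by (auto simp: vertices_def faces_def vec_eq_iff)
     (metis one_neq_zero zero_neq_neg_one)

lemma vertex_sq: "v \<in> vertices \<Longrightarrow> v $ i * v $ i = 1"
  unfolding vertices_def by (metis (mono_tags) mem_Collect_eq mult_1 mult_minus1 minus_minus)

lemma vertex_abs: "v \<in> vertices \<Longrightarrow> \<bar>v $ i\<bar> = 1"
  unfolding vertices_def by (metis (mono_tags) abs_1 abs_minus_cancel mem_Collect_eq)

lemma vertex_nonzero: "v \<in> vertices \<Longrightarrow> v $ i \<noteq> 0"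
  using vertex_sq[of v i] by auto

definition facet :: "real^'n \<Rightarrow> 'n \<Rightarrow> real^'n::finite" where
  "facet v i = v $ i *\<^sub>R axis i 1"

lemma facet_nth: "facet v i $ k = (if k = i then v $ i else 0)"
  by (simp add: facet_def axis_def)

lemma facet_faces:
  assumes "v \<in> vertices" shows "facet v i \<in> faces"
proof -
  have "facet v i $ i \<noteq> 0" using vertex_nonzero[OF assms] by (simp add: facet_nth)
  then have "facet v i \<noteq> 0" by (metis zero_index)
  then show ?thesis using assms by (auto simp: faces_def facet_nth vertices_def)
qed

lemma l1_facet: "v \<in> vertices \<Longrightarrow> l1 (facet v i) = 1"
  by (simp add: l1_def facet_nth if_distrib[of abs] vertex_abs cong: if_cong)

lemma inner_facet: "x \<bullet> facet v i = v $ i * x $ i"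
  by (simp add: facet_def inner_axis)

lemma inner_vertex_remove: "x \<bullet> v = v $ i * x $ i + (\<Sum>k\<in>UNIV - {i}. v $ k * x $ (k::'n::finite))"
proof -
  have "x \<bullet> v = (\<Sum>k\<in>UNIV. v $ k * x $ k)" by (simp add: inner_vec_sum mult.commute)
  then show ?thesis by (simp add: sum.remove[of UNIV i])
qed

text \<open>With \<open>s = 1\<close> the midpoint of the facet centre and the vertex \<open>v\<close>, on a facet of the cube; with \<open>s = 1 / n\<close> the
  midpoint of the facet centre and \<open>v / n\<close>, on the facet of the polar with normal \<open>v\<close>.\<close>
definition bump_centre :: "real \<Rightarrow> real^'n \<Rightarrow> 'n \<Rightarrow> real^'n::finite" where
  "bump_centre s v i = (1/2) *\<^sub>R facet v i + (s/2) *\<^sub>R v"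

lemma bump_centre_nth: "bump_centre s v i $ k = v $ k * ((if k = i then 1/2 else 0) + s/2)"
  by (simp add: bump_centre_def facet_nth algebra_simps)

lemma bump_centre_vertex_nth:
  assumes "v \<in> vertices" shows "v $ k * bump_centre s v i $ k = (if k = i then 1/2 else 0) + s/2"
  using vertex_sq[OF assms, of k] by (simp add: bump_centre_nth mult.assoc[symmetric])

lemma weight_facet_centre:
  fixes v :: "real^'n::finite"
  assumes v: "v \<in> vertices" and s: "0 < s" and n: "2 \<le> CARD('n)"
  shows "weight (facet v i) (bump_centre s v i) = 1/2"
proof -
  obtain j where j: "j \<noteq> i" using n by (metis card_2_iff' card_le_Suc0_iff_eq finite UNIV_I not_less_eq_eq numeral_2_eq_2)
  have ab: "\<bar>bump_centre s v i $ k\<bar> = s / 2" if "k \<noteq> i" for k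
    using that s vertex_abs[OF v, of k] by (simp add: bump_centre_nth abs_mult)
  have "weight (facet v i) (bump_centre s v i) = facet v i $ i * bump_centre s v i $ i - s / 2"
  proof (rule weight_eq[OF facet_faces[OF v]])
    show "facet v i $ i \<noteq> 0" using vertex_nonzero[OF v] by (simp add: facet_nth)
    show "s / 2 = 0 \<or> (\<exists>j. facet v i $ j = 0 \<and> \<bar>bump_centre s v i $ j\<bar> = s / 2)"
      using j ab by (intro disjI2 exI[of _ j]) (simp add: facet_nth)
    show "s / 2 \<le> facet v i $ i * bump_centre s v i $ i"
      using bump_centre_vertex_nth[OF v, of i s i] by (simp add: facet_nth)
  qed (use s ab vertex_nonzero[OF v] in \<open>auto simp: facet_nth split: if_splits\<close>)
  then show ?thesis using bump_centre_vertex_nth[OF v, of i s i] by (simp add: facet_nth)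
qed

lemma weight_vertex_centre:
  fixes v :: "real^'n::finite"
  assumes v: "v \<in> vertices" and s: "0 < s" and n: "2 \<le> CARD('n)"
  shows "weight v (bump_centre s v i) = s/2"
proof -
  obtain j where j: "j \<noteq> i" using n by (metis card_2_iff' card_le_Suc0_iff_eq finite UNIV_I not_less_eq_eq numeral_2_eq_2)
  have "weight v (bump_centre s v i) = v $ j * bump_centre s v i $ j - 0"
    by (rule weight_eq[OF vertices_faces[OF v]])
      (use j s vertex_nonzero[OF v] bump_centre_vertex_nth[OF v] in auto)
  then show ?thesis using bump_centre_vertex_nth[OF v, of j s i] j by simp
qed

lemma weight_near:
  fixes c :: "real^'n::finite"
  assumes c: "c \<in> faces" and x: "x \<in> ball p (1 / (4 * real CARD('n)))" shows "weight c p - 1/4 \<le> weight c x"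
proof -
  have n1: "1 \<le> real CARD('n)" by (simp add: Suc_le_eq)
  have "l1 (p - x) \<le> real CARD('n) * norm (p - x)" by (rule l1_le_norm)
  also have "\<dots> \<le> real CARD('n) * (1 / (4 * real CARD('n)))"
    using x by (intro mult_left_mono) (auto simp: dist_norm)
  also have "\<dots> = 1/4" using n1 by simp
  finally show ?thesis using weight_lipschitz[OF c, of p x] by linarith
qed

text \<open>Near the centre of the bump only one facet constraint is active.\<close>
lemma half_ball_cube:
  fixes v :: "real^'n::finite"
  assumes v: "v \<in> vertices"
  shows "unit_cube \<inter> ball (bump_centre 1 v i) (1 / (4 * real CARD('n))) =
    {x \<in> ball (bump_centre 1 v i) (1 / (4 * real CARD('n))). (x - bump_centre 1 v i) \<bullet> facet v i \<le> 0}"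
proof -
  let ?p = "bump_centre 1 v i" and ?r = "1 / (4 * real CARD('n))"
  have n1: "1 \<le> real CARD('n)" by (simp add: Suc_le_eq)
  have r: "?r \<le> 1/4" using n1 by (simp add: divide_simps)
  have "x \<in> unit_cube \<longleftrightarrow> (x - ?p) \<bullet> facet v i \<le> 0" if x: "x \<in> ball ?p ?r" for x
  proof -
    have near: "\<bar>x $ k - ?p $ k\<bar> < 1/4" for k
    proof -
      have "norm (x - ?p) < ?r" using x by (simp add: dist_norm norm_minus_commute)
      then have "\<bar>(x - ?p) $ k\<bar> < 1/4" using component_le_norm_cart[of "x - ?p" k] r by linarith
      then show ?thesis by simp
    qed
    have off: "\<bar>x $ k\<bar> \<le> 1" if "k \<noteq> i" for k
    proof -
      have "\<bar>?p $ k\<bar> = 1/2" using that vertex_abs[OF v, of k] by (simp add: bump_centre_nth abs_mult)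
      then show ?thesis using near[of k] by linarith
    qed
    have pi: "v $ i * ?p $ i = 1" using bump_centre_vertex_nth[OF v, of i 1 i] by simp
    have "\<bar>v $ i * x $ i - v $ i * ?p $ i\<bar> < 1/4"
      using near[of i] vertex_abs[OF v, of i] by (simp add: right_diff_distrib[symmetric] abs_mult)
    then have "0 < v $ i * x $ i" using pi by linarith
    then have "\<bar>x $ i\<bar> = v $ i * x $ i" using vertex_abs[OF v, of i] abs_of_pos[of "v $ i * x $ i"] by (simp add: abs_mult)
    moreover have "(x - ?p) \<bullet> facet v i = v $ i * x $ i - 1"
      using pi by (simp add: inner_facet right_diff_distrib)
    moreover have "x \<in> unit_cube \<longleftrightarrow> \<bar>x $ i\<bar> \<le> 1"
    proof
      assume i: "\<bar>x $ i\<bar> \<le> 1"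
      have "\<bar>x $ k\<bar> \<le> 1" for k using i off[of k] by (cases "k = i") simp_all
      then show "x \<in> unit_cube" by (simp add: mem_unit_cube)
    qed (simp add: mem_unit_cube)
    ultimately show ?thesis by simp
  qed
  then show ?thesis by blast
qed

lemma half_ball_polar:
  fixes v :: "real^'n::finite"
  assumes v: "v \<in> vertices"
  shows "polar unit_cube \<inter> ball (bump_centre (1 / real CARD('n)) v i) (1 / (4 * real CARD('n))) =
    {x \<in> ball (bump_centre (1 / real CARD('n)) v i) (1 / (4 * real CARD('n))). (x - bump_centre (1 / real CARD('n)) v i) \<bullet> v \<le> 0}"
proof -
  let ?n = "real CARD('n)"
  let ?p = "bump_centre (1 / ?n) v i" and ?r = "1 / (4 * ?n)"
  have n1: "1 \<le> ?n" by (simp add: Suc_le_eq)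
  have "x \<in> polar unit_cube \<longleftrightarrow> (x - ?p) \<bullet> v \<le> 0" if x: "x \<in> ball ?p ?r" for x
  proof -
    have "v $ k * x $ k = \<bar>x $ k\<bar>" for k
    proof -
      have "\<bar>x $ k - ?p $ k\<bar> < ?r"
        using component_le_norm_cart[of "x - ?p" k] x by (simp add: dist_norm norm_minus_commute)
      then have "\<bar>v $ k * x $ k - v $ k * ?p $ k\<bar> < ?r"
        using vertex_abs[OF v, of k] by (simp add: right_diff_distrib[symmetric] abs_mult)
      moreover have "2 * ?r \<le> v $ k * ?p $ k"
        using bump_centre_vertex_nth[OF v, of k "1 / ?n" i] by simp
      moreover have "0 < ?r" using n1 by simp
      ultimately have "0 < v $ k * x $ k" by linarith
      then show ?thesis using vertex_abs[OF v, of k] abs_of_pos[of "v $ k * x $ k"] by (simp add: abs_mult)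
    qed
    then have "x \<bullet> v = l1 x" by (simp add: inner_vec_sum l1_def mult.commute)
    moreover have "?p \<bullet> v = 1"
    proof -
      have "?p \<bullet> v = (\<Sum>k\<in>UNIV. (if k = i then 1/2 else 0) + 1 / (2 * ?n))"
        unfolding inner_vec_sum using bump_centre_vertex_nth[OF v, of _ "1 / ?n" i] by (intro sum.cong) (simp_all add: mult.commute)
      also have "\<dots> = 1" using n1 by (simp add: sum.distrib)
      finally show ?thesis .
    qed
    ultimately show ?thesis by (simp add: polar_unit_cube inner_diff_left)
  qed
  then show ?thesis by blast
qed

text \<open>If \<open>P = (F + V) / 2\<close> exceeds one, then \<open>F \<le> 1\<close> must be nearly attained, and an \<open>l1\<close>-norm close to one leaves
  only \<open>s = O(d)\<close> for the other coordinates. This keeps the separating functional close to the facet centre.\<close>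
lemma slack_bounds:
  fixes P F V a b s d :: real
  assumes "1 + d / 4 < P" "P = (F + V) / 2" "F = a" "V \<le> a + s" "0 \<le> d"
  shows slack_sum: "a \<le> b \<Longrightarrow> b + s \<le> 1 + 2 * d \<Longrightarrow> s \<le> 4 * d"
    and slack_top: "F \<le> 1 \<Longrightarrow> s \<le> 4 * d \<Longrightarrow> \<bar>a - 1\<bar> \<le> 2 * d"
  using assms by (auto simp: field_simps abs_le_iff)

lemma shift_bound:
  fixes w A B d m :: real
  assumes "w = - A + B / 2" "\<bar>A\<bar> \<le> d / 4" "\<bar>B\<bar> \<le> m" "d \<le> m" "0 \<le> d"
  shows "\<bar>w\<bar> \<le> 6 * m"
  using assms by linarith

text \<open>The linear gain uses the contact point of a vertex \<open>v\<close> and a coordinate \<open>i\<close> for which \<open>1 - v $ i * X v $ i\<close> is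
  largest. This maximum \<open>\<delta>\<close> measures the distance to the cube: \<open>K\<close> contains \<open>(1 - \<delta>) B\<close> because its polar is
  controlled by the contact points of the vertices.\<close>
lemma normal_position:
  assumes n2: "2 \<le> CARD('n::{finite,wellorder})"
  shows "\<exists>\<epsilon>>0. \<epsilon> < 1 \<and> (\<forall>K :: (real^'n::_) set.
    compact K \<longrightarrow> convex K \<longrightarrow> (\<forall>x\<in>K. - x \<in> K) \<longrightarrow> (\<forall>i. axis i 1 \<in> K) \<longrightarrow> K \<subseteq> unit_cube \<longrightarrow>
    (\<forall>x\<in>unit_cube. (1 - \<epsilon>) *\<^sub>R x \<in> K) \<longrightarrow>
    K = unit_cube \<or> volume_product (unit_cube :: (real^'n::_) set) < volume_product K)"
proof -
  let ?n = "real CARD('n)"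
  let ?B = "unit_cube :: (real^'n::_) set"
  let ?F = "faces :: (real^'n::_) set"
  have n1: "1 \<le> ?n" by (simp add: Suc_le_eq)
  define r where "r = 1 / (4 * ?n)"
  have r: "0 < r" "r \<le> 1" "r\<^sup>2 \<le> 1/4"
  proof -
    show r0: "0 < r" using n1 by (simp add: r_def)
    have r4: "r \<le> 1/4" using n1 by (simp add: r_def divide_simps)
    then show "r \<le> 1" by simp
    have "r\<^sup>2 \<le> r * 1" unfolding power2_eq_square using r0 r4 by (intro mult_left_mono) auto
    then show "r\<^sup>2 \<le> 1/4" using r4 by simp
  qed
  obtain C \<epsilon>1 where C: "0 \<le> C" "0 < \<epsilon>1" and vol: "\<And>(S :: (real^'n::_) set) T D w p r e.
      S \<in> lmeasurable \<Longrightarrow> sym_set S \<Longrightarrow> T \<in> lmeasurable \<Longrightarrow> e \<le> \<epsilon>1 \<Longrightarrow> 0 < r \<Longrightarrow> r \<le> 1 \<Longrightarrow>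
      (\<forall>c\<in>faces. \<forall>i. \<bar>D c $ i\<bar> \<le> e) \<Longrightarrow> (\<forall>i. \<bar>w $ i\<bar> \<le> e) \<Longrightarrow>
      (\<forall>x\<in>S. x + ((\<Sum>c\<in>faces. weight c x *\<^sub>R D c) + bump p r x *\<^sub>R w) \<in> T) \<Longrightarrow>
      (1 - C * e\<^sup>2 + (\<Sum>c\<in>faces. (c \<bullet> D c) / (l1 c * class_size c))) * measure lebesgue S
        + integral S (\<lambda>x. bump_grad p r x \<bullet> w) \<le> measure lebesgue T"
    using piecewise_linear_volume[where 'n='n] by blast
  let ?A = "(vertices :: (real^'n::_) set) \<times> (UNIV :: 'n set)"
  have finV: "finite (vertices :: (real^'n::_) set)"
    by (rule finite_subset[OF _ finite_faces]) (use vertices_faces in auto)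
  have finA: "finite ?A" using finV by simp
  have "\<exists>\<gamma>>0. \<forall>a\<in>?A. \<exists>g\<ge>\<gamma>. \<forall>w. integral ?B (\<lambda>x. bump_grad (bump_centre 1 (fst a) (snd a)) r x \<bullet> w) = g * (w \<bullet> facet (fst a) (snd a))"
  proof (rule finite_uniform_pos[OF finA])
    fix a assume "a \<in> ?A"
    then have v: "fst a \<in> vertices" by auto
    have ne: "facet (fst a) (snd a) \<noteq> 0" using facet_faces[OF v] by (auto simp: faces_def)
    show "\<exists>g>0. \<forall>w. integral ?B (\<lambda>x. bump_grad (bump_centre 1 (fst a) (snd a)) r x \<bullet> w) = g * (w \<bullet> facet (fst a) (snd a))"
    proof -
      obtain g where g: "0 < g" "\<forall>S w. S \<inter> ball (bump_centre 1 (fst a) (snd a)) r =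
          {x \<in> ball (bump_centre 1 (fst a) (snd a)) r. (x - bump_centre 1 (fst a) (snd a)) \<bullet> facet (fst a) (snd a) \<le> 0} \<longrightarrow>
          integral S (\<lambda>x. bump_grad (bump_centre 1 (fst a) (snd a)) r x \<bullet> w) = g * (w \<bullet> facet (fst a) (snd a))"
        using half_ball_integral[OF r(1) ne, of "bump_centre 1 (fst a) (snd a)"] by (elim exE conjE) (rule that)
      then show ?thesis using half_ball_cube[OF v, of "snd a", folded r_def] by (intro exI[of _ g]) simp
    qed
  qed
  then obtain \<gamma>1 where \<gamma>1pos: "0 < \<gamma>1" and \<gamma>1all: "\<forall>a\<in>?A. \<exists>g\<ge>\<gamma>1. \<forall>w. integral ?B (\<lambda>x. bump_grad (bump_centre 1 (fst a) (snd a)) r x \<bullet> w) = g * (w \<bullet> facet (fst a) (snd a))"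
    by (elim exE conjE) (rule that)
  have \<gamma>1: "0 < \<gamma>1" "\<exists>g\<ge>\<gamma>1. \<forall>w. integral ?B (\<lambda>x. bump_grad (bump_centre 1 v i) r x \<bullet> w) = g * (w \<bullet> facet v i)"
    if "v \<in> vertices" for v i
    using \<gamma>1pos bspec[OF \<gamma>1all, of "(v, i)"] that by simp_all
  have "\<exists>\<gamma>>0. \<forall>a\<in>?A. \<exists>g\<ge>\<gamma>. \<forall>w. integral (polar ?B) (\<lambda>x. bump_grad (bump_centre (1 / ?n) (fst a) (snd a)) r x \<bullet> w) = g * (w \<bullet> fst a)"
  proof (rule finite_uniform_pos[OF finA])
    fix a assume "a \<in> ?A"
    then have v: "fst a \<in> vertices" by auto
    have ne: "fst a \<noteq> 0" using vertices_faces[OF v] by (auto simp: faces_def)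
    show "\<exists>g>0. \<forall>w. integral (polar ?B) (\<lambda>x. bump_grad (bump_centre (1 / ?n) (fst a) (snd a)) r x \<bullet> w) = g * (w \<bullet> fst a)"
    proof -
      obtain g where g: "0 < g" "\<forall>S w. S \<inter> ball (bump_centre (1 / ?n) (fst a) (snd a)) r =
          {x \<in> ball (bump_centre (1 / ?n) (fst a) (snd a)) r. (x - bump_centre (1 / ?n) (fst a) (snd a)) \<bullet> fst a \<le> 0} \<longrightarrow>
          integral S (\<lambda>x. bump_grad (bump_centre (1 / ?n) (fst a) (snd a)) r x \<bullet> w) = g * (w \<bullet> fst a)"
        using half_ball_integral[OF r(1) ne, of "bump_centre (1 / ?n) (fst a) (snd a)"] by (elim exE conjE) (rule that)
      then show ?thesis using half_ball_polar[OF v, of "snd a", folded r_def] by (intro exI[of _ g]) simp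
    qed
  qed
  then obtain \<gamma>2 where \<gamma>2pos: "0 < \<gamma>2" and \<gamma>2all: "\<forall>a\<in>?A. \<exists>g\<ge>\<gamma>2. \<forall>w. integral (polar ?B) (\<lambda>x. bump_grad (bump_centre (1 / ?n) (fst a) (snd a)) r x \<bullet> w) = g * (w \<bullet> fst a)"
    by (elim exE conjE) (rule that)
  have \<gamma>2: "0 < \<gamma>2" "\<exists>g\<ge>\<gamma>2. \<forall>w. integral (polar ?B) (\<lambda>x. bump_grad (bump_centre (1 / ?n) v i) r x \<bullet> w) = g * (w \<bullet> v)"
    if "v \<in> vertices" for v i
    using \<gamma>2pos bspec[OF \<gamma>2all, of "(v, i)"] that by simp_all
  define VB where "VB = measure lebesgue ?B"
  define VP where "VP = measure lebesgue (polar ?B)"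
  have lB: "?B \<in> lmeasurable" by (rule lmeasurable_compact[OF compact_unit_cube])
  have lP: "polar ?B \<in> lmeasurable" by (rule lmeasurable_compact[OF compact_polar_cube])
  have VB: "0 < VB" unfolding VB_def by (rule measure_pos_of_cube[of 1]) (use lB in auto)
  have VP: "0 < VP" unfolding VP_def
  proof (rule measure_pos_of_cube[of "1 / ?n"])
    fix x :: "real^'n::_" assume "x \<in> unit_cube"
    then have "l1 x \<le> (\<Sum>i\<in>(UNIV :: 'n set). 1)" unfolding l1_def by (intro sum_mono) (simp add: mem_unit_cube)
    then have "l1 x \<le> ?n" by simp
    moreover have "l1 ((1 / ?n) *\<^sub>R x) = l1 x / ?n" by (simp add: l1_def sum_divide_distrib abs_mult)
    ultimately show "(1 / ?n) *\<^sub>R x \<in> polar ?B" using n1 by (simp add: polar_unit_cube)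
  qed (use n1 lP in auto)
  \<comment> \<open>\<open>\<tau>\<close> is the guaranteed linear gain relative to the volumes, \<open>Q\<close> bounds the quadratic errors and \<open>M\<close> all first
    order terms.\<close>
  define \<tau> where "\<tau> = min (\<gamma>1 / (4 * VB)) (\<gamma>2 / (2 * VP))"
  have \<tau>: "0 < \<tau>" "\<tau> * VB \<le> \<gamma>1 / 4" "\<tau> * VP \<le> \<gamma>2 / 2"
  proof -
    show "0 < \<tau>" using \<gamma>1pos \<gamma>2pos VB VP by (simp add: \<tau>_def)
    have "\<tau> \<le> \<gamma>1 / (4 * VB)" "\<tau> \<le> \<gamma>2 / (2 * VP)" by (simp_all add: \<tau>_def)
    then show "\<tau> * VB \<le> \<gamma>1 / 4" "\<tau> * VP \<le> \<gamma>2 / 2" using VB VP by (simp_all add: field_simps)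
  qed
  define N where "N = real (card ?F)"
  define Q where "Q = 2 * (C * (6 * ?n)\<^sup>2)"
  define M where "M = 2 * N + Q + \<tau>"
  have Q0: "0 \<le> Q" using C by (simp add: Q_def)
  have M0: "0 < M" using Q0 \<tau> by (simp add: M_def N_def)
  have MQ: "0 < M\<^sup>2 + Q" using M0 Q0 by (simp add: add_pos_nonneg)
  have min4: "\<exists>\<eta>>0. \<eta> \<le> 1/2 \<and> \<eta> \<le> a \<and> \<eta> \<le> b \<and> \<eta> \<le> c" if "0 < a" "0 < b" "0 < c" for a b c :: real
    by (rule exI[of _ "min (1/2) (min a (min b c))"]) (use that in auto)
  have "0 < \<epsilon>1 / (6 * ?n)" "0 < 1 / M" "0 < \<tau> / (2 * (M\<^sup>2 + Q))"
    using C(2) n1 M0 MQ \<tau>(1) by (auto intro!: divide_pos_pos)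
  from min4[OF this] obtain \<eta> where
    \<eta>: "0 < \<eta>" "\<eta> \<le> 1/2" "\<eta> \<le> \<epsilon>1 / (6 * ?n)" "\<eta> \<le> 1 / M" "\<eta> \<le> \<tau> / (2 * (M\<^sup>2 + Q))"
    by (elim exE conjE) (rule that)
  define \<epsilon> where "\<epsilon> = \<eta> / ?n"
  have \<epsilon>: "0 < \<epsilon>" "\<epsilon> \<le> 1/2" "?n * \<epsilon> = \<eta>"
  proof -
    show "0 < \<epsilon>" using \<eta> n1 by (simp add: \<epsilon>_def)
    show e: "?n * \<epsilon> = \<eta>" using n1 by (simp add: \<epsilon>_def)
    have "1 * \<epsilon> \<le> ?n * \<epsilon>" using n1 \<open>0 < \<epsilon>\<close> by (intro mult_right_mono) auto
    then show "\<epsilon> \<le> 1/2" using e \<eta>(2) by linarith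
  qed
  show ?thesis
  proof (rule exI[of _ \<epsilon>], intro conjI allI impI)
    show "0 < \<epsilon>" by (rule \<epsilon>(1))
    show "\<epsilon> < 1" using \<epsilon>(2) by simp
    fix K :: "(real^'n::_) set"
    assume K: "compact K" "convex K" and sym: "\<forall>x\<in>K. - x \<in> K" and ax: "\<forall>i. axis i 1 \<in> K"
      and Kc: "K \<subseteq> unit_cube" and Ke: "\<forall>x\<in>unit_cube. (1 - \<epsilon>) *\<^sub>R x \<in> K"
    have t: "0 < 1 - \<epsilon>" "\<And>x. x \<in> unit_cube \<Longrightarrow> (1 - \<epsilon>) *\<^sub>R x \<in> K" using \<epsilon> Ke by auto
    have ax': "\<And>i. axis i 1 \<in> K" "\<And>i. - axis i 1 \<in> K" using ax sym by auto
    have K0: "0 \<in> K" using t(2)[of 0] by (simp add: mem_unit_cube)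
    have "\<forall>c\<in>?F. \<exists>z. contact K c (fst z) (fst (snd z)) (snd (snd z))"
      using contact_pair[OF K t Kc ax'] by (simp add: split_paired_Ex)
    from bchoice[OF this] obtain Z where Z: "\<forall>c\<in>?F. contact K c (fst (Z c)) (fst (snd (Z c))) (snd (snd (Z c)))"
      by (rule exE)
    define X where "X = (\<lambda>c. fst (Z c))"
    define \<Xi> where "\<Xi> = (\<lambda>c. fst (snd (Z c)))"
    define R where "R = (\<lambda>c. snd (snd (Z c)))"
    have ct: "contact K c (X c) (\<Xi> c) (R c)" if "c \<in> faces" for c
      using Z that unfolding X_def \<Xi>_def R_def by blast
    have XR: "X c \<in> K" "\<Xi> c \<in> polar K" "0 < R c" "X c \<bullet> c = R c * l1 c"
      "\<forall>i. c $ i \<noteq> 0 \<longrightarrow> \<Xi> c $ i = c $ i / (R c * l1 c)" "l1 c = 1 \<Longrightarrow> X c = c" "l1 c = 1 \<Longrightarrow> \<Xi> c = c"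
      if "c \<in> faces" for c
      using ct[OF that] unfolding contact_def by blast+
    \<comment> \<open>Measured by the contact points themselves, so that some vertex attains \<open>\<delta>\<close> in a single coordinate.\<close>
    define \<delta> where "\<delta> = Max ((\<lambda>a. 1 - fst a $ snd a * X (fst a) $ snd a) ` ?A)"
    have imfin: "finite ((\<lambda>a. 1 - fst a $ snd a * X (fst a) $ snd a) ` ?A)" using finA by simp
    have "(\<chi> i. 1) \<in> (vertices :: (real^'n::_) set)" by (simp add: vertices_def)
    then have Ane: "?A \<noteq> {}" by auto
    have le_\<delta>: "1 - \<delta> \<le> v $ i * X v $ i" if "v \<in> vertices" for v i
    proof -
      have "1 - fst (v, i) $ snd (v, i) * X (fst (v, i)) $ snd (v, i) \<le> \<delta>"
        unfolding \<delta>_def by (rule Max_ge[OF imfin]) (use that in \<open>blast intro: imageI\<close>)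
      then show ?thesis by simp
    qed
    have "\<delta> \<in> (\<lambda>a. 1 - fst a $ snd a * X (fst a) $ snd a) ` ?A"
      unfolding \<delta>_def by (rule Max_in[OF imfin]) (use Ane in blast)
    then obtain v i where v: "v \<in> vertices" and vi: "v $ i * X v $ i = 1 - \<delta>" by auto
    have X_le: "v $ i * X v $ i \<le> 1" if "v \<in> vertices" for v i
    proof -
      have "X v \<in> unit_cube" using XR(1)[OF vertices_faces[OF that]] Kc by blast
      then have "\<bar>v $ i * X v $ i\<bar> \<le> 1" using vertex_abs[OF that, of i] by (simp add: abs_mult mem_unit_cube)
      then show ?thesis by linarith
    qed
    have \<delta>0: "0 \<le> \<delta>" using X_le[OF v, of i] vi by simp
    have \<delta>\<eta>: "\<delta> \<le> \<eta>"
    proof -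
      note vf = vertices_faces[OF v]
      have "\<bar>X v $ i - v $ i\<bar> \<le> ?n * \<epsilon>"
        by (rule contact_pair_estimates(3)[OF _ \<epsilon>(2) t(2) Kc vf ct[OF vf]])
           (use \<epsilon>(1) in auto)
      moreover have "\<delta> = v $ i * (v $ i - X v $ i)" using vi vertex_sq[OF v, of i] by (simp add: right_diff_distrib)
      then have "\<bar>\<delta>\<bar> = \<bar>X v $ i - v $ i\<bar>" using vertex_abs[OF v, of i] by (simp add: abs_mult abs_minus_commute)
      ultimately show ?thesis using \<epsilon>(3) by linarith
    qed
    have \<delta>2: "\<delta> \<le> 1/2" using \<delta>\<eta> \<eta>(2) by linarith
    have cube_in: "(1 - \<delta>) *\<^sub>R x \<in> K" if x: "x \<in> unit_cube" for x
    proof (rule bipolar[OF compact_imp_closed[OF K(1)] K(2) K0])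
      fix \<xi> assume \<xi>: "\<xi> \<in> polar K"
      define u :: "real^'n::_" where "u = (\<chi> i. if 0 \<le> \<xi> $ i then 1 else -1)"
      have u: "u \<in> vertices" by (simp add: u_def vertices_def)
      have "(1 - \<delta>) * l1 \<xi> \<le> X u \<bullet> \<xi>"
        unfolding l1_def inner_vec_sum sum_distrib_left
      proof (rule sum_mono)
        fix k
        have "X u $ k * \<xi> $ k = (u $ k * X u $ k) * \<bar>\<xi> $ k\<bar>" by (simp add: u_def)
        moreover have "(1 - \<delta>) * \<bar>\<xi> $ k\<bar> \<le> (u $ k * X u $ k) * \<bar>\<xi> $ k\<bar>" using le_\<delta>[OF u] by (intro mult_right_mono) auto
        ultimately show "(1 - \<delta>) * \<bar>\<xi> $ k\<bar> \<le> X u $ k * \<xi> $ k" by linarith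
      qed
      also have "\<dots> \<le> 1" using \<xi> XR(1)[OF vertices_faces[OF u]] by (simp add: polar_def)
      finally have "(1 - \<delta>) * l1 \<xi> \<le> 1" .
      moreover have "x \<bullet> \<xi> \<le> l1 \<xi>" using inner_le_l1[OF x, of \<xi>] by linarith
      then have "(1 - \<delta>) * (x \<bullet> \<xi>) \<le> (1 - \<delta>) * l1 \<xi>" using \<delta>2 by (intro mult_left_mono) auto
      ultimately show "((1 - \<delta>) *\<^sub>R x) \<bullet> \<xi> \<le> 1" by simp
    qed
    show "K = unit_cube \<or> volume_product (unit_cube :: (real^'n::_) set) < volume_product K"
    proof (cases "\<delta> = 0")
      case True
      then show ?thesis using cube_in Kc by auto
    next
      case False
      then have \<delta>pos: "0 < \<delta>" using \<delta>0 by simp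
      note est = contact_pair_estimates[OF \<delta>0 \<delta>2 cube_in Kc]
      have est1: "1 - \<delta> \<le> R c" and est2: "R c \<le> 1" and est3: "\<bar>X c $ i - c $ i\<bar> \<le> ?n * \<delta>"
        and est4: "\<bar>l1 c * \<Xi> c $ i - c $ i\<bar> \<le> 2 * ?n * \<delta>" if c: "c \<in> faces" for c i
        using est[OF _ c ct[OF c]] by blast+
      have pc: "compact (polar K)" by (rule compact_polar[OF t])
      have lK: "K \<in> lmeasurable" "polar K \<in> lmeasurable" using K(1) pc by (auto intro: lmeasurable_compact)
      \<comment> \<open>One bound for all displacements: \<open>n \<delta>\<close> for \<open>D1\<close>, \<open>2 n \<delta>\<close> for \<open>D2\<close>, and the bump directions below.\<close>
      define e where "e = 6 * ?n * \<delta>"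
      have e1: "e \<le> \<epsilon>1"
      proof -
        have "e \<le> 6 * ?n * (\<epsilon>1 / (6 * ?n))" unfolding e_def using \<delta>\<eta> \<eta>(3) n1 by (intro mult_left_mono) linarith+
        then show ?thesis using n1 by simp
      qed
      have nd: "\<delta> \<le> ?n * \<delta>" using n1 \<delta>pos by simp
      define D1 where "D1 = (\<lambda>c. X c - c)"
      define D2 where "D2 = (\<lambda>c. l1 c *\<^sub>R \<Xi> c - c)"
      have bD1: "\<forall>c\<in>?F. \<forall>i. \<bar>D1 c $ i\<bar> \<le> e"
      proof (intro ballI allI)
        fix c :: "real^'n::_" and i assume c: "c \<in> faces"
        show "\<bar>D1 c $ i\<bar> \<le> e" using est3[OF c, of i] nd \<delta>pos unfolding D1_def e_def by simp
      qed
      have bD2: "\<forall>c\<in>?F. \<forall>i. \<bar>D2 c $ i\<bar> \<le> e"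
      proof (intro ballI allI)
        fix c :: "real^'n::_" and i assume c: "c \<in> faces"
        show "\<bar>D2 c $ i\<bar> \<le> e" using est4[OF c, of i] nd \<delta>pos unfolding D2_def e_def by simp
      qed
      have e0: "0 \<le> e" unfolding e_def using n1 \<delta>pos by simp
      have map1: "x + ((\<Sum>c\<in>faces. weight c x *\<^sub>R D1 c) + z) = (\<Sum>c\<in>faces. weight c x *\<^sub>R X c) + z" for x z
        using sum_weight_scaleR[of x] by (simp add: D1_def scaleR_diff_right sum_subtractf)
      have map2: "x + ((\<Sum>c\<in>faces. weight c x *\<^sub>R D2 c) + z) = (\<Sum>c\<in>faces. (weight c x * l1 c) *\<^sub>R \<Xi> c) + z" for x z
        using sum_weight_scaleR[of x] by (simp add: D2_def scaleR_diff_right sum_subtractf)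
      define \<alpha> where "\<alpha> = (\<Sum>c\<in>?F. (c \<bullet> D1 c) / (l1 c * class_size c))"
      define \<beta> where "\<beta> = (\<Sum>c\<in>?F. (c \<bullet> D2 c) / (l1 c * class_size c))"
      have \<alpha>: "\<alpha> = (\<Sum>c\<in>?F. (R c - 1) / class_size c)"
        unfolding \<alpha>_def
      proof (rule sum.cong)
        fix c :: "real^'n::_" assume c: "c \<in> faces"
        have "c \<bullet> D1 c = (R c - 1) * l1 c"
          unfolding D1_def inner_diff_right inner_commute[of c "X c"] XR(4)[OF c] face_inner_self[OF c] by (simp add: left_diff_distrib)
        then show "(c \<bullet> D1 c) / (l1 c * class_size c) = (R c - 1) / class_size c" using l1_face_pos[OF c] by simp
      qed simp
      have \<beta>: "\<beta> = (\<Sum>c\<in>?F. (1 / R c - 1) / class_size c)"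
        unfolding \<beta>_def
      proof (rule sum.cong)
        fix c :: "real^'n::_" assume c: "c \<in> faces"
        have "c \<bullet> \<Xi> c = (\<Sum>i\<in>UNIV. c $ i * c $ i / (R c * l1 c))"
          unfolding inner_vec_sum
        proof (rule sum.cong)
          fix i show "c $ i * \<Xi> c $ i = c $ i * c $ i / (R c * l1 c)" using XR(5)[OF c] by (cases "c $ i = 0") auto
        qed simp
        also have "\<dots> = (c \<bullet> c) / (R c * l1 c)" by (simp add: inner_vec_sum sum_divide_distrib)
        also have "\<dots> = 1 / R c" unfolding face_inner_self[OF c] using l1_face_pos[OF c] by simp
        finally have "c \<bullet> D2 c = (1 / R c - 1) * l1 c"
          by (simp add: D2_def inner_diff_right face_inner_self[OF c] algebra_simps)
        then show "(c \<bullet> D2 c) / (l1 c * class_size c) = (1 / R c - 1) / class_size c" using l1_face_pos[OF c] by simp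
      qed simp
      have cs: "1 \<le> class_size c" if "c \<in> faces" for c :: "real^'n::_"
        using class_size_pos[OF that] by (simp add: class_size_def Suc_le_eq)
      have Rinv: "1 / R c - 1 \<le> 2 * \<delta>" "0 \<le> 1 / R c - 1" if c: "c \<in> faces" for c
      proof -
        have "1 / R c \<le> 1 / (1 - \<delta>)" using est1[OF c] \<delta>2 by (intro divide_left_mono) auto
        also have "\<dots> \<le> 1 + 2 * \<delta>" by (rule inverse_one_minus_le[OF \<delta>0 \<delta>2])
        finally have "1 / R c \<le> 1 + 2 * \<delta>" .
        then show "1 / R c - 1 \<le> 2 * \<delta>" by simp
        show "0 \<le> 1 / R c - 1" using XR(3)[OF c] est2[OF c] by simp
      qed
      have \<alpha>\<beta>: "0 \<le> \<alpha> + \<beta>"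
        unfolding \<alpha> \<beta> sum.distrib[symmetric]
      proof (rule sum_nonneg)
        fix c :: "real^'n::_" assume c: "c \<in> faces"
        have "(R c - 1) + (1 / R c - 1) = (R c - 1)\<^sup>2 / R c" using XR(3)[OF c] by (simp add: power2_eq_square field_simps)
        then have "0 \<le> (R c - 1) + (1 / R c - 1)" using XR(3)[OF c] by simp
        then show "0 \<le> (R c - 1) / class_size c + (1 / R c - 1) / class_size c"
          unfolding add_divide_distrib[symmetric] using class_size_pos[OF c] by simp
      qed
      have small: "\<bar>q / class_size c\<bar> \<le> 2 * \<delta>" if "c \<in> faces" "\<bar>q\<bar> \<le> 2 * \<delta>" for q and c :: "real^'n::_"
      proof -
        have "\<bar>q\<bar> / class_size c \<le> \<bar>q\<bar> / 1" using cs[OF that(1)] by (intro divide_left_mono) auto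
        then show ?thesis using that(2) cs[OF that(1)] by simp
      qed
      have b\<alpha>: "\<bar>\<alpha>\<bar> \<le> 2 * N * \<delta>"
      proof -
        have "\<bar>\<alpha>\<bar> \<le> (\<Sum>c\<in>?F. 2 * \<delta>)" unfolding \<alpha>
          by (rule order_trans[OF sum_abs sum_mono], rule small) (use est1 est2 \<delta>0 in \<open>auto simp: abs_le_iff\<close>, fastforce)
        then show ?thesis by (simp add: N_def)
      qed
      have b\<beta>: "\<bar>\<beta>\<bar> \<le> 2 * N * \<delta>"
      proof -
        have "\<bar>\<beta>\<bar> \<le> (\<Sum>c\<in>?F. 2 * \<delta>)" unfolding \<beta>
        proof (rule order_trans[OF sum_abs sum_mono])
          fix c :: "real^'n::_" assume c: "c \<in> faces"
          show "\<bar>(1 / R c - 1) / class_size c\<bar> \<le> 2 * \<delta>" by (rule small[OF c]) (use Rinv[OF c] in simp)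
        qed
        then show ?thesis by (simp add: N_def)
      qed
      have Ce: "C * e\<^sup>2 = Q / 2 * \<delta>\<^sup>2" by (simp add: e_def Q_def power_mult_distrib)
      have inP: "(\<Sum>c\<in>faces. weight c x * l1 c) \<le> 1" if "x \<in> polar ?B" for x
        using that by (simp add: sum_weight_l1 polar_unit_cube)
      have inB: "(\<Sum>c\<in>faces. weight c x) \<le> 1" if "x \<in> ?B" for x
        using that by (intro sum_weight_le) (simp add: mem_unit_cube)
      \<comment> \<open>No push: the direction is \<open>0\<close>, so any centre and radius will do.\<close>
      have base1: "(1 + (\<alpha> - Q / 2 * \<delta>\<^sup>2)) * VB \<le> measure lebesgue K"
      proof -
        have "\<forall>x\<in>?B. x + ((\<Sum>c\<in>faces. weight c x *\<^sub>R D1 c) + bump 0 1 x *\<^sub>R 0) \<in> K"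
          unfolding map1
        proof
          fix x assume x: "x \<in> ?B"
          have "(\<Sum>c\<in>faces. weight c x *\<^sub>R X c) + 0 *\<^sub>R (0 :: real^'n::_) \<in> K"
            by (rule weighted_sum_mem[OF K(2) K0 finite_faces K0]) (use XR(1) weight_nonneg inB[OF x] in auto)
          then show "(\<Sum>c\<in>faces. weight c x *\<^sub>R X c) + bump 0 1 x *\<^sub>R 0 \<in> K" by simp
        qed
        then have "(1 - C * e\<^sup>2 + \<alpha>) * measure lebesgue ?B + integral ?B (\<lambda>x. bump_grad 0 1 x \<bullet> 0) \<le> measure lebesgue K"
          unfolding \<alpha>_def using e0 by (intro vol[OF lB sym_set_unit_cube lK(1) e1 _ _ bD1]) auto
        then show ?thesis by (simp add: VB_def Ce algebra_simps)
      qed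
      have base2: "(1 + (\<beta> - Q / 2 * \<delta>\<^sup>2)) * VP \<le> measure lebesgue (polar K)"
      proof -
        have "\<forall>x\<in>polar ?B. x + ((\<Sum>c\<in>faces. weight c x *\<^sub>R D2 c) + bump 0 1 x *\<^sub>R 0) \<in> polar K"
          unfolding map2
        proof
          fix x assume x: "x \<in> polar ?B"
          have "(\<Sum>c\<in>faces. (weight c x * l1 c) *\<^sub>R \<Xi> c) + 0 *\<^sub>R (0 :: real^'n::_) \<in> polar K"
            by (rule weighted_sum_mem[OF convex_polar zero_polar finite_faces zero_polar])
              (use XR(2) weight_nonneg inP[OF x] less_imp_le[OF l1_face_pos] in \<open>auto intro!: mult_nonneg_nonneg\<close>)
          then show "(\<Sum>c\<in>faces. (weight c x * l1 c) *\<^sub>R \<Xi> c) + bump 0 1 x *\<^sub>R 0 \<in> polar K" by simp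
        qed
        then have "(1 - C * e\<^sup>2 + \<beta>) * measure lebesgue (polar ?B) + integral (polar ?B) (\<lambda>x. bump_grad 0 1 x \<bullet> 0) \<le> measure lebesgue (polar K)"
          unfolding \<beta>_def using e0 by (intro vol[OF lP sym_set_polar_cube lK(2) e1 _ _ bD2]) auto
        then show ?thesis by (simp add: VP_def Ce algebra_simps)
      qed
      have d2: "\<delta>\<^sup>2 \<le> \<delta>" using \<delta>0 \<delta>2 by (simp add: power2_eq_square mult_left_le)
      have small_sum: "\<bar>q\<bar> \<le> M * \<delta>" if "\<bar>q0\<bar> \<le> 2 * N * \<delta>" "q = q0 - Q / 2 * \<delta>\<^sup>2 \<or> q = q0 - Q / 2 * \<delta>\<^sup>2 + \<tau> * \<delta>" for q q0
      proof -
        have "0 \<le> Q / 2 * \<delta>\<^sup>2" using Q0 by simp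
        moreover have "Q / 2 * \<delta>\<^sup>2 \<le> Q * \<delta>" using Q0 d2 by (intro mult_mono) auto
        moreover have "0 \<le> \<tau> * \<delta>" using \<tau>(1) \<delta>0 by simp
        ultimately show ?thesis using that unfolding M_def by (auto simp: algebra_simps abs_le_iff)
      qed
      have dd: "M * \<delta> \<le> 1" "(M\<^sup>2 + Q) * \<delta> < \<tau>"
      proof -
        have "M * \<delta> \<le> M * (1 / M)" using \<delta>\<eta> \<eta>(4) M0 by (intro mult_left_mono) auto
        then show "M * \<delta> \<le> 1" using M0 by simp
        have "(M\<^sup>2 + Q) * \<delta> \<le> (M\<^sup>2 + Q) * (\<tau> / (2 * (M\<^sup>2 + Q)))" using \<delta>\<eta> \<eta>(5) MQ by (intro mult_left_mono) auto
        also have "\<dots> = \<tau> / 2"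
        proof -
          have "x * (\<tau> / (2 * x)) = \<tau> / 2" if "0 < x" for x using that by simp
          then show ?thesis using MQ by blast
        qed
        finally show "(M\<^sup>2 + Q) * \<delta> < \<tau>" using \<tau>(1) by simp
      qed
      have conclude: ?thesis if "(1 + (\<alpha> - Q / 2 * \<delta>\<^sup>2 + \<tau> * \<delta>)) * VB \<le> measure lebesgue K \<or>
          (1 + (\<beta> - Q / 2 * \<delta>\<^sup>2 + \<tau> * \<delta>)) * VP \<le> measure lebesgue (polar K)"
      proof -
        have "VB * VP < measure lebesgue K * measure lebesgue (polar K)"
          using that
        proof
          assume "(1 + (\<alpha> - Q / 2 * \<delta>\<^sup>2 + \<tau> * \<delta>)) * VB \<le> measure lebesgue K"
          then show ?thesis
            using \<alpha>\<beta> by (intro product_gain[OF VB VP _ base2 small_sum[OF b\<alpha>] small_sum[OF b\<beta>] _ \<delta>pos dd]) auto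
        next
          assume "(1 + (\<beta> - Q / 2 * \<delta>\<^sup>2 + \<tau> * \<delta>)) * VP \<le> measure lebesgue (polar K)"
          then show ?thesis
            using \<alpha>\<beta> by (intro product_gain[OF VB VP base1 _ small_sum[OF b\<alpha>] small_sum[OF b\<beta>] _ \<delta>pos dd]) auto
        qed
        then show ?thesis by (simp add: volume_product_def VB_def VP_def)
      qed
      let ?f = "facet v i"
      note vf = vertices_faces[OF v] and ff = facet_faces[OF v, of i] and lf = l1_facet[OF v, of i]
      have Xf: "X ?f = ?f" "\<Xi> ?f = ?f" using XR(6,7)[OF ff lf] by blast+
      have fK: "?f \<in> K" using XR(1)[OF ff] Xf(1) by simp
      obtain j where j: "j \<noteq> i" using n2 by (metis card_2_iff' card_le_Suc0_iff_eq finite UNIV_I not_less_eq_eq numeral_2_eq_2)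
      have fv: "?f \<noteq> v" using j vertex_nonzero[OF v, of j] by (metis facet_nth)
      have fself: "?f \<bullet> ?f = 1" using face_inner_self[OF ff] lf by simp
      have fv1: "?f \<bullet> v = 1" using vertex_sq[OF v, of i] by (simp add: inner_commute[of ?f v] inner_facet)
      define p where "p = bump_centre 1 v i"
      have p_eq: "p = (1/2) *\<^sub>R (?f + v)" by (simp add: p_def bump_centre_def scaleR_add_right)
      \<comment> \<open>The image of the cube reaches only about \<open>(1 - \<delta> / 2) p\<close> in this direction.\<close>
      show ?thesis
      proof (cases "(1 - \<delta> / 4) *\<^sub>R p \<in> K")
        case q: True
        define w where "w = (1 - \<delta> / 4) *\<^sub>R p - (1/2) *\<^sub>R (?f + X v)"
        have wf: "w \<bullet> ?f = \<delta> / 4"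
        proof -
          have "v $ i * w $ i = (1 - \<delta> / 4) * (v $ i * p $ i) - (v $ i * v $ i + v $ i * X v $ i) / 2"
            by (simp add: w_def facet_nth algebra_simps)
          moreover have "v $ i * p $ i = 1" unfolding p_def using bump_centre_vertex_nth[OF v, of i 1 i] by simp
          ultimately have "v $ i * w $ i = (1 - \<delta> / 4) * 1 - (1 + (1 - \<delta>)) / 2" by (simp only: vi vertex_sq[OF v])
          then show ?thesis unfolding inner_facet by (simp add: field_simps)
        qed
        have bw: "\<forall>k. \<bar>w $ k\<bar> \<le> e"
        proof
          fix k
          have wk: "w $ k = - (\<delta> / 4 * p $ k) + (v $ k - X v $ k) / 2" by (simp add: w_def p_eq algebra_simps)
          have "\<bar>p $ k\<bar> \<le> 1" unfolding p_def using vertex_abs[OF v, of k] by (simp add: bump_centre_nth abs_mult)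
          then have "\<delta> / 4 * \<bar>p $ k\<bar> \<le> \<delta> / 4 * 1" using \<delta>0 by (intro mult_left_mono) auto
          then have pk: "\<bar>\<delta> / 4 * p $ k\<bar> \<le> \<delta> / 4" using \<delta>0 by (simp add: abs_mult)
          have "\<bar>v $ k - X v $ k\<bar> \<le> ?n * \<delta>" using est3[OF vf, of k] by (simp add: abs_minus_commute)
          then show "\<bar>w $ k\<bar> \<le> e" unfolding e_def mult.assoc by (rule shift_bound[OF wk pk _ nd \<delta>0])
        qed
        define \<kappa> where "\<kappa> = (\<lambda>c. if c = ?f then 1/2 else if c = v then 1/2 else 0 :: real)"
        have \<kappa>sum: "(\<Sum>c\<in>faces. \<kappa> c *\<^sub>R Y c) = (1/2) *\<^sub>R (Y ?f + Y v)" for Y :: "_ \<Rightarrow> 'z::real_vector"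
        proof -
          have "(\<Sum>c\<in>faces. \<kappa> c *\<^sub>R Y c) = (\<Sum>c\<in>{?f, v}. \<kappa> c *\<^sub>R Y c)"
            by (rule sum.mono_neutral_right) (use finite_faces ff vf in \<open>auto simp: \<kappa>_def\<close>)
          then show ?thesis using fv by (simp add: \<kappa>_def scaleR_add_right)
        qed
        have mem: "\<forall>x\<in>?B. x + ((\<Sum>c\<in>faces. weight c x *\<^sub>R D1 c) + bump p r x *\<^sub>R w) \<in> K"
          unfolding map1
        proof
          fix x assume x: "x \<in> ?B"
          have "(\<Sum>c\<in>faces. weight c x *\<^sub>R X c) + bump p r x *\<^sub>R ((1 - \<delta> / 4) *\<^sub>R p - (\<Sum>c\<in>faces. \<kappa> c *\<^sub>R X c)) \<in> K"
          proof (rule bump_mem[OF K(2) K0 q XR(1) bump_bounds(1) _ _ inB[OF x]])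
            show "(\<Sum>c\<in>faces. \<kappa> c) = 1" using \<kappa>sum[of "\<lambda>_. 1 :: real"] by simp
            fix c :: "real^'n::_" assume c: "c \<in> faces"
            show "bump p r x * \<kappa> c \<le> weight c x"
            proof (cases "x \<in> ball p r \<and> (c = ?f \<or> c = v)")
              case True
              have "weight c p = 1/2"
                using True weight_facet_centre[OF v _ n2, of 1 i] weight_vertex_centre[OF v _ n2, of 1 i] by (auto simp: p_def)
              then have "1/4 \<le> weight c x" using weight_near[OF c, of x p] True by (simp add: r_def)
              moreover have "bump p r x * \<kappa> c \<le> 1/4 * 1"
                using bump_bounds[where p=p and r=r and x=x] r(3) by (intro mult_mono) (auto simp: \<kappa>_def)
              ultimately show ?thesis by linarith
            next
              case False
              then have "bump p r x * \<kappa> c = 0" using bump_outside[of x p r] r(1) by (auto simp: \<kappa>_def)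
              then show ?thesis using weight_nonneg[of c x] by linarith
            qed
          qed
          then show "(\<Sum>c\<in>faces. weight c x *\<^sub>R X c) + bump p r x *\<^sub>R w \<in> K"
            unfolding \<kappa>sum Xf(1) w_def .
        qed
        obtain g where g: "\<gamma>1 \<le> g" "integral ?B (\<lambda>x. bump_grad p r x \<bullet> w) = g * (w \<bullet> ?f)"
          using \<gamma>1(2)[OF v, of i] unfolding p_def by blast
        have "(1 - C * e\<^sup>2 + \<alpha>) * measure lebesgue ?B + integral ?B (\<lambda>x. bump_grad p r x \<bullet> w) \<le> measure lebesgue K"
          unfolding \<alpha>_def by (rule vol[OF lB sym_set_unit_cube lK(1) e1 r(1,2) bD1 bw mem])
        moreover have "\<tau> * VB * \<delta> \<le> g * (\<delta> / 4)"
        proof -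
          have "\<tau> * VB * \<delta> \<le> \<gamma>1 / 4 * \<delta>" using \<tau>(2) \<delta>0 by (rule mult_right_mono)
          also have "\<dots> \<le> g / 4 * \<delta>" using g(1) \<delta>0 by (intro mult_right_mono) auto
          finally show ?thesis by simp
        qed
        ultimately show ?thesis
          by (intro conclude disjI1) (simp add: g(2) wf VB_def Ce algebra_simps)
      next
        case q: False
        obtain \<xi> where \<xi>: "\<xi> \<in> polar K" "1 < ((1 - \<delta> / 4) *\<^sub>R p) \<bullet> \<xi>"
          using bipolar[OF compact_imp_closed[OF K(1)] K(2) K0, of "(1 - \<delta> / 4) *\<^sub>R p"] q by (meson not_le)
        define w where "w = \<xi> - ?f"
        have p\<xi>: "1 + \<delta> / 4 < p \<bullet> \<xi>"
        proof (rule ccontr)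
          assume "\<not> 1 + \<delta> / 4 < p \<bullet> \<xi>"
          then have "(1 - \<delta> / 4) * (p \<bullet> \<xi>) \<le> (1 - \<delta> / 4) * (1 + \<delta> / 4)" using \<delta>2 by (intro mult_left_mono) auto
          also have "\<dots> = 1 - (\<delta> / 4)\<^sup>2" by (simp add: power2_eq_square algebra_simps)
          also have "\<dots> \<le> 1" by simp
          finally show False using \<xi>(2) by simp
        qed
        have f\<xi>: "?f \<bullet> \<xi> \<le> 1" using \<xi>(1) fK by (simp add: polar_def)
        have pe: "p \<bullet> \<xi> = (?f \<bullet> \<xi> + v \<bullet> \<xi>) / 2" by (simp add: p_eq inner_add_left)
        have wv: "\<delta> / 2 \<le> w \<bullet> v"
          using p\<xi> f\<xi> pe fv1 by (simp add: w_def inner_diff_left inner_commute[of \<xi> v])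
        define s where "s = (\<Sum>k\<in>UNIV - {i}. \<bar>\<xi> $ k\<bar>)"
        have l\<xi>: "l1 \<xi> = \<bar>\<xi> $ i\<bar> + s" unfolding l1_def s_def by (rule sum.remove) auto
        have "l1 \<xi> \<le> 1 / (1 - \<delta>)" by (rule polar_l1_le[OF _ cube_in \<xi>(1)]) (use \<delta>2 in auto)
        also have "\<dots> \<le> 1 + 2 * \<delta>" by (rule inverse_one_minus_le[OF \<delta>0 \<delta>2])
        finally have l1\<xi>: "\<bar>\<xi> $ i\<bar> + s \<le> 1 + 2 * \<delta>" using l\<xi> by simp
        have f\<xi>i: "?f \<bullet> \<xi> = v $ i * \<xi> $ i" by (simp add: inner_commute[of ?f] inner_facet)
        have v\<xi>: "v \<bullet> \<xi> \<le> v $ i * \<xi> $ i + s"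
          unfolding inner_commute[of v] inner_vertex_remove[of \<xi> v i] s_def
        proof (intro add_left_mono sum_mono)
          fix k show "v $ k * \<xi> $ k \<le> \<bar>\<xi> $ k\<bar>" using vertex_abs[OF v, of k] abs_ge_self[of "v $ k * \<xi> $ k"] by (simp add: abs_mult)
        qed
        have abs_i: "v $ i * \<xi> $ i \<le> \<bar>\<xi> $ i\<bar>" using vertex_abs[OF v, of i] abs_ge_self[of "v $ i * \<xi> $ i"] by (simp add: abs_mult)
        have s4: "s \<le> 4 * \<delta>" by (rule slack_sum[OF p\<xi> pe f\<xi>i v\<xi> \<delta>0 abs_i l1\<xi>])
        have s0: "0 \<le> s" by (simp add: s_def sum_nonneg)
        have fi: "\<bar>v $ i * \<xi> $ i - 1\<bar> \<le> 2 * \<delta>" by (rule slack_top[OF p\<xi> pe f\<xi>i v\<xi> \<delta>0 f\<xi> s4])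
        have bw: "\<forall>k. \<bar>w $ k\<bar> \<le> e"
        proof
          fix k
          have "\<bar>w $ k\<bar> \<le> 4 * \<delta>"
          proof (cases "k = i")
            case True
            have "v $ i * w $ i = v $ i * \<xi> $ i - 1" by (simp add: w_def facet_nth right_diff_distrib vertex_sq[OF v])
            then have "\<bar>w $ i\<bar> = \<bar>v $ i * \<xi> $ i - 1\<bar>" using vertex_abs[OF v, of i] by (metis abs_mult mult_1)
            then show ?thesis using fi True \<delta>0 by simp
          next
            case False
            have "\<bar>\<xi> $ k\<bar> \<le> s" unfolding s_def by (rule member_le_sum) (use False in auto)
            then show ?thesis using False s4 by (simp add: w_def facet_nth)
          qed
          then show "\<bar>w $ k\<bar> \<le> e" unfolding e_def using nd \<delta>0 by linarith
        qed
        \<comment> \<open>Next to \<open>facet v i\<close> itself the bump would have to be of size \<open>\<delta>\<close>. Since \<open>\<xi>\<close> and \<open>facet v i\<close> both lie in the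
          polar, the shift towards \<open>\<xi>\<close> can be carried out halfway to the centre of the facet with normal \<open>v\<close>.\<close>
        define p' where "p' = bump_centre (1 / ?n) v i"
        define \<kappa> where "\<kappa> = (\<lambda>c. if c = ?f then 1 else 0 :: real)"
        have \<kappa>sum: "(\<Sum>c\<in>faces. \<kappa> c *\<^sub>R Y c) = Y ?f" for Y :: "_ \<Rightarrow> 'z::real_vector"
        proof -
          have "(\<Sum>c\<in>faces. \<kappa> c *\<^sub>R Y c) = (\<Sum>c\<in>{?f}. \<kappa> c *\<^sub>R Y c)"
            by (rule sum.mono_neutral_right) (use finite_faces ff in \<open>auto simp: \<kappa>_def\<close>)
          then show ?thesis by (simp add: \<kappa>_def)
        qed
        have mem: "\<forall>x\<in>polar ?B. x + ((\<Sum>c\<in>faces. weight c x *\<^sub>R D2 c) + bump p' r x *\<^sub>R w) \<in> polar K"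
          unfolding map2
        proof
          fix x assume x: "x \<in> polar ?B"
          have "(\<Sum>c\<in>faces. (weight c x * l1 c) *\<^sub>R \<Xi> c) + bump p' r x *\<^sub>R (\<xi> - (\<Sum>c\<in>faces. \<kappa> c *\<^sub>R \<Xi> c)) \<in> polar K"
          proof (rule bump_mem[OF convex_polar zero_polar \<xi>(1) XR(2) bump_bounds(1) _ _ inP[OF x]])
            show "(\<Sum>c\<in>faces. \<kappa> c) = 1" using \<kappa>sum[of "\<lambda>_. 1 :: real"] by simp
            fix c :: "real^'n::_" assume c: "c \<in> faces"
            show "bump p' r x * \<kappa> c \<le> weight c x * l1 c"
            proof (cases "x \<in> ball p' r \<and> c = ?f")
              case True
              have "weight c p' = 1/2"
                using True weight_facet_centre[OF v _ n2, of "1 / ?n" i] n1 by (simp add: p'_def)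
              then have "1/4 \<le> weight c x" using weight_near[OF c, of x p'] True by (simp add: r_def)
              moreover have "bump p' r x \<le> 1/4" using bump_bounds(2)[of p' r x] r(3) by linarith
              ultimately show ?thesis using True lf by (simp add: \<kappa>_def)
            next
              case False
              then have "bump p' r x * \<kappa> c = 0" using bump_outside[of x p' r] r(1) by (auto simp: \<kappa>_def)
              moreover have "0 \<le> weight c x * l1 c" using weight_nonneg[of c x] l1_face_pos[OF c] by simp
              ultimately show ?thesis by linarith
            qed
          qed
          then show "(\<Sum>c\<in>faces. (weight c x * l1 c) *\<^sub>R \<Xi> c) + bump p' r x *\<^sub>R w \<in> polar K"
            unfolding \<kappa>sum Xf(2) w_def .
        qed
        obtain g where g: "\<gamma>2 \<le> g" "integral (polar ?B) (\<lambda>x. bump_grad p' r x \<bullet> w) = g * (w \<bullet> v)"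
          using \<gamma>2(2)[OF v, of i] unfolding p'_def by blast
        have "(1 - C * e\<^sup>2 + \<beta>) * measure lebesgue (polar ?B) + integral (polar ?B) (\<lambda>x. bump_grad p' r x \<bullet> w) \<le> measure lebesgue (polar K)"
          unfolding \<beta>_def by (rule vol[OF lP sym_set_polar_cube lK(2) e1 r(1,2) bD2 bw mem])
        moreover have "\<tau> * VP * \<delta> \<le> g * (w \<bullet> v)"
        proof -
          have "\<tau> * VP * \<delta> \<le> \<gamma>2 / 2 * \<delta>" using \<tau>(3) \<delta>0 by (rule mult_right_mono)
          also have "\<dots> = \<gamma>2 * (\<delta> / 2)" by simp
          also have "\<dots> \<le> g * (w \<bullet> v)" using g(1) wv \<delta>0 \<gamma>2pos by (intro mult_mono) auto
          finally show ?thesis .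
        qed
        ultimately show ?thesis
          by (intro conclude disjI2) (simp add: g(2) VP_def Ce algebra_simps)
      qed
    qed
  qed
qed

section \<open>Bringing a body near the cube into contact position\<close>

lemma prod_rows_expand:
  fixes a :: "'n::finite \<Rightarrow> 'n \<Rightarrow> real"
  shows "(\<Prod>i\<in>UNIV. \<Sum>j\<in>UNIV. a i j) = (\<Sum>g\<in>UNIV. \<Prod>i\<in>UNIV. a i (g i))"
  using prod_sum_PiE[of "UNIV :: 'n set" "\<lambda>_. UNIV :: 'n set" a] by (simp add: PiE_UNIV_domain)

lemma abs_det_le_permanent:
  fixes F :: "real^'n::finite^'n"
  shows "\<bar>det F\<bar> \<le> (\<Sum>p | p permutes UNIV. \<Prod>i\<in>UNIV. \<bar>F $ i $ p i\<bar>)"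
  unfolding det_def
proof (rule order_trans[OF sum_abs sum_mono])
  show "\<bar>of_int (sign p) * (\<Prod>i\<in>UNIV. F $ i $ p i)\<bar> \<le> (\<Prod>i\<in>UNIV. \<bar>F $ i $ p i\<bar>)" for p
    by (simp add: abs_mult abs_prod sign_def)
qed

text \<open>The product of the row norms is the sum of \<open>\<bar>F $ i $ g i\<bar>\<close>-products over all maps \<open>g\<close>, while the determinant only
  sees permutations. So non-injective products are at most \<open>s ^ n - 1\<close>; changing one value of a permutation with a
  large product bounds a single off-permutation entry.\<close>
lemma row_small_off_permutation:
  fixes F :: "real^'n::finite^'n"
  assumes s: "1 \<le> s" "s \<le> 2" and rows: "\<And>i. l1 (F $ i) \<le> s" and det: "1 \<le> \<bar>det F\<bar>"
  shows "\<exists>p. p permutes UNIV \<and> (\<forall>i j. j \<noteq> p i \<longrightarrow> \<bar>F $ i $ j\<bar> \<le> 2 * fact CARD('n) * (s ^ CARD('n) - 1))"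
proof -
  let ?P = "{p. p permutes (UNIV :: 'n set)}"
  let ?t = "\<lambda>g. \<Prod>i\<in>UNIV. \<bar>F $ i $ g i\<bar>"
  have t0: "0 \<le> ?t g" for g by (simp add: prod_nonneg)
  have finP: "finite ?P" by (simp add: finite_permutations)
  have perm: "1 \<le> (\<Sum>p\<in>?P. ?t p)" using det abs_det_le_permanent[of F] by linarith
  have all: "(\<Sum>g\<in>UNIV. ?t g) \<le> s ^ CARD('n)"
  proof -
    have "(\<Sum>g\<in>UNIV. ?t g) = (\<Prod>i\<in>UNIV. l1 (F $ i))" unfolding l1_def by (rule prod_rows_expand[symmetric])
    also have "\<dots> \<le> (\<Prod>i\<in>(UNIV :: 'n set). s)" using rows by (intro prod_mono) (auto simp: l1_def sum_nonneg)
    finally show ?thesis by simp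
  qed
  have non: "?t g \<le> s ^ CARD('n) - 1" if "g \<notin> ?P" for g
  proof -
    have "?t g + (\<Sum>p\<in>?P. ?t p) = (\<Sum>p\<in>insert g ?P. ?t p)" using that finP by simp
    also have "\<dots> \<le> (\<Sum>g\<in>UNIV. ?t g)" using t0 by (intro sum_mono2) auto
    finally show ?thesis using perm all by linarith
  qed
  have "\<exists>p\<in>?P. 1 / fact CARD('n) \<le> ?t p"
  proof (rule ccontr)
    assume "\<not> ?thesis"
    then have "(\<Sum>p\<in>?P. ?t p) < (\<Sum>p\<in>?P. 1 / fact CARD('n))"
      using finP by (intro sum_strict_mono) (auto simp: not_le intro: permutes_id)
    also have "\<dots> = 1" by (simp add: card_permutations)
    finally show False using perm by simp
  qed
  then obtain p where p: "p permutes UNIV" "1 / fact CARD('n) \<le> ?t p" by blast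
  have "\<bar>F $ i $ j\<bar> \<le> 2 * fact CARD('n) * (s ^ CARD('n) - 1)" if "j \<noteq> p i" for i j
  proof -
    define rest where "rest = (\<Prod>k\<in>UNIV - {i}. \<bar>F $ k $ p k\<bar>)"
    have rest0: "0 \<le> rest" by (simp add: rest_def prod_nonneg)
    have "?t p = \<bar>F $ i $ p i\<bar> * rest" unfolding rest_def by (rule prod.remove) auto
    moreover have "\<bar>F $ i $ p i\<bar> \<le> 2"
    proof -
      have "\<bar>F $ i $ p i\<bar> \<le> l1 (F $ i)" unfolding l1_def by (rule member_le_sum) auto
      then show ?thesis using rows[of i] s(2) by linarith
    qed
    ultimately have "1 / fact CARD('n) \<le> 2 * rest" using p(2) mult_right_mono[OF _ rest0] by fastforce
    then have rest: "1 / (2 * fact CARD('n)) \<le> rest" by (simp add: field_simps)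
    define g where "g = p(i := j)"
    obtain k where k: "p k = j" using p(1) permutes_univ by metis
    have ki: "k \<noteq> i" using k that by auto
    have "g \<notin> ?P"
    proof
      assume "g \<in> ?P"
      then have "inj g" using permutes_inj by auto
      moreover have "g k = g i" using k ki by (simp add: g_def)
      ultimately show False using ki by (auto dest: injD)
    qed
    then have "?t g \<le> s ^ CARD('n) - 1" by (rule non)
    moreover have "?t g = \<bar>F $ i $ g i\<bar> * (\<Prod>k\<in>UNIV - {i}. \<bar>F $ k $ g k\<bar>)" by (rule prod.remove) auto
    moreover have "(\<Prod>k\<in>UNIV - {i}. \<bar>F $ k $ g k\<bar>) = rest" unfolding rest_def by (rule prod.cong) (auto simp: g_def)
    ultimately have "\<bar>F $ i $ j\<bar> * rest \<le> s ^ CARD('n) - 1" by (simp add: g_def)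
    moreover have "\<bar>F $ i $ j\<bar> * (1 / (2 * fact CARD('n))) \<le> \<bar>F $ i $ j\<bar> * rest" using rest by (intro mult_left_mono) auto
    ultimately have "\<bar>F $ i $ j\<bar> * (1 / (2 * fact CARD('n))) \<le> s ^ CARD('n) - 1" by linarith
    then show ?thesis by (simp add: divide_le_eq mult_ac)
  qed
  then show ?thesis using p(1) by blast
qed

lemma row_l1_lower:
  fixes F :: "real^'n::finite^'n"
  assumes s: "1 \<le> s" and rows: "\<And>i. l1 (F $ i) \<le> s" and det: "1 \<le> \<bar>det F\<bar>"
  shows "2 - s ^ CARD('n) \<le> l1 (F $ i)"
proof -
  have "1 \<le> (\<Sum>p | p permutes UNIV. \<Prod>i\<in>UNIV. \<bar>F $ i $ p i\<bar>)" using det abs_det_le_permanent[of F] by linarith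
  also have "\<dots> \<le> (\<Sum>g\<in>UNIV. \<Prod>i\<in>UNIV. \<bar>F $ i $ g i\<bar>)" by (rule sum_mono2) (auto simp: prod_nonneg)
  also have "\<dots> = (\<Prod>i\<in>UNIV. l1 (F $ i))" unfolding l1_def by (rule prod_rows_expand[symmetric])
  also have "\<dots> = l1 (F $ i) * (\<Prod>k\<in>UNIV - {i}. l1 (F $ k))" by (rule prod.remove) auto
  also have "\<dots> \<le> l1 (F $ i) * s ^ CARD('n)"
  proof (rule mult_left_mono)
    have "(\<Prod>k\<in>UNIV - {i}. l1 (F $ k)) \<le> (\<Prod>k\<in>UNIV - {i}. s)"
      using rows by (intro prod_mono) (auto simp: l1_def sum_nonneg)
    also have "\<dots> \<le> s ^ CARD('n)" using s by (simp add: power_increasing)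
    finally show "(\<Prod>k\<in>UNIV - {i}. l1 (F $ k)) \<le> s ^ CARD('n)" .
  qed (simp add: l1_def sum_nonneg)
  finally have 1: "1 \<le> l1 (F $ i) * s ^ CARD('n)" .
  let ?S = "s ^ CARD('n)"
  have S: "1 \<le> ?S" using s by simp
  have "(2 - ?S) * ?S \<le> 1" using zero_le_power2[of "?S - 1"] by (simp add: power2_eq_square algebra_simps)
  then have "(2 - ?S) * ?S \<le> l1 (F $ i) * ?S" using 1 by linarith
  then show ?thesis using S by (simp add: mult_le_cancel_right)
qed

text \<open>\<open>F\<close> is close to a signed permutation matrix, so it cannot shrink the sup-norm by much.\<close>
lemma expanding_matrix:
  fixes F :: "real^'n::finite^'n"
  assumes s: "1 \<le> s" "s \<le> 2" and rows: "\<And>i. l1 (F $ i) \<le> s" and det: "1 \<le> \<bar>det F\<bar>"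
    and y: "\<And>i. \<bar>(F *v x) $ i\<bar> \<le> m"
    and pos: "0 < 1 - (1 + 4 * real CARD('n) * fact CARD('n)) * (s ^ CARD('n) - 1)"
  shows "\<bar>x $ j\<bar> * (1 - (1 + 4 * real CARD('n) * fact CARD('n)) * (s ^ CARD('n) - 1)) \<le> m"
proof -
  let ?n = "real CARD('n)" and ?th = "s ^ CARD('n) - 1"
  define off_bound where "off_bound = 2 * fact CARD('n) * ?th"
  have th0: "0 \<le> ?th" using s(1) by simp
  have o0: "0 \<le> off_bound" using th0 by (simp add: off_bound_def)
  obtain p where p: "p permutes UNIV" "\<And>i j. j \<noteq> p i \<Longrightarrow> \<bar>F $ i $ j\<bar> \<le> off_bound"
    using row_small_off_permutation[OF s rows det] unfolding off_bound_def by blast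
  have "finite (range (\<lambda>k. \<bar>x $ k\<bar>))" by simp
  then have "Max (range (\<lambda>k. \<bar>x $ k\<bar>)) \<in> range (\<lambda>k. \<bar>x $ k\<bar>)" by (intro Max_in) auto
  then obtain k where k: "Max (range (\<lambda>k. \<bar>x $ k\<bar>)) = \<bar>x $ k\<bar>" by blast
  have le: "\<bar>x $ l\<bar> \<le> \<bar>x $ k\<bar>" for l unfolding k[symmetric] by (intro Max_ge) auto
  obtain i where i: "p i = k" using p(1) permutes_univ by metis
  have off: "(\<Sum>l\<in>UNIV - {k}. \<bar>F $ i $ l\<bar>) \<le> ?n * off_bound"
  proof -
    have "(\<Sum>l\<in>UNIV - {k}. \<bar>F $ i $ l\<bar>) \<le> (\<Sum>l\<in>UNIV - {k}. off_bound)" using p(2)[of _ i] i by (intro sum_mono) auto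
    also have "\<dots> \<le> (\<Sum>l\<in>(UNIV :: 'n set). off_bound)" using o0 by (intro sum_mono2) auto
    finally show ?thesis by simp
  qed
  have "2 - s ^ CARD('n) \<le> l1 (F $ i)" by (rule row_l1_lower[OF s(1) rows det])
  moreover have "l1 (F $ i) = \<bar>F $ i $ k\<bar> + (\<Sum>l\<in>UNIV - {k}. \<bar>F $ i $ l\<bar>)" unfolding l1_def by (rule sum.remove) auto
  ultimately have diag: "1 - ?th - ?n * off_bound \<le> \<bar>F $ i $ k\<bar>" using off by linarith
  have "(F *v x) $ i = F $ i $ k * x $ k + (\<Sum>l\<in>UNIV - {k}. F $ i $ l * x $ l)"
    unfolding matrix_vector_mult_def vec_lambda_beta by (rule sum.remove) auto
  moreover have "\<bar>\<Sum>l\<in>UNIV - {k}. F $ i $ l * x $ l\<bar> \<le> (?n * off_bound) * \<bar>x $ k\<bar>"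
  proof -
    have "\<bar>\<Sum>l\<in>UNIV - {k}. F $ i $ l * x $ l\<bar> \<le> (\<Sum>l\<in>UNIV - {k}. \<bar>F $ i $ l\<bar> * \<bar>x $ k\<bar>)"
      using le by (intro order_trans[OF sum_abs] sum_mono) (auto simp: abs_mult intro!: mult_left_mono)
    also have "\<dots> = (\<Sum>l\<in>UNIV - {k}. \<bar>F $ i $ l\<bar>) * \<bar>x $ k\<bar>" by (simp add: sum_distrib_right)
    also have "\<dots> \<le> (?n * off_bound) * \<bar>x $ k\<bar>" using off by (intro mult_right_mono) auto
    finally show ?thesis .
  qed
  ultimately have "\<bar>F $ i $ k\<bar> * \<bar>x $ k\<bar> - (?n * off_bound) * \<bar>x $ k\<bar> \<le> m"
    using y[of i] unfolding abs_mult[symmetric] by linarith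
  moreover have "(1 - ?th - ?n * off_bound) * \<bar>x $ k\<bar> \<le> \<bar>F $ i $ k\<bar> * \<bar>x $ k\<bar>" using diag by (intro mult_right_mono) auto
  ultimately have xk: "\<bar>x $ k\<bar> * (1 - ?th - 2 * (?n * off_bound)) \<le> m" by (simp add: algebra_simps)
  have e: "1 - ?th - 2 * (?n * off_bound) = 1 - (1 + 4 * ?n * fact CARD('n)) * ?th" by (simp add: off_bound_def algebra_simps)
  have "\<bar>x $ j\<bar> * (1 - (1 + 4 * ?n * fact CARD('n)) * ?th) \<le> \<bar>x $ k\<bar> * (1 - (1 + 4 * ?n * fact CARD('n)) * ?th)"
    using le[of j] pos by (intro mult_right_mono) auto
  also have "\<dots> \<le> m" using xk unfolding e .
  finally show ?thesis .
qed

lemma polar_linear_image: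
  fixes f g :: "real^'n::finite \<Rightarrow> real^'n"
  assumes f: "linear f" and g: "linear g" and fg: "\<And>x. f (g x) = x" "\<And>x. g (f x) = x"
  shows "polar (f ` K) = adjoint g ` polar K"
proof (intro set_eqI iffI)
  fix \<xi> assume \<xi>: "\<xi> \<in> polar (f ` K)"
  have "x \<bullet> adjoint f \<xi> = f x \<bullet> \<xi>" for x by (rule adjoint_works[OF f])
  then have "adjoint f \<xi> \<in> polar K" using \<xi> by (auto simp: polar_def)
  moreover have "adjoint g (adjoint f \<xi>) = \<xi>"
  proof (rule vector_eq_rdot[THEN iffD1], intro allI)
    fix z
    have "z \<bullet> adjoint g (adjoint f \<xi>) = z \<bullet> \<xi>" unfolding adjoint_works[OF g] adjoint_works[OF f] fg ..
    then show "adjoint g (adjoint f \<xi>) \<bullet> z = \<xi> \<bullet> z" by (simp add: inner_commute)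
  qed
  ultimately show "\<xi> \<in> adjoint g ` polar K" by (metis image_eqI)
next
  fix \<xi> assume "\<xi> \<in> adjoint g ` polar K"
  then obtain \<zeta> where \<zeta>: "\<zeta> \<in> polar K" "\<xi> = adjoint g \<zeta>" by blast
  have "f x \<bullet> \<xi> = x \<bullet> \<zeta>" for x unfolding \<zeta>(2) adjoint_works[OF g] fg ..
  then show "\<xi> \<in> polar (f ` K)" using \<zeta>(1) by (auto simp: polar_def)
qed

lemma volume_product_linear_image:
  fixes f g :: "real^'n::{finite,wellorder} \<Rightarrow> real^'n::_"
  assumes f: "linear f" and g: "linear g" and fg: "\<And>x. f (g x) = x" "\<And>x. g (f x) = x"
    and K: "K \<in> lmeasurable" "polar K \<in> lmeasurable"
  shows "volume_product (f ` K) = volume_product K"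
proof -
  have "matrix (f \<circ> g) = matrix f ** matrix g" by (rule matrix_compose[OF g f])
  moreover have "f \<circ> g = id" using fg by (simp add: fun_eq_iff)
  ultimately have "det (matrix f) * det (matrix g) = det (matrix (id :: real^'n::_ \<Rightarrow> _))" by (simp add: det_mul)
  also have "\<dots> = 1" by simp
  finally have "\<bar>det (matrix f)\<bar> * \<bar>det (matrix g)\<bar> = 1" by (simp add: abs_mult[symmetric])
  moreover have "det (matrix (adjoint g)) = det (matrix g)"
    using matrix_adjoint[OF g] by (simp add: det_transpose)
  ultimately show ?thesis
    unfolding volume_product_def polar_linear_image[OF f g fg]
    by (simp add: measure_linear_image[OF f K(1)] measure_linear_image[OF adjoint_linear[OF g] K(2)])
qed

lemma compact_rows:
  fixes A :: "(real^'n::finite) set"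
  assumes "compact A" shows "compact {F :: real^'n^'n. \<forall>i. F $ i \<in> A}"
  unfolding compact_eq_bounded_closed
proof
  obtain B where B: "\<And>x. x \<in> A \<Longrightarrow> norm x \<le> B" using compact_imp_bounded[OF assms] by (auto simp: bounded_iff)
  have "norm F \<le> real CARD('n) * B" if "\<forall>i. F $ i \<in> A" for F :: "real^'n^'n"
  proof -
    have "norm F \<le> (\<Sum>i\<in>(UNIV::'n set). norm (F $ i))" unfolding norm_vec_def by (rule L2_set_le_sum) auto
    also have "\<dots> \<le> (\<Sum>i\<in>(UNIV::'n set). B)" using that B by (intro sum_mono) auto
    finally show ?thesis by simp
  qed
  then show "bounded {F :: real^'n^'n. \<forall>i. F $ i \<in> A}" by (auto simp: bounded_iff)
  have "{F :: real^'n^'n. \<forall>i. F $ i \<in> A} = (\<Inter>i. (\<lambda>F. F $ i) -` A)" by auto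
  moreover have "closed ((\<lambda>F :: real^'n^'n. F $ i) -` A)" for i
    by (intro continuous_closed_vimage compact_imp_closed assms) (auto intro: continuous_intros)
  ultimately show "closed {F :: real^'n^'n. \<forall>i. F $ i \<in> A}" by auto
qed

text \<open>Choose the rows of \<open>F\<close> in the polar of \<open>K\<close> with maximal determinant. By maximality, replacing a row by another
  point of the polar does not increase the determinant; by Cramer this bounds the coordinates of such a point with
  respect to the rows, which says that the preimages of the axis vectors lie in the bipolar of \<open>K\<close>.\<close>
lemma auerbach_position:
  fixes K :: "(real^'n::finite) set"
  assumes K: "compact K" "convex K" "\<And>x. x \<in> K \<Longrightarrow> - x \<in> K" and Kc: "K \<subseteq> unit_cube"
    and t: "0 < t" "\<And>x. x \<in> unit_cube \<Longrightarrow> t *\<^sub>R x \<in> K"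
  shows "\<exists>F :: real^'n^'n. 1 \<le> det F \<and> (\<forall>i. F $ i \<in> polar K) \<and> (\<lambda>x. F *v x) ` K \<subseteq> unit_cube \<and>
    (\<forall>i. axis i 1 \<in> (\<lambda>x. F *v x) ` K)"
proof -
  let ?R = "{F :: real^'n^'n. \<forall>i. F $ i \<in> polar K}"
  have K0: "0 \<in> K" using t(2)[of 0] by (simp add: mem_unit_cube)
  have comp: "compact ?R" by (rule compact_rows[OF compact_polar[OF t]])
  have id: "mat 1 \<in> ?R"
  proof (intro CollectI allI)
    fix i
    have "(mat 1 :: real^'n^'n) $ i = axis i 1" by (simp add: mat_def axis_def vec_eq_iff)
    moreover have "x \<bullet> axis i 1 \<le> 1" if "x \<in> K" for x
      using that Kc by (auto simp: inner_axis mem_unit_cube abs_le_iff)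
    ultimately show "(mat 1 :: real^'n^'n) $ i \<in> polar K" by (simp add: polar_def)
  qed
  have "continuous_on ?R det" unfolding det_def by (intro continuous_intros)
  then obtain F where F: "F \<in> ?R" "\<forall>G\<in>?R. det G \<le> det F"
    using continuous_attains_sup[OF comp] id by blast
  have det1: "1 \<le> det F" using F(2) id by (metis det_I)
  have coef: "w $ j \<le> 1" if w: "(\<Sum>i\<in>UNIV. w $ i *s row i F) \<in> polar K" for w :: "real^'n" and j
  proof -
    let ?G = "\<chi> i. if i = j then (\<Sum>i\<in>UNIV. w $ i *s row i F) else row i F"
    have "?G \<in> ?R" using w F(1) by (auto simp: row_def)
    then have "det ?G \<le> det F" using F(2) by blast
    moreover have "det ?G = w $ j * det F" by (rule cramer_lemma_transpose)
    ultimately show ?thesis using det1 by (simp add: mult_le_cancel_right1)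
  qed
  have inv: "invertible F" using det1 by (simp add: invertible_det_nz)
  obtain Fi where Fi: "F ** Fi = mat 1" "Fi ** F = mat 1" using inv unfolding invertible_def by blast
  have cube: "(\<lambda>x. F *v x) ` K \<subseteq> unit_cube"
  proof
    fix y assume "y \<in> (\<lambda>x. F *v x) ` K"
    then obtain x where x: "x \<in> K" "y = F *v x" by blast
    have "\<bar>y $ i\<bar> \<le> 1" for i
    proof -
      have y: "y $ i = x \<bullet> (F $ i)" by (simp add: x(2) matrix_vector_mult_def inner_vec_sum mult.commute)
      have "x \<bullet> (F $ i) \<le> 1" "(- x) \<bullet> (F $ i) \<le> 1" using F(1) x(1) K(3)[OF x(1)] unfolding polar_def by blast+
      then show ?thesis unfolding y by (simp add: abs_le_iff)
    qed
    then show "y \<in> unit_cube" by (simp add: mem_unit_cube)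
  qed
  have axes: "axis j 1 \<in> (\<lambda>x. F *v x) ` K" for j
  proof -
    define x where "x = Fi *v axis j 1"
    have Fx: "F *v x = axis j 1" by (simp add: x_def matrix_vector_mul_assoc Fi)
    have "x \<in> K"
    proof (rule bipolar[OF compact_imp_closed[OF K(1)] K(2) K0])
      fix \<xi> assume \<xi>: "\<xi> \<in> polar K"
      define w where "w = transpose Fi *v \<xi>"
      have "transpose F *v w = transpose (Fi ** F) *v \<xi>"
        unfolding w_def matrix_vector_mul_assoc matrix_transpose_mul ..
      then have w\<xi>: "transpose F *v w = \<xi>" by (simp add: Fi transpose_mat)
      have "(\<Sum>i\<in>UNIV. w $ i *s row i F) = transpose F *v w"
        by (simp add: vec_eq_iff matrix_vector_mult_def transpose_def row_def sum_component mult.commute)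
      then have "w $ j \<le> 1" using coef[of w j] w\<xi> \<xi> by simp
      moreover have "x \<bullet> \<xi> = w \<bullet> (F *v x)"
        unfolding w\<xi>[symmetric] transpose_matrix_vector inner_commute[of x] by (rule dot_lmul_matrix)
      ultimately show "x \<bullet> \<xi> \<le> 1" by (simp add: Fx inner_axis)
    qed
    then show ?thesis using Fx by force
  qed
  show ?thesis using det1 F(1) cube axes by blast
qed

lemma compact_linear_vec_image:
  fixes f :: "real^'n::finite \<Rightarrow> real^'m::finite"
  assumes "linear f" "compact S" shows "compact (f ` S)"
  using linear_continuous_on[of f S] assms by (intro compact_continuous_image) (simp_all add: linear_conv_bounded_linear)

lemma neg_linear_image:
  assumes "linear f" "\<forall>x\<in>K. - x \<in> K" "y \<in> f ` K" shows "- y \<in> f ` K"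
proof -
  obtain x where x: "x \<in> K" "y = f x" using assms(3) by blast
  have "- y = f (- x)" using linear_neg[OF assms(1)] x(2) by simp
  then show ?thesis using assms(2) x(1) by blast
qed

lemma small_delta:
  fixes \<epsilon> L :: real
  assumes "0 < \<epsilon>"
  shows "\<exists>\<delta>>0. \<delta> \<le> 1 \<and> (1 - \<epsilon>) * (1 + \<delta>) \<le> 1 - L * ((1 + \<delta>) ^ n - 1) \<and> 0 < 1 - L * ((1 + \<delta>) ^ n - 1)"
proof -
  have "((\<lambda>d. 1 - L * ((1 + d) ^ n - 1) - (1 - \<epsilon>) * (1 + d)) \<longlongrightarrow> 1 - L * ((1 + 0) ^ n - 1) - (1 - \<epsilon>) * (1 + 0)) (at_right 0)"
    by (intro tendsto_intros)
  then have 1: "\<forall>\<^sub>F d in at_right 0. 0 < 1 - L * ((1 + d) ^ n - 1) - (1 - \<epsilon>) * (1 + d)"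
    using assms by (intro order_tendstoD(1)) auto
  have "((\<lambda>d. 1 - L * ((1 + d) ^ n - 1)) \<longlongrightarrow> 1 - L * ((1 + 0) ^ n - 1)) (at_right 0)"
    by (intro tendsto_intros)
  then have 2: "\<forall>\<^sub>F d in at_right 0. 0 < 1 - L * ((1 + d) ^ n - 1)"
    by (intro order_tendstoD(1)) auto
  have 3: "\<forall>\<^sub>F d in at_right (0::real). d \<in> {0<..<1}" by (rule eventually_at_right_real) simp
  have "\<forall>\<^sub>F d in at_right 0. 0 < d \<and> d \<le> 1 \<and> (1 - \<epsilon>) * (1 + d) \<le> 1 - L * ((1 + d) ^ n - 1) \<and> 0 < 1 - L * ((1 + d) ^ n - 1)"
    using 1 2 3 by eventually_elim auto
  then show ?thesis using eventually_happens'[OF trivial_limit_at_right_real] by blast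
qed

text \<open>Closeness to a cube as a sandwich between dilates of \<open>K\<close>. The Auerbach matrix brings \<open>K\<close> into contact position
  without losing closeness, since it is nearly a signed permutation. The first alternative is the equality case.\<close>
lemma near_cube:
  assumes n2: "2 \<le> CARD('n::{finite,wellorder})"
  shows "\<exists>\<delta>>0. \<forall>(K :: (real^'n::_) set) a b (f :: real^'n::_ \<Rightarrow> real^'n::_).
    compact K \<longrightarrow> convex K \<longrightarrow> (\<forall>x\<in>K. - x \<in> K) \<longrightarrow> linear f \<longrightarrow> inj f \<longrightarrow> 0 < a \<longrightarrow> 0 < b \<longrightarrow> b / a \<le> 1 + \<delta> \<longrightarrow>
    (\<lambda>x. a *\<^sub>R x) ` K \<subseteq> f ` unit_cube \<longrightarrow> f ` unit_cube \<subseteq> (\<lambda>x. b *\<^sub>R x) ` K \<longrightarrow>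
    (\<exists>g :: real^'n::_ \<Rightarrow> real^'n::_. linear g \<and> inj g \<and> K = g ` unit_cube \<and> volume_product K = volume_product (unit_cube :: (real^'n::_) set)) \<or>
    volume_product (unit_cube :: (real^'n::_) set) < volume_product K"
proof -
  obtain \<epsilon> where \<epsilon>: "0 < \<epsilon>" "\<epsilon> < 1" and np: "\<And>K :: (real^'n::_) set.
    compact K \<Longrightarrow> convex K \<Longrightarrow> (\<forall>x\<in>K. - x \<in> K) \<Longrightarrow> (\<forall>i. axis i 1 \<in> K) \<Longrightarrow> K \<subseteq> unit_cube \<Longrightarrow>
    (\<forall>x\<in>unit_cube. (1 - \<epsilon>) *\<^sub>R x \<in> K) \<Longrightarrow>
    K = unit_cube \<or> volume_product (unit_cube :: (real^'n::_) set) < volume_product K"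
    using normal_position[OF n2] by blast
  define L where "L = 1 + 4 * real CARD('n) * fact CARD('n)"
  obtain \<delta> where \<delta>: "0 < \<delta>" "\<delta> \<le> 1" "(1 - \<epsilon>) * (1 + \<delta>) \<le> 1 - L * ((1 + \<delta>) ^ CARD('n) - 1)"
    "0 < 1 - L * ((1 + \<delta>) ^ CARD('n) - 1)"
    using small_delta[OF \<epsilon>(1)] by blast
  show ?thesis
  proof (rule exI[of _ \<delta>], intro conjI allI impI)
    show "0 < \<delta>" by (rule \<delta>(1))
    fix K :: "(real^'n::_) set" and a b :: real and f :: "real^'n::_ \<Rightarrow> real^'n::_"
    assume K: "compact K" "convex K" "\<forall>x\<in>K. - x \<in> K" and f: "linear f" "inj f" and ab: "0 < a" "0 < b" "b / a \<le> 1 + \<delta>"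
      and sub1: "(\<lambda>x. a *\<^sub>R x) ` K \<subseteq> f ` unit_cube" and sub2: "f ` unit_cube \<subseteq> (\<lambda>x. b *\<^sub>R x) ` K"
    obtain g where g: "linear g" "\<And>x. g (f x) = x" "\<And>x. f (g x) = x"
      using linear_injective_isomorphism[OF f] by blast
    define h where "h = (\<lambda>x. a *\<^sub>R g x)"
    define h' where "h' = (\<lambda>x. (1 / a) *\<^sub>R f x)"
    have h: "linear h" unfolding h_def using g(1) by (rule linear_compose_scale_right)
    have h': "linear h'" unfolding h'_def using f(1) by (rule linear_compose_scale_right)
    have hh: "h (h' x) = x" "h' (h x) = x" for x
      using ab(1) linear_scale[OF g(1)] linear_scale[OF f(1)] by (simp_all add: h_def h'_def g)
    define K1 where "K1 = h ` K"
    have K1: "compact K1" "convex K1" "\<And>x. x \<in> K1 \<Longrightarrow> - x \<in> K1"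
    proof -
      show "compact K1" unfolding K1_def by (rule compact_linear_vec_image[OF h K(1)])
      show "convex K1" unfolding K1_def using h K(2) by (rule convex_linear_image)
      show "- x \<in> K1" if "x \<in> K1" for x
        using neg_linear_image[OF h K(3)] that unfolding K1_def by blast
    qed
    have K1c: "K1 \<subseteq> unit_cube"
    proof
      fix y assume "y \<in> K1"
      then obtain x where x: "x \<in> K" "y = a *\<^sub>R g x" by (auto simp: K1_def h_def)
      from subsetD[OF sub1 imageI[OF x(1)]] obtain z where z: "z \<in> unit_cube" "a *\<^sub>R x = f z"
        by (elim imageE) (rule that)
      have "y = g (a *\<^sub>R x)" using linear_scale[OF g(1)] x(2) by simp
      then show "y \<in> unit_cube" using z by (simp add: g)
    qed
    define t where "t = a / b"
    have t0: "0 < t" using ab by (simp add: t_def)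
    have tK: "t *\<^sub>R x \<in> K1" if xc: "x \<in> unit_cube" for x
    proof -
      from subsetD[OF sub2 imageI[OF xc]] obtain k where k: "k \<in> K" "f x = b *\<^sub>R k" by (elim imageE) (rule that)
      have "x = g (b *\<^sub>R k)" using k(2) g(2)[of x] by simp
      then have "t *\<^sub>R x = h k" using ab linear_scale[OF g(1)] by (simp add: t_def h_def)
      then show ?thesis using k(1) by (simp add: K1_def)
    qed
    define s where "s = 1 / t"
    have s: "s \<le> 1 + \<delta>" using ab by (simp add: s_def t_def)
    have s1: "1 \<le> s"
    proof -
      have "t *\<^sub>R (\<chi> i. 1) \<in> unit_cube" using tK[of "\<chi> i. 1"] K1c by (auto simp: mem_unit_cube)
      then have "t \<le> 1" using t0 by (simp add: mem_unit_cube)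
      then show ?thesis using t0 by (simp add: s_def)
    qed
    obtain F :: "real^'n::_^'n::_" where F: "1 \<le> det F" "\<forall>i. F $ i \<in> polar K1" "(\<lambda>x. F *v x) ` K1 \<subseteq> unit_cube"
      "\<forall>i. axis i 1 \<in> (\<lambda>x. F *v x) ` K1"
      using auerbach_position[OF K1 K1c t0 tK] by blast
    have "invertible F" using F(1) by (simp add: invertible_det_nz)
    then obtain Fi where Fi: "F ** Fi = mat 1" "Fi ** F = mat 1" unfolding invertible_def by blast
    define u where "u = (\<lambda>x. F *v h x)"
    define u' where "u' = (\<lambda>x. h' (Fi *v x))"
    have lin: "linear u" "linear u'" unfolding u_def u'_def
      using linear_compose[OF h matrix_vector_mul_linear] linear_compose[OF matrix_vector_mul_linear h'] by (simp_all add: o_def)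
    have uu: "u (u' x) = x" "u' (u x) = x" for x
      by (simp_all add: u_def u'_def hh matrix_vector_mul_assoc Fi)
    define K2 where "K2 = u ` K"
    have K2F: "K2 = (\<lambda>x. F *v x) ` K1" unfolding K2_def K1_def u_def image_image ..
    have K2: "compact K2" "convex K2" "\<forall>x\<in>K2. - x \<in> K2"
    proof -
      show "compact K2" unfolding K2_def by (rule compact_linear_vec_image[OF lin(1) K(1)])
      show "convex K2" unfolding K2_def using lin(1) K(2) by (rule convex_linear_image)
      show "\<forall>x\<in>K2. - x \<in> K2"
        using neg_linear_image[OF lin(1) K(3)] unfolding K2_def by blast
    qed
    have inner: "\<forall>x\<in>unit_cube. (1 - \<epsilon>) *\<^sub>R x \<in> K2"
    proof
      fix y :: "real^'n::_" assume y: "y \<in> unit_cube"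
      define x where "x = Fi *v ((1 - \<epsilon>) *\<^sub>R y)"
      have Fx: "F *v x = (1 - \<epsilon>) *\<^sub>R y" by (simp add: x_def matrix_vector_mul_assoc Fi)
      have rows: "l1 (F $ i) \<le> s" for i using polar_l1_le[OF t0 tK] F(2) by (simp add: s_def)
      have pw: "s ^ CARD('n) \<le> (1 + \<delta>) ^ CARD('n)" using s s1 by (intro power_mono) auto
      have L0: "0 \<le> L" by (simp add: L_def)
      define q where "q = 1 - L * (s ^ CARD('n) - 1)"
      have q: "1 - L * ((1 + \<delta>) ^ CARD('n) - 1) \<le> q" unfolding q_def using pw L0 by (intro diff_left_mono mult_left_mono) auto
      have q0: "0 < q" using q \<delta>(4) by linarith
      have bound: "\<bar>x $ j\<bar> * q \<le> 1 - \<epsilon>" for j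
        unfolding q_def L_def
      proof (rule expanding_matrix[OF s1 _ rows])
        show "s \<le> 2" using s \<delta>(2) by linarith
        show "1 \<le> \<bar>det F\<bar>" using F(1) by linarith
        show "0 < 1 - (1 + 4 * real CARD('n) * fact CARD('n)) * (s ^ CARD('n) - 1)" using q0 unfolding q_def L_def .
        fix i
        have "\<bar>y $ i\<bar> \<le> 1" using y by (simp add: mem_unit_cube)
        then have "(1 - \<epsilon>) * \<bar>y $ i\<bar> \<le> (1 - \<epsilon>) * 1" using \<epsilon>(2) by (intro mult_left_mono) auto
        then show "\<bar>(F *v x) $ i\<bar> \<le> 1 - \<epsilon>" using \<epsilon>(2) by (simp add: Fx abs_mult)
      qed
      have "\<bar>(s *\<^sub>R x) $ j\<bar> \<le> 1" for j
      proof -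
        have "(1 - \<epsilon>) * s \<le> (1 - \<epsilon>) * (1 + \<delta>)" using s \<epsilon>(2) by (intro mult_left_mono) auto
        also have "\<dots> \<le> q" using \<delta>(3) q by linarith
        finally have "(1 - \<epsilon>) * s \<le> q" .
        moreover have "\<bar>x $ j\<bar> * q * s \<le> (1 - \<epsilon>) * s" using bound[of j] s1 by (intro mult_right_mono) auto
        ultimately have "(s * \<bar>x $ j\<bar>) * q \<le> 1 * q" by (simp add: mult_ac)
        then have "s * \<bar>x $ j\<bar> \<le> 1" using q0 by (rule mult_right_le_imp_le)
        then show ?thesis using s1 by (simp add: abs_mult)
      qed
      then have "s *\<^sub>R x \<in> unit_cube" by (simp add: mem_unit_cube)
      then have "t *\<^sub>R (s *\<^sub>R x) \<in> K1" by (rule tK)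
      then have "x \<in> K1" using t0 by (simp add: s_def)
      then show "(1 - \<epsilon>) *\<^sub>R y \<in> K2" unfolding K2F Fx[symmetric] by (rule imageI)
    qed
    have pK2: "compact (polar K2)" by (rule compact_polar[of "1 - \<epsilon>"]) (use \<epsilon> inner in auto)
    have Ku: "K = u' ` K2" unfolding K2_def image_image uu by simp
    have vp: "volume_product K = volume_product K2"
      unfolding Ku by (rule volume_product_linear_image[OF lin(2,1) uu(2,1)])
        (use K2(1) pK2 in \<open>auto intro: lmeasurable_compact\<close>)
    have "K2 = unit_cube \<or> volume_product (unit_cube :: (real^'n::_) set) < volume_product K2"
      by (rule np[OF K2 _ _ inner]) (use F(3,4) K2F in auto)
    then show "(\<exists>g :: real^'n::_ \<Rightarrow> real^'n::_. linear g \<and> inj g \<and> K = g ` unit_cube \<and> volume_product K = volume_product (unit_cube :: (real^'n::_) set)) \<or>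
      volume_product (unit_cube :: (real^'n::_) set) < volume_product K"
    proof
      assume "K2 = unit_cube"
      moreover have "inj u'" using uu(1) by (metis injI)
      ultimately show ?thesis using Ku vp lin(2) by blast
    qed (use vp in simp)
  qed
qed

section \<open>Relabelling coordinates by a well-ordered type\<close>

text \<open>The volume formulas above are over well-ordered index types. Numbering the coordinates carries the result over to
  every finite index type.\<close>
typedef ('n::finite) index = "{..<CARD('n)}" by (rule exI[of _ 0]) (simp add: card_gt_0_iff)

instance index :: (finite) finite
proof
  have "range (Rep_index :: 'a index \<Rightarrow> nat) \<subseteq> {..<CARD('a)}" using Rep_index by blast
  then have "finite (range (Rep_index :: 'a index \<Rightarrow> nat))" by (rule finite_subset) simp
  then show "finite (UNIV :: 'a index set)"
    by (rule finite_imageD) (rule inj_onI, simp only: Rep_index_inject)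
qed

instantiation index :: (finite) wellorder
begin

definition less_eq_index :: "'a index \<Rightarrow> 'a index \<Rightarrow> bool" where
  "less_eq_index i j \<longleftrightarrow> Rep_index i \<le> Rep_index j"

definition less_index :: "'a index \<Rightarrow> 'a index \<Rightarrow> bool" where
  "less_index i j \<longleftrightarrow> Rep_index i < Rep_index j"

instance
proof
  fix P :: "'a index \<Rightarrow> bool" and i
  assume step: "\<And>x. (\<And>y. y < x \<Longrightarrow> P y) \<Longrightarrow> P x"
  show "P i"
  proof (induction "Rep_index i" arbitrary: i rule: less_induct)
    case less
    show ?case by (rule step) (use less in \<open>simp add: less_index_def\<close>)
  qed
qed (auto simp: less_eq_index_def less_index_def Rep_index_inject)

end

lemma card_index: "CARD('n::finite index) = CARD('n)"
  using type_definition.card[OF type_definition_index[where 'n='n]] by simp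

definition index_bij :: "'n::finite index \<Rightarrow> 'n" where
  "index_bij = (SOME h. bij h)"

lemma bij_index_bij: "bij (index_bij :: 'n::finite index \<Rightarrow> 'n)"
proof -
  have "\<exists>h. bij_betw h (UNIV :: 'n index set) (UNIV :: 'n set)"
    by (rule finite_same_card_bij) (simp_all add: card_index)
  then show ?thesis unfolding index_bij_def by (rule someI_ex)
qed

lemma index_bij_inv: "index_bij (inv index_bij i) = i" "inv index_bij (index_bij k) = k"
  by (rule surj_f_inv_f[OF bij_is_surj[OF bij_index_bij]], rule inv_f_f[OF bij_is_inj[OF bij_index_bij]])

definition relabel :: "real^'n::finite \<Rightarrow> real^('n index)" where
  "relabel x = (\<chi> k. x $ index_bij k)"

definition unrelabel :: "real^('n::finite index) \<Rightarrow> real^'n" where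
  "unrelabel y = (\<chi> i. y $ inv index_bij i)"

lemma relabel_inverse [simp]: "unrelabel (relabel x) = x" "relabel (unrelabel y) = y"
  by (simp_all add: relabel_def unrelabel_def vec_eq_iff index_bij_inv)

lemma linear_relabel: "linear relabel" "linear unrelabel"
  by (auto intro!: linearI simp: relabel_def unrelabel_def vec_eq_iff)

lemma inner_relabel: "relabel x \<bullet> relabel y = x \<bullet> (y :: real^'n::finite)"
  unfolding inner_vec_sum relabel_def vec_lambda_beta
  by (rule sum.reindex_bij_betw[OF bij_index_bij, of "\<lambda>i. x $ i * y $ i"])

lemma relabel_unit_cube: "relabel ` (unit_cube :: (real^'n::finite) set) = unit_cube"
proof
  show "relabel ` (unit_cube :: (real^'n) set) \<subseteq> unit_cube" by (auto simp: relabel_def mem_unit_cube)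
  show "unit_cube \<subseteq> relabel ` (unit_cube :: (real^'n) set)"
  proof
    fix y :: "real^('n index)" assume "y \<in> unit_cube"
    then have "unrelabel y \<in> unit_cube" by (auto simp: unrelabel_def mem_unit_cube)
    then show "y \<in> relabel ` (unit_cube :: (real^'n) set)" by (metis image_eqI relabel_inverse(2))
  qed
qed

lemma unrelabel_unit_cube: "unrelabel ` (unit_cube :: (real^('n::finite index)) set) = unit_cube"
  unfolding relabel_unit_cube[symmetric] image_image by simp

lemma polar_relabel: "polar (relabel ` K) = relabel ` polar K"
proof (intro set_eqI iffI)
  fix \<xi> assume "\<xi> \<in> polar (relabel ` K)"
  then have "relabel x \<bullet> relabel (unrelabel \<xi>) \<le> 1" if "x \<in> K" for x using that by (simp add: polar_def)
  then have "unrelabel \<xi> \<in> polar K" by (simp add: polar_def inner_relabel del: relabel_inverse)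
  then show "\<xi> \<in> relabel ` polar K" by (metis image_eqI relabel_inverse(2))
next
  fix \<xi> assume "\<xi> \<in> relabel ` polar K"
  then show "\<xi> \<in> polar (relabel ` K)" by (auto simp: polar_def inner_relabel)
qed

lemma prod_Basis_cart: "(\<Prod>b\<in>(Basis :: (real^'n::finite) set). f (x \<bullet> b)) = (\<Prod>i\<in>UNIV. f (x $ i))"
proof -
  have B: "(Basis :: (real^'n) set) = range (\<lambda>i. axis i 1)" by (auto simp: Basis_vec_def)
  have "inj (\<lambda>i. axis i (1::real) :: real^'n)" by (auto simp: inj_on_def axis_eq_axis)
  then show ?thesis unfolding B by (subst prod.reindex) (simp_all add: inner_axis)
qed

lemma lborel_relabel: "distr lborel borel relabel = (lborel :: (real^('n::finite index)) measure)"
proof (rule lborel_eqI[symmetric])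
  have meas: "relabel \<in> borel_measurable (borel :: (real^'n) measure)"
    by (rule borel_measurable_continuous_onI[OF linear_continuous_on[OF linear_conv_bounded_linear[THEN iffD1, OF linear_relabel(1)]]])
  fix l u :: "real^('n index)" assume lu: "\<And>b. b \<in> Basis \<Longrightarrow> l \<bullet> b \<le> u \<bullet> b"
  have "l $ k \<le> u $ k" for k using lu[of "axis k 1"] by (simp add: inner_axis)
  then have lu': "unrelabel l \<bullet> b \<le> unrelabel u \<bullet> b" if "b \<in> Basis" for b
    using that by (auto simp: Basis_vec_def inner_axis unrelabel_def)
  have "relabel -` box l u = box (unrelabel l) (unrelabel u)"
  proof (intro set_eqI iffI)
    fix x :: "real^'n" assume "x \<in> relabel -` box l u"
    then have "\<forall>k. l $ k < x $ index_bij k \<and> x $ index_bij k < u $ k" by (simp add: mem_box_cart relabel_def)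
    then have "l $ inv index_bij i < x $ i \<and> x $ i < u $ inv index_bij i" for i
      using index_bij_inv(1)[of i] by metis
    then show "x \<in> box (unrelabel l) (unrelabel u)" by (simp add: mem_box_cart unrelabel_def)
  next
    fix x :: "real^'n" assume "x \<in> box (unrelabel l) (unrelabel u)"
    then have "\<forall>i. l $ inv index_bij i < x $ i \<and> x $ i < u $ inv index_bij i" by (simp add: mem_box_cart unrelabel_def)
    then have "l $ k < x $ index_bij k \<and> x $ index_bij k < u $ k" for k
      using index_bij_inv(2)[of k] by metis
    then show "x \<in> relabel -` box l u" by (simp add: mem_box_cart relabel_def)
  qed
  then have "emeasure (distr lborel borel relabel) (box l u) = emeasure lborel (box (unrelabel l) (unrelabel u))"
    using meas by (simp add: emeasure_distr)
  also have "\<dots> = (\<Prod>b\<in>Basis. (unrelabel u - unrelabel l) \<bullet> b)" using lu' by (rule emeasure_lborel_box)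
  also have "(\<Prod>b\<in>Basis. (unrelabel u - unrelabel l) \<bullet> b) = (\<Prod>i\<in>UNIV. (u - l) $ inv index_bij i)"
    using prod_Basis_cart[of "\<lambda>t. t" "unrelabel u - unrelabel l"] by (simp add: unrelabel_def)
  also have "\<dots> = (\<Prod>k\<in>UNIV. (u - l) $ k)"
    by (rule prod.reindex_bij_betw[OF bij_imp_bij_inv[OF bij_index_bij], of "\<lambda>k. (u - l) $ k"])
  also have "\<dots> = (\<Prod>b\<in>Basis. (u - l) \<bullet> b)" using prod_Basis_cart[of "\<lambda>t. t" "u - l"] by simp
  finally show "emeasure (distr lborel borel relabel) (box l u) = (\<Prod>b\<in>Basis. (u - l) \<bullet> b)" .
qed simp

lemma compact_relabel:
  fixes S :: "(real^'n::finite) set"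
  assumes "compact S" shows "compact (relabel ` S)"
  using linear_relabel(1) assms by (rule compact_linear_vec_image)

lemma measure_relabel:
  fixes S :: "(real^'n::finite) set"
  assumes "compact S" shows "measure lebesgue (relabel ` S) = measure lebesgue S"
proof -
  have meas: "relabel \<in> borel_measurable (borel :: (real^'n) measure)"
    by (rule borel_measurable_continuous_onI[OF linear_continuous_on[OF linear_conv_bounded_linear[THEN iffD1, OF linear_relabel(1)]]])
  have b: "relabel ` S \<in> sets borel" using compact_relabel[OF assms] by (rule borel_compact)
  have "relabel -` relabel ` S = S" by (metis inj_on_inverseI inj_vimage_image_eq relabel_inverse(1))
  then have "measure (distr lborel borel relabel) (relabel ` S) = measure lborel S"
    using meas b by (simp add: measure_distr)
  then have "measure lborel (relabel ` S) = measure lborel S" unfolding lborel_relabel .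
  moreover have "S \<in> sets borel" using assms by (rule borel_compact)
  ultimately show ?thesis using b by (simp add: measure_completion)
qed

lemma volume_product_relabel:
  assumes "compact K" "compact (polar K)"
  shows "volume_product (relabel ` K) = volume_product K"
  by (simp add: volume_product_def polar_relabel measure_relabel assms)

section \<open>The Banach-Mazur distance to the cube\<close>

text \<open>By symmetry and convexity, a ball inside \<open>K\<close> can be averaged with its reflection to a ball around the
  origin.\<close>
lemma convex_body_contains_cube:
  fixes K :: "(real^'n::finite) set"
  assumes "convex_body K" "origin_symmetric K"
  shows "\<exists>t>0. \<forall>x\<in>unit_cube. t *\<^sub>R x \<in> K"
proof -
  have K: "convex K" "interior K \<noteq> {}" using assms(1) by (auto simp: convex_body_def)
  have sym: "- x \<in> K" if "x \<in> K" for x using assms(2) that unfolding origin_symmetric_def by blast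
  obtain z e where z: "0 < e" "ball z e \<subseteq> K" using K(2) by (meson ex_in_conv mem_interior)
  have ball: "y \<in> K" if y: "norm y < e" for y
  proof -
    have "z + y \<in> K" using y z(2) by (auto simp: dist_norm)
    moreover have "z - y \<in> K" using y z(2) by (auto simp: dist_norm)
    then have "- (z - y) \<in> K" by (rule sym)
    ultimately have "(1/2) *\<^sub>R (z + y) + (1/2) *\<^sub>R (- (z - y)) \<in> K" using K(1) by (intro convexD) auto
    moreover have "(1/2) *\<^sub>R (z + y) + (1/2) *\<^sub>R (- (z - y)) = y" by (simp add: algebra_simps flip: scaleR_add_left)
    ultimately show ?thesis by simp
  qed
  let ?n = "real CARD('n)"
  have n1: "1 \<le> ?n" by (simp add: Suc_le_eq)
  show ?thesis
  proof (rule exI[of _ "e / (2 * ?n)"], intro conjI ballI)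
    show "0 < e / (2 * ?n)" using z(1) n1 by simp
    fix x :: "real^'n" assume x: "x \<in> unit_cube"
    have "l1 x \<le> (\<Sum>i\<in>(UNIV::'n set). 1)" unfolding l1_def using x by (intro sum_mono) (simp add: mem_unit_cube)
    then have nx: "norm x \<le> ?n" using norm_le_l1_vec[of x] by simp
    have "norm ((e / (2 * ?n)) *\<^sub>R x) = e / (2 * ?n) * norm x" using z(1) n1 by simp
    also have "\<dots> \<le> e / (2 * ?n) * ?n" using nx z(1) n1 by (intro mult_left_mono) auto
    also have "\<dots> < e" using z(1) n1 by simp
    finally show "(e / (2 * ?n)) *\<^sub>R x \<in> K" by (rule ball)
  qed
qed

text \<open>The set whose infimum is the Banach-Mazur distance; it is nonempty for the bodies considered, so a distance
  below \<open>1 + \<delta>\<close> is witnessed by an actual sandwich.\<close>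
definition ratios :: "(real^'n::finite) set \<Rightarrow> (real^'n) set \<Rightarrow> real set" where
  "ratios K L = {b / a | a b. a > 0 \<and> b > 0 \<and>
      (\<exists>T :: real ^ 'n ^ 'n. invertible T \<and>
        (\<lambda>x. a *\<^sub>R x) ` K \<subseteq> (\<lambda>x. T *v x) ` L \<and>
        (\<lambda>x. T *v x) ` L \<subseteq> (\<lambda>x. b *\<^sub>R x) ` K)}"

lemma banach_mazur_ratios: "banach_mazur_dist K L = Inf (ratios K L)"
  unfolding banach_mazur_dist_def ratios_def ..

lemma ratiosD:
  assumes "r \<in> ratios K L"
  shows "\<exists>a b (T :: real^'n^'n::finite). r = b / a \<and> 0 < a \<and> 0 < b \<and> invertible T \<and>
    (\<lambda>x. a *\<^sub>R x) ` K \<subseteq> (\<lambda>x. T *v x) ` L \<and> (\<lambda>x. T *v x) ` L \<subseteq> (\<lambda>x. b *\<^sub>R x) ` K"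
  using assms unfolding ratios_def by (elim CollectE exE conjE) (intro exI conjI; assumption)

text \<open>Compare the norm of a farthest point of \<open>K\<close> on both sides of \<open>a K \<subseteq> b K\<close>.\<close>
lemma ratios_ge_1:
  fixes K :: "(real^'n::finite) set"
  assumes K: "convex_body K" "origin_symmetric K" and r: "r \<in> ratios K L"
  shows "1 \<le> r"
proof -
  from ratiosD[OF r] obtain a b and T :: "real^'n^'n" where T: "r = b / a" "0 < a" "0 < b" "invertible T"
      "(\<lambda>x. a *\<^sub>R x) ` K \<subseteq> (\<lambda>x. T *v x) ` L" "(\<lambda>x. T *v x) ` L \<subseteq> (\<lambda>x. b *\<^sub>R x) ` K"
    by (elim exE conjE) (rule that)
  note ab = T(1-3) subset_trans[OF T(5,6)]
  have comp: "compact K" using K(1) by (simp add: convex_body_def)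
  obtain t where t: "0 < t" "\<forall>x\<in>unit_cube. t *\<^sub>R x \<in> K" using convex_body_contains_cube[OF K] by blast
  have e: "t *\<^sub>R (\<chi> i. 1) \<in> K" using t(2) by (simp add: mem_unit_cube)
  then have "K \<noteq> {}" by blast
  then obtain x where x: "x \<in> K" "\<forall>y\<in>K. norm y \<le> norm x"
    using continuous_attains_sup[OF comp, of norm] continuous_on_norm_id by blast
  have "(t *\<^sub>R (\<chi> i. 1) :: real^'n) \<noteq> 0" using t(1) by (simp add: vec_eq_iff)
  then have "0 < norm (t *\<^sub>R (\<chi> i. 1) :: real^'n)" by simp
  then have nx: "0 < norm x" using x(2) e by fastforce
  from subsetD[OF ab(4) imageI[OF x(1)]] obtain y where y: "y \<in> K" "a *\<^sub>R x = b *\<^sub>R y" by (elim imageE) (rule that)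
  have "a * norm x = b * norm y" using arg_cong[OF y(2), of norm] ab by simp
  also have "\<dots> \<le> b * norm x" using x(2) y(1) ab by (intro mult_left_mono) auto
  finally have "a \<le> b" using nx by simp
  then show ?thesis using ab by simp
qed

lemma ratios_nonempty:
  fixes K :: "(real^'n::finite) set"
  assumes K: "convex_body K" "origin_symmetric K"
  shows "ratios K unit_cube \<noteq> {}"
proof -
  obtain t where t: "0 < t" "\<forall>x\<in>unit_cube. t *\<^sub>R x \<in> K" using convex_body_contains_cube[OF K] by blast
  have "bounded K" using K(1) by (simp add: convex_body_def compact_imp_bounded)
  then obtain B where B: "0 < B" "\<And>x. x \<in> K \<Longrightarrow> norm x \<le> B" by (meson bounded_pos)
  have s1: "(\<lambda>x. (1 / B) *\<^sub>R x) ` K \<subseteq> (\<lambda>x. mat 1 *v x) ` unit_cube"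
  proof (rule image_subsetI)
    fix x assume "x \<in> K"
    then have "\<bar>x $ i\<bar> \<le> B" for i using B(2)[of x] component_le_norm_cart[of x i] by linarith
    then have "(1 / B) *\<^sub>R x \<in> unit_cube" using B(1) by (simp add: mem_unit_cube abs_mult)
    then show "(1 / B) *\<^sub>R x \<in> (\<lambda>x. mat 1 *v x) ` unit_cube" by simp
  qed
  have s2: "(\<lambda>x. mat 1 *v x) ` unit_cube \<subseteq> (\<lambda>x. (1 / t) *\<^sub>R x) ` K"
  proof (rule image_subsetI)
    fix x :: "real^'n" assume "x \<in> unit_cube"
    then have "t *\<^sub>R x \<in> K" using t(2) by blast
    then show "mat 1 *v x \<in> (\<lambda>x. (1 / t) *\<^sub>R x) ` K"
      using t(1) by (intro image_eqI[of _ _ "t *\<^sub>R x"]) simp_all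
  qed
  have inv: "invertible (mat 1 :: real^'n^'n)" by (simp add: invertible_det_nz)
  have "(1 / t) / (1 / B) \<in> ratios K unit_cube"
    unfolding ratios_def
  proof (rule CollectI, rule exI[of _ "1 / B"], rule exI[of _ "1 / t"], intro conjI refl)
    show "\<exists>T :: real^'n^'n. invertible T \<and> (\<lambda>x. (1 / B) *\<^sub>R x) ` K \<subseteq> (\<lambda>x. T *v x) ` unit_cube \<and>
        (\<lambda>x. T *v x) ` unit_cube \<subseteq> (\<lambda>x. (1 / t) *\<^sub>R x) ` K"
      using s1 s2 inv by (intro exI[of _ "mat 1"] conjI)
  qed (use t(1) B(1) in simp_all)
  then show ?thesis by blast
qed

theorem mainTheorem1:
  assumes "2 \<le> CARD('n::finite)"
  shows "\<exists>\<delta>>0. \<forall>K :: (real ^ 'n) set.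
    convex_body K \<and> origin_symmetric K \<and> banach_mazur_dist K unit_cube \<le> 1 + \<delta> \<longrightarrow>
      volume_product K \<ge> volume_product (unit_cube :: (real ^ 'n) set) \<and>
      (volume_product K = volume_product (unit_cube :: (real ^ 'n) set) \<longrightarrow>
        banach_mazur_dist K unit_cube = 1 \<and> parallelepiped K)"
proof -
  have n2: "2 \<le> CARD('n index)" using assms by (simp add: card_index)
  obtain \<delta> where \<delta>: "0 < \<delta>" and near: "\<And>(K :: (real^('n index)) set) a b (f :: real^('n index) \<Rightarrow> real^('n index)).
    compact K \<Longrightarrow> convex K \<Longrightarrow> (\<forall>x\<in>K. - x \<in> K) \<Longrightarrow> linear f \<Longrightarrow> inj f \<Longrightarrow> 0 < a \<Longrightarrow> 0 < b \<Longrightarrow> b / a \<le> 1 + \<delta> \<Longrightarrow>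
    (\<lambda>x. a *\<^sub>R x) ` K \<subseteq> f ` unit_cube \<Longrightarrow> f ` unit_cube \<subseteq> (\<lambda>x. b *\<^sub>R x) ` K \<Longrightarrow>
    (\<exists>g :: real^('n index) \<Rightarrow> real^('n index). linear g \<and> inj g \<and> K = g ` unit_cube \<and> volume_product K = volume_product (unit_cube :: (real^('n index)) set)) \<or>
    volume_product (unit_cube :: (real^('n index)) set) < volume_product K"
    using near_cube[OF n2] by blast
  have vpc: "volume_product (unit_cube :: (real^('n index)) set) = volume_product (unit_cube :: (real^'n) set)"
    using volume_product_relabel[OF compact_unit_cube compact_polar_cube, where 'a='n] by (simp add: relabel_unit_cube)
  show ?thesis
  proof (rule exI[of _ "\<delta> / 2"], intro conjI allI impI)
    show "0 < \<delta> / 2" using \<delta> by simp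
    fix K :: "(real^'n) set"
    assume hyp: "convex_body K \<and> origin_symmetric K \<and> banach_mazur_dist K unit_cube \<le> 1 + \<delta> / 2"
    then have K: "convex_body K" "origin_symmetric K" by blast+
    have "Inf (ratios K unit_cube) < 1 + \<delta>" using hyp \<delta> by (simp add: banach_mazur_ratios)
    then obtain r where r: "r \<in> ratios K unit_cube" "r < 1 + \<delta>"
      using cInf_lessD[OF ratios_nonempty[OF K]] by blast
    from ratiosD[OF r(1)] obtain a b T where T: "r = b / a" "0 < a" "0 < b" "invertible (T :: real^'n^'n)"
      "(\<lambda>x. a *\<^sub>R x) ` K \<subseteq> (\<lambda>x. T *v x) ` unit_cube" "(\<lambda>x. T *v x) ` unit_cube \<subseteq> (\<lambda>x. b *\<^sub>R x) ` K"
      by (elim exE conjE) (rule that)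
    have Kc: "compact K" "convex K" using K(1) by (auto simp: convex_body_def)
    have sym: "- x \<in> K" if "x \<in> K" for x using K(2) that unfolding origin_symmetric_def by blast
    obtain t where t: "0 < t" "\<forall>x\<in>unit_cube. t *\<^sub>R x \<in> K" using convex_body_contains_cube[OF K] by blast
    have pK: "compact (polar K)" by (rule compact_polar[OF t(1)]) (use t(2) in auto)
    have vpK: "volume_product (relabel ` K) = volume_product K" by (rule volume_product_relabel[OF Kc(1) pK])
    define f where "f = (\<lambda>y. relabel (T *v unrelabel y))"
    have inj_rel: "inj (relabel :: real^'n \<Rightarrow> _)" "inj (unrelabel :: _ \<Rightarrow> real^'n)"
      by (metis injI relabel_inverse(1), metis injI relabel_inverse(2))
    have linf: "linear f" unfolding f_def
      using linear_compose[OF linear_compose[OF linear_relabel(2) matrix_vector_mul_linear[of T]] linear_relabel(1)] by (simp add: o_def)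
    have injT: "inj (\<lambda>x. T *v x)" using T(4) by (simp add: inj_matrix_vector_mult)
    have injf: "inj f"
      using inj_compose[OF inj_compose[OF inj_rel(1) injT] inj_rel(2)] unfolding f_def o_def .
    have fcube: "f ` unit_cube = relabel ` (\<lambda>x. T *v x) ` unit_cube"
    proof -
      have "f ` unit_cube = relabel ` (\<lambda>x. T *v x) ` unrelabel ` unit_cube" by (simp only: f_def image_image)
      then show ?thesis by (simp only: unrelabel_unit_cube)
    qed
    have scale: "(\<lambda>x. c *\<^sub>R x) ` relabel ` S = relabel ` (\<lambda>x. c *\<^sub>R x) ` S" for c and S :: "(real^'n) set"
      unfolding image_image linear_scale[OF linear_relabel(1)] ..
    have "(\<exists>g :: real^('n index) \<Rightarrow> real^('n index). linear g \<and> inj g \<and> relabel ` K = g ` unit_cube \<and> volume_product (relabel ` K) = volume_product (unit_cube :: (real^('n index)) set)) \<or>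
      volume_product (unit_cube :: (real^('n index)) set) < volume_product (relabel ` K)"
    proof (rule near[OF compact_relabel[OF Kc(1)] convex_linear_image[OF linear_relabel(1) Kc(2)] _ linf injf T(2,3)])
      show "\<forall>x\<in>relabel ` K. - x \<in> relabel ` K" using neg_linear_image[OF linear_relabel(1)] sym by blast
      show "b / a \<le> 1 + \<delta>" using r(2) T(1) by simp
      show "(\<lambda>x. a *\<^sub>R x) ` relabel ` K \<subseteq> f ` unit_cube" unfolding scale fcube using T(5) by (rule image_mono)
      show "f ` unit_cube \<subseteq> (\<lambda>x. b *\<^sub>R x) ` relabel ` K" unfolding scale fcube using T(6) by (rule image_mono)
    qed
    then consider (cube) g :: "real^('n index) \<Rightarrow> real^('n index)" where "linear g" "inj g" "relabel ` K = g ` unit_cube"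
        "volume_product K = volume_product (unit_cube :: (real^'n) set)"
      | (less) "volume_product (unit_cube :: (real^'n) set) < volume_product K"
      unfolding vpK vpc by (elim disjE exE conjE)
    then have main: "volume_product (unit_cube :: (real^'n) set) \<le> volume_product K \<and>
       (volume_product K = volume_product (unit_cube :: (real^'n) set) \<longrightarrow> parallelepiped K)"
    proof cases
      case cube
      define G where "G = (\<lambda>x. unrelabel (g (relabel x)))"
      have linG: "linear G" unfolding G_def
        using linear_compose[OF linear_compose[OF linear_relabel(1) cube(1)] linear_relabel(2)] by (simp add: o_def)
      have injG: "inj G"
        using inj_compose[OF inj_compose[OF inj_rel(2) cube(2)] inj_rel(1)] unfolding G_def o_def .
      have "K = unrelabel ` relabel ` K" by (simp add: image_image)
      also have "\<dots> = unrelabel ` g ` relabel ` unit_cube" by (simp only: cube(3) relabel_unit_cube)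
      also have "\<dots> = G ` unit_cube" by (simp only: G_def image_image)
      finally have KG: "K = (\<lambda>x. matrix G *v x) ` unit_cube" using linG by simp
      have "invertible (matrix G)" using linG injG by (simp add: invertible_det_nz det_nz_iff_inj)
      then show ?thesis using KG cube(4) unfolding parallelepiped_def by auto
    next
      case less then show ?thesis by simp
    qed
    have bm: "banach_mazur_dist K unit_cube = 1" if par: "parallelepiped K"
      unfolding banach_mazur_ratios
    proof (rule cInf_eq_minimum)
      obtain P :: "real^'n^'n" where "invertible P" "K = (\<lambda>x. P *v x) ` unit_cube"
        using par unfolding parallelepiped_def by blast
      then show "1 \<in> ratios K unit_cube"
        unfolding ratios_def by (intro CollectI exI[of _ "1::real"]) auto
    qed (rule ratios_ge_1[OF K])
    show "volume_product (unit_cube :: (real^'n) set) \<le> volume_product K" using main by blast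
    show "banach_mazur_dist K unit_cube = 1" "parallelepiped K" if "volume_product K = volume_product (unit_cube :: (real^'n) set)"
      using main bm that by blast+
  qed
qed

end
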